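(* Let $p$ be an odd prime, let $C$ be the endomorphism dga defined in the context, and let $k$ be a nonzero integer. Then the multiplication $$H^{-(2p-2)k+1}(C)\otimes H^{(2p-2)k+1}(C)\longrightarrow H^2(C)$$ induced by the product of $C$ is injective.
   Context: Let $E(1)$ be the Adams summand of $p$-local complex $K$-theory, $E(1)_*=\mathbb{Z}_{(p)}[v_1,v_1^{-1}]$ with $|v_1|=2p-2$, and let $\mathcal{B}$ be the abelian category of $E(1)_*E(1)$-comodules concentrated in degrees divisible by $2p-2$. Fix an integer $r$ whose class generates the cyclic group $(\mathbb{Z}/p^2)^\times$, and let $\Psi^r$ be the $r$-th Adams operation on $E(1)$, so $\Psi^r(v_1)=r^{p-1}v_1$. The Adams–Baird–Ravenel resolution of $E(1)_*$ in $\mathcal{B}$ is the exact sequence $$0\to E(1)_*\to I^0\xrightarrow{\ d\ }I^1\xrightarrow{\ d\ }I^2\to 0,\qquad I^0=I^1=E(1)_*E(1),\quad I^2=E(1)_*\otimes\mathbb{Q},$$ where $d:I^0\to I^1$ is $E(1)_*(\Psi^r-1)$ and $d:I^1\to I^2$ is the map $q$ induced on $E(1)_*(-)$ by the map of spectra $E(1)\to H\mathbb{Q}$ that is a rational isomorphism on $\pi_0$ and zero on other homotopy groups. Put $I^j=0$ for $j\notin\{0,1,2\}$. For $M,N\in\mathcal{B}$ let $\mathrm{Hom}_{\mathcal{B}}(M_{*-t},N_* )$ denote the $\mathbb{Z}_{(p)}$-module of comodule maps $M\to N$ raising the internal degree by $t$. The endomorphism dga $C$ (of the periodized resolution, a replacement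 of the compact generator of Franke's exotic algebraic model) is the cochain complex with $$C^n=\prod_{s+t=n,\ i}\mathrm{Hom}_{\mathcal{B}}\big((I^i)_{*-t},(I^{i+s})_*\big),$$ with differential $C^n\to C^{n+1}$ given by $f\mapsto d\circ f+(-1)^{n+1}f\circ d$ and product given by composition of morphisms. The tensor product is over $\mathbb{Z}_{(p)}$, with $H^n(C)$ the cohomology of $C$. *)

theory Defs
  imports
    "HOL-Algebra.Free_Abelian_Groups"
    "HOL-Algebra.Generated_Groups"
    "HOL-Algebra.Module"
    "HOL-Number_Theory.Residues"
    "HOL-Library.Product_Plus"
    "HOL-Library.Poly_Mapping"
begin

section \<open>Tensor products over a commutative ring\<close>

definition tensor_rels ::
  "('r, 'x) ring_scheme \<Rightarrow> ('r, 'a, 'y) module_scheme \<Rightarrow> ('r, 'b, 'z) module_scheme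
    \<Rightarrow> ('a \<times> 'b \<Rightarrow>\<^sub>0 int) set"
  where "tensor_rels R M N =
    generate (free_Abelian_group (carrier M \<times> carrier N))
     ({frag_of (x \<oplus>\<^bsub>M\<^esub> x', y) - frag_of (x, y) - frag_of (x', y) | x x' y.
         x \<in> carrier M \<and> x' \<in> carrier M \<and> y \<in> carrier N} \<union>
      {frag_of (x, y \<oplus>\<^bsub>N\<^esub> y') - frag_of (x, y) - frag_of (x, y') | x y y'.
         x \<in> carrier M \<and> y \<in> carrier N \<and> y' \<in> carrier N} \<union>
      {frag_of (a \<odot>\<^bsub>M\<^esub> x, y) - frag_of (x, a \<odot>\<^bsub>N\<^esub> y) | a x y.
         a \<in> carrier R \<and> x \<in> carrier M \<and> y \<in> carrier N})"

text \<open>The underlying abelian group of the tensor product, in multiplicative notation as a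
  quotient of a free abelian group.\<close>

definition tensor_product ::
  "('r, 'x) ring_scheme \<Rightarrow> ('r, 'a, 'y) module_scheme \<Rightarrow> ('r, 'b, 'z) module_scheme
    \<Rightarrow> ('a \<times> 'b \<Rightarrow>\<^sub>0 int) set monoid"
  where "tensor_product R M N =
    free_Abelian_group (carrier M \<times> carrier N) Mod tensor_rels R M N"

definition tensor_class ::
  "('r, 'x) ring_scheme \<Rightarrow> ('r, 'a, 'y) module_scheme \<Rightarrow> ('r, 'b, 'z) module_scheme
    \<Rightarrow> ('a \<times> 'b \<Rightarrow>\<^sub>0 int) \<Rightarrow> ('a \<times> 'b \<Rightarrow>\<^sub>0 int) set"
  where "tensor_class R M N c =
    tensor_rels R M N #>\<^bsub>free_Abelian_group (carrier M \<times> carrier N)\<^esub> c"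

text \<open>The homomorphism from a tensor product to a commutative group \<open>G\<close> (written
  multiplicatively) that is induced by a balanced map \<open>\<mu>\<close>. For balanced \<open>\<mu>\<close> the formal sums
  in one class all have the same image.\<close>

definition tensor_lift ::
  "('c, 'x) monoid_scheme \<Rightarrow> ('a \<times> 'b \<Rightarrow> 'c) \<Rightarrow> ('a \<times> 'b \<Rightarrow>\<^sub>0 int) set \<Rightarrow> 'c"
  where "tensor_lift G \<mu> X =
    the_elem ((\<lambda>c. finprod G (\<lambda>m. \<mu> m [^]\<^bsub>G\<^esub> Poly_Mapping.lookup c m) (Poly_Mapping.keys c)) ` X)"

section \<open>Graded left comodules and their morphisms\<close>

text \<open>\<open>coact\<close> takes values in \<open>G \<otimes>\<^sub>R M\<close>, where \<open>G\<close> is the right \<open>R\<close>-module underlying the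
  coalgebra; \<open>hcomp M m\<close> is the homogeneous component of degree \<open>m\<close>.\<close>

record ('r, 'g, 'a) comodule = "('r, 'a) module" +
  hcomp :: "int \<Rightarrow> 'a set"
  coact :: "'a \<Rightarrow> ('g \<times> 'a \<Rightarrow>\<^sub>0 int) set"

text \<open>Comodule maps raising the degree by \<open>t\<close>. They are normalised to vanish outside the
  carrier of the source, so that equality of maps is equality of functions. All comodules below
  live in even degrees, so no signs occur in linearity or in \<open>id \<otimes> f\<close>.\<close>

definition comodule_hom ::
  "('r, 'x) ring_scheme \<Rightarrow> ('r, 'g, 'y) module_scheme \<Rightarrow> int
    \<Rightarrow> ('r, 'g, 'a, 'z) comodule_scheme \<Rightarrow> ('r, 'g, 'b, 'w) comodule_scheme \<Rightarrow> ('a \<Rightarrow> 'b) set"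
  where "comodule_hom R G t M N =
    {f. (\<forall>x\<in>carrier M. f x \<in> carrier N) \<and>
        (\<forall>x. x \<notin> carrier M \<longrightarrow> f x = \<zero>\<^bsub>N\<^esub>) \<and>
        (\<forall>x\<in>carrier M. \<forall>y\<in>carrier M. f (x \<oplus>\<^bsub>M\<^esub> y) = f x \<oplus>\<^bsub>N\<^esub> f y) \<and>
        (\<forall>a\<in>carrier R. \<forall>x\<in>carrier M. f (a \<odot>\<^bsub>M\<^esub> x) = a \<odot>\<^bsub>N\<^esub> f x) \<and>
        (\<forall>m. \<forall>x\<in>hcomp M m. f x \<in> hcomp N (m + t)) \<and>
        (\<forall>x\<in>carrier M. coact N (f x) =
           tensor_lift (tensor_product R G N)
             (\<lambda>(g, y). tensor_class R G N (frag_of (g, f y))) (coact M x))}"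

section \<open>The Hopf algebroid \<open>(E(1)\<^sub>*, E(1)\<^sub>*E(1))\<close>\<close>

text \<open>Laurent polynomials in one, two and three variables over the rationals.\<close>

type_synonym laurent = "int \<Rightarrow>\<^sub>0 rat"
type_synonym laurent2 = "int \<times> int \<Rightarrow>\<^sub>0 rat"
type_synonym laurent3 = "int \<times> int \<times> int \<Rightarrow>\<^sub>0 rat"

definition change_exponents :: "('m \<Rightarrow> 'n) \<Rightarrow> ('m \<Rightarrow>\<^sub>0 rat) \<Rightarrow> ('n \<Rightarrow>\<^sub>0 rat)"
  where "change_exponents \<phi> f =
    (\<Sum>m\<in>Poly_Mapping.keys f. Poly_Mapping.single (\<phi> m) (Poly_Mapping.lookup f m))"

definition Zloc_set :: "nat \<Rightarrow> rat set"
  where "Zloc_set p = {of_int a / of_int b | a b. \<not> int p dvd b}"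

definition Zloc :: "nat \<Rightarrow> rat ring"
  where "Zloc p =
    \<lparr>carrier = Zloc_set p, monoid.mult = (*), one = 1, ring.zero = 0, add = (+)\<rparr>"

definition E1 :: "nat \<Rightarrow> laurent ring"
  where "E1 p =
    \<lparr>carrier = {f. \<forall>i. Poly_Mapping.lookup f i \<in> Zloc_set p},
     monoid.mult = (*), one = 1, ring.zero = 0, add = (+)\<rparr>"

text \<open>A two-variable Laurent polynomial \<open>f(u, w)\<close>, with \<open>u = \<eta>\<^sub>L v\<^sub>1\<close> and \<open>w = \<eta>\<^sub>R v\<^sub>1\<close>,
  evaluated at \<open>(k v\<^sub>1, l v\<^sub>1)\<close>.\<close>

definition eval2 :: "rat \<Rightarrow> rat \<Rightarrow> laurent2 \<Rightarrow> laurent"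
  where "eval2 k l f =
    (\<Sum>(a, b)\<in>Poly_Mapping.keys f.
       Poly_Mapping.single (a + b) (Poly_Mapping.lookup f (a, b) * k powi a * l powi b))"

text \<open>\<open>E(1)\<^sub>*E(1)\<close> is torsion-free, hence a subring of \<open>E(1)\<^sub>*E(1) \<otimes> \<rat> = \<rat>[u\<^sup>\<plusminus>, w\<^sup>\<plusminus>]\<close>; by the
  theorem of Adams, Harris and Switzer it consists of the Laurent polynomials that become
  integral under \<open>\<Psi>\<^sup>k \<and> \<Psi>\<^sup>l\<close> followed by multiplication, for all integers \<open>k\<close>, \<open>l\<close> prime to
  \<open>p\<close>, where \<open>\<Psi>\<^sup>k v\<^sub>1 = k\<^sup>p\<^sup>-\<^sup>1 v\<^sub>1\<close>.\<close>

definition E1E1 :: "nat \<Rightarrow> laurent2 set"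
  where "E1E1 p =
    {f. \<forall>k l :: int. \<not> int p dvd k \<longrightarrow> \<not> int p dvd l \<longrightarrow>
          eval2 (of_int k ^ (p - 1)) (of_int l ^ (p - 1)) f \<in> carrier (E1 p)}"

definition eta_L :: "laurent \<Rightarrow> laurent2"
  where "eta_L = change_exponents (\<lambda>i. (i, 0))"

definition eta_R :: "laurent \<Rightarrow> laurent2"
  where "eta_R = change_exponents (\<lambda>i. (0, i))"

definition left_E1_module :: "laurent2 set \<Rightarrow> (laurent, laurent2) module"
  where "left_E1_module S =
    \<lparr>carrier = S, monoid.mult = (*), one = 1, ring.zero = 0, add = (+),
     smult = (\<lambda>a x. eta_L a * x)\<rparr>"

definition right_E1E1 :: "nat \<Rightarrow> (laurent, laurent2) module"
  where "right_E1E1 p =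
    \<lparr>carrier = E1E1 p, monoid.mult = (*), one = 1, ring.zero = 0, add = (+),
     smult = (\<lambda>a x. eta_R a * x)\<rparr>"

text \<open>Since \<open>E(1)\<^sub>*E(1)\<close> is flat over \<open>E(1)\<^sub>*\<close>, its tensor square embeds into
  \<open>\<rat>[x\<^sup>\<plusminus>, y\<^sup>\<plusminus>, z\<^sup>\<plusminus>]\<close> by \<open>g \<otimes> h \<mapsto> g(x, y) h(y, z)\<close>, and the coproduct of \<open>f\<close> is the
  element corresponding to \<open>f(x, z)\<close>, that is \<open>u \<mapsto> u \<otimes> 1\<close> and \<open>w \<mapsto> 1 \<otimes> w\<close>.\<close>

definition tensor_value :: "(laurent2 \<times> laurent2 \<Rightarrow>\<^sub>0 int) \<Rightarrow> laurent3"
  where "tensor_value c =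
    (\<Sum>(g, h)\<in>Poly_Mapping.keys c. of_int (Poly_Mapping.lookup c (g, h)) *
       (change_exponents (\<lambda>(a, b). (a, b, 0)) g * change_exponents (\<lambda>(a, b). (0, a, b)) h))"

definition coproduct :: "nat \<Rightarrow> laurent2 \<Rightarrow> (laurent2 \<times> laurent2 \<Rightarrow>\<^sub>0 int) set"
  where "coproduct p f =
    (THE X. X \<in> carrier (tensor_product (E1 p) (right_E1E1 p) (left_E1_module (E1E1 p))) \<and>
       (\<forall>c\<in>X. tensor_value c = change_exponents (\<lambda>(a, b). (a, 0, b)) f))"

text \<open>The internal degree of \<open>u\<^sup>a w\<^sup>b\<close> is \<open>(2p - 2)(a + b)\<close>.\<close>

definition internal_comp :: "nat \<Rightarrow> laurent2 set \<Rightarrow> int \<Rightarrow> laurent2 set"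
  where "internal_comp p S m =
    {x \<in> S. \<forall>(a, b)\<in>Poly_Mapping.keys x. (2 * int p - 2) * (a + b) = m}"

section \<open>The Adams--Baird--Ravenel resolution\<close>

text \<open>\<open>E(1)\<^sub>* \<otimes> \<rat>\<close> is represented by its image \<open>\<rat>[u\<^sup>\<plusminus>]\<close> under \<open>\<eta>\<^sub>L\<close>, so that all terms of the
  resolution have elements of the same type. Its coaction is \<open>c u\<^sup>a \<mapsto> u\<^sup>a \<otimes> c\<close> for rational
  \<open>c\<close>.\<close>

definition E1Q :: "laurent2 set"
  where "E1Q = {f. \<forall>(a, b)\<in>Poly_Mapping.keys f. b = 0}"

definition coact_Q :: "nat \<Rightarrow> laurent2 set \<Rightarrow> laurent2 \<Rightarrow> (laurent2 \<times> laurent2 \<Rightarrow>\<^sub>0 int) set"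
  where "coact_Q p S f =
    tensor_class (E1 p) (right_E1E1 p) (left_E1_module S)
      (\<Sum>(a, b)\<in>Poly_Mapping.keys f.
         frag_of (Poly_Mapping.single (a, 0) 1,
                  Poly_Mapping.single (0, 0) (Poly_Mapping.lookup f (a, b))))"

definition res_obj :: "nat \<Rightarrow> int \<Rightarrow> (laurent, laurent2, laurent2) comodule"
  where "res_obj p j =
    (if j = 0 \<or> j = 1 then
       module.extend (left_E1_module (E1E1 p))
         (comodule.fields (internal_comp p (E1E1 p)) (coproduct p))
     else if j = 2 then
       module.extend (left_E1_module E1Q)
         (comodule.fields (internal_comp p E1Q) (coact_Q p E1Q))
     else
       module.extend (left_E1_module {0})
         (comodule.fields (internal_comp p {0}) (coact_Q p {0})))"

text \<open>\<open>E(1)\<^sub>*(\<Psi>\<^sup>r)\<close> acts on the second smash factor: it fixes \<open>u\<close> and multiplies \<open>w\<close> by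
  \<open>r\<^sup>p\<^sup>-\<^sup>1\<close>.\<close>

definition adams_op :: "nat \<Rightarrow> int \<Rightarrow> laurent2 \<Rightarrow> laurent2"
  where "adams_op p r f =
    (\<Sum>(a, b)\<in>Poly_Mapping.keys f.
       Poly_Mapping.single (a, b) (Poly_Mapping.lookup f (a, b) * (of_int r ^ (p - 1)) powi b))"

text \<open>The map induced by \<open>E(1) \<rightarrow> H\<rat>\<close> kills \<open>u\<^sup>a w\<^sup>b\<close> for \<open>b \<noteq> 0\<close> and sends \<open>u\<^sup>a\<close> to itself.\<close>

definition rational_map :: "laurent2 \<Rightarrow> laurent2"
  where "rational_map f =
    (\<Sum>(a, b)\<in>{m \<in> Poly_Mapping.keys f. snd m = 0}.
       Poly_Mapping.single (a, b) (Poly_Mapping.lookup f (a, b)))"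

definition res_d :: "nat \<Rightarrow> int \<Rightarrow> int \<Rightarrow> laurent2 \<Rightarrow> laurent2"
  where "res_d p r j x =
    (if x \<notin> carrier (res_obj p j) then 0
     else if j = 0 then adams_op p r x - x
     else if j = 1 then rational_map x
     else 0)"

section \<open>The endomorphism dga\<close>

text \<open>A cochain \<open>f\<close> of degree \<open>n\<close> has components \<open>f i s : I\<^sup>i \<rightarrow> I\<^sup>i\<^sup>+\<^sup>s\<close>, comodule maps raising
  the internal degree by \<open>t = n - s\<close>.\<close>

type_synonym cochain = "int \<Rightarrow> int \<Rightarrow> laurent2 \<Rightarrow> laurent2"

definition C_set :: "nat \<Rightarrow> int \<Rightarrow> cochain set"
  where "C_set p n =
    {f. \<forall>i s. f i s \<in>
       comodule_hom (E1 p) (right_E1E1 p) (n - s) (res_obj p i) (res_obj p (i + s))}"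

text \<open>The ring fields \<open>mult\<close> and \<open>one\<close> of a module record play no role in \<open>C\<^sup>n\<close> and \<open>H\<^sup>n\<close>.\<close>

definition C_module :: "nat \<Rightarrow> int \<Rightarrow> (rat, cochain) module"
  where "C_module p n =
    \<lparr>carrier = C_set p n, monoid.mult = undefined, one = undefined,
     ring.zero = (\<lambda>i s x. 0), add = (\<lambda>f g i s x. f i s x + g i s x),
     smult = (\<lambda>c f i s x. Poly_Mapping.single (0, 0) c * f i s x)\<rparr>"

definition C_d :: "nat \<Rightarrow> int \<Rightarrow> int \<Rightarrow> cochain \<Rightarrow> cochain"
  where "C_d p r n f = (\<lambda>i s x.
    res_d p r (i + s - 1) (f i (s - 1) x) +
    (if even (n + 1) then f (i + 1) (s - 1) (res_d p r i x)
     else - f (i + 1) (s - 1) (res_d p r i x)))"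

text \<open>Composition; only the intermediate terms \<open>I\<^sup>0\<close>, \<open>I\<^sup>1\<close>, \<open>I\<^sup>2\<close> contribute.\<close>

definition C_mult :: "cochain \<Rightarrow> cochain \<Rightarrow> cochain"
  where "C_mult f g = (\<lambda>i s x. \<Sum>j\<in>{0..2}. f j (i + s - j) (g i (j - i) x))"

definition cocycles :: "nat \<Rightarrow> int \<Rightarrow> int \<Rightarrow> cochain set"
  where "cocycles p r n = {f \<in> C_set p n. C_d p r n f = (\<lambda>i s x. 0)}"

definition coboundaries :: "nat \<Rightarrow> int \<Rightarrow> int \<Rightarrow> cochain set"
  where "coboundaries p r n = C_d p r (n - 1) ` C_set p (n - 1)"

definition coh_class :: "nat \<Rightarrow> int \<Rightarrow> int \<Rightarrow> cochain \<Rightarrow> cochain set"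
  where "coh_class p r n f = coboundaries p r n +>\<^bsub>C_module p n\<^esub> f"

definition cohomology :: "nat \<Rightarrow> int \<Rightarrow> int \<Rightarrow> (rat, cochain set) module"
  where "cohomology p r n =
    \<lparr>carrier = coh_class p r n ` cocycles p r n, monoid.mult = undefined, one = undefined,
     ring.zero = coboundaries p r n, add = (\<lambda>X Y. X <+>\<^bsub>C_module p n\<^esub> Y),
     smult = (\<lambda>c X. \<Union>f\<in>X. coh_class p r n (c \<odot>\<^bsub>C_module p n\<^esub> f))\<rparr>"

text \<open>The product \<open>H\<^sup>m(C) \<times> H\<^sup>n(C) \<rightarrow> H\<^sup>m\<^sup>+\<^sup>n(C)\<close>, \<open>([f], [g]) \<mapsto> [f \<circ> g]\<close>; the union is over
  representatives, all of which give the same class.\<close>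

definition coh_mult ::
  "nat \<Rightarrow> int \<Rightarrow> int \<Rightarrow> int \<Rightarrow> cochain set \<Rightarrow> cochain set \<Rightarrow> cochain set"
  where "coh_mult p r m n X Y = (\<Union>f\<in>X. \<Union>g\<in>Y. coh_class p r (m + n) (C_mult f g))"

definition coh_mult_tensor ::
  "nat \<Rightarrow> int \<Rightarrow> int \<Rightarrow> int \<Rightarrow> (cochain set \<times> cochain set \<Rightarrow>\<^sub>0 int) set \<Rightarrow> cochain set"
  where "coh_mult_tensor p r m n =
    tensor_lift (add_monoid (cohomology p r (m + n))) (\<lambda>(X, Y). coh_mult p r m n X Y)"

end

theory Submission
  imports Defs "HOL-Number_Theory.Residue_Primitive_Roots"
begin

text \<open>
  Write \<open>q = 2p - 2\<close> and \<open>\<rho> = r\<^sup>p\<^sup>-\<^sup>1\<close>. Rationally each term of the resolution is spanned by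
  elements \<open>u\<^sup>a w\<^sup>b\<close>, and \<open>w\<^sup>b\<close> is primitive. A comodule map of degree \<open>qT\<close> between two terms is
  therefore a multiplier \<open>u\<^sup>a w\<^sup>b \<mapsto> \<phi>\<^sub>b u\<^sup>a w\<^sup>b\<^sup>+\<^sup>T\<close> for a sequence \<open>\<phi>\<close> of
  rational numbers (\<open>comodule_hom_multiplier\<close>). In particular the maps
  \<open>E(1)\<^sub>*E(1) \<rightarrow> E(1)\<^sub>*E(1)\<close> correspond to the linear functionals \<open>x\<^sup>b \<mapsto> \<phi>\<^sub>b\<close> that are integral on the
  degree zero part \<open>A\<^sub>0\<close> of \<open>E(1)\<^sub>*E(1)\<close>, which consists of the Laurent polynomials in \<open>x = w/u\<close>
  with values in \<open>\<int>\<^sub>(\<^sub>p\<^sub>)\<close> on the units congruent to \<open>1\<close> modulo \<open>p\<close>; a map from \<open>E(1)\<^sub>*E(1)\<close> to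
  \<open>E(1)\<^sub>* \<otimes> \<rat>\<close> is one rational number.

  Since \<open>q \<ge> 4\<close>, a cochain of degree \<open>qT + 1\<close> has only the components \<open>I\<^sup>0 \<rightarrow> I\<^sup>1\<close> and \<open>I\<^sup>1 \<rightarrow> I\<^sup>2\<close>, that
  is a functional \<open>\<alpha>\<close> and a number \<open>\<lambda>\<close>. For \<open>T \<noteq> 0\<close> it is a cocycle if and only if
  \<open>\<alpha>\<^bsub>-T\<^esub> + \<lambda> (\<rho>\<^bsup>-T\<^esup> - 1) = 0\<close>, so \<open>\<alpha>\<close> determines it, and the coboundaries are the functionals
  \<open>(\<rho>\<^sup>T \<Psi> - 1) a - b (\<Psi> - 1)\<close>. The value \<open>\<alpha>\<^sub>0\<close> identifies \<open>H\<^bsup>qT+1\<^esup>\<close> with the cyclic module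
  \<open>\<int>\<^sub>(\<^sub>p\<^sub>)/(\<rho>\<^sup>T - 1)\<close> (\<open>boundary_functionalI\<close>), and in the same way \<open>H\<^sup>2 = \<rat>/\<int>\<^sub>(\<^sub>p\<^sub>)\<close>. The product of
  \<open>(\<alpha>, \<lambda>)\<close> and \<open>(\<beta>, \<mu>)\<close> is the composite \<open>I\<^sup>0 \<rightarrow> I\<^sup>1 \<rightarrow> I\<^sup>2\<close>, with class \<open>\<lambda> \<beta>\<^sub>0\<close>. In opposite
  degrees \<open>T = -k\<close> and \<open>T = k\<close> it therefore sends \<open>s\<close> times the product of the two generators to
  \<open>- s/(\<rho>\<^sup>k - 1)\<close>. This lies in \<open>\<int>\<^sub>(\<^sub>p\<^sub>)\<close> only if \<open>\<rho>\<^sup>k - 1\<close> divides \<open>s\<close>, and then \<open>s\<close> kills the first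
  generator. As every element of the tensor product is such a multiple, the multiplication is
  injective.

  Two facts about \<open>A\<^sub>0\<close> carry this. As \<open>r\<close> generates the units modulo every power of \<open>p\<close>, the powers of
  \<open>\<rho>\<close> are dense in the units congruent to \<open>1\<close> modulo \<open>p\<close>, so that integrality can be tested there;
  this gives the exactness properties of \<open>\<Psi> - 1\<close> behind the computation of \<open>H\<^bsup>qT+1\<^esup>\<close>. And \<open>A\<^sub>0\<close> has
  an explicit basis of shifted binomial polynomials. The basis makes \<open>E(1)\<^sub>*E(1)\<close> free as a left
  \<open>E(1)\<^sub>*\<close>-module, so that its tensor square embeds into Laurent polynomials in three variables
  (\<open>tensor_value_injective\<close>) and the coproduct exists (\<open>coproduct_exists\<close>), and it allows lifting a
  functional modulo \<open>\<rho>\<^sup>T - 1\<close> to an integral one (\<open>functional_divisible_by_adams_diff\<close>).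
\<close>

section \<open>Linear functionals on Laurent polynomials\<close>

abbreviation (input) "lookup \<equiv> Poly_Mapping.lookup"
abbreviation (input) "single \<equiv> Poly_Mapping.single"
abbreviation (input) "keys \<equiv> Poly_Mapping.keys"

lemma poly_mapping_additive_induct [case_names zero single add]:
  fixes f :: "'m \<Rightarrow>\<^sub>0 'c::comm_monoid_add"
  assumes "P 0" and "\<And>m c. P (single m c)"
    and "\<And>f g. P f \<Longrightarrow> P g \<Longrightarrow> P (f + g)"
  shows "P f"
proof -
  have sum: "P (\<Sum>m\<in>K. single m (lookup f m))" if "finite K" for K
    using that by (induction rule: finite_induct) (auto intro: assms)
  have "f = (\<Sum>m\<in>keys f. single m (lookup f m))"
    by (rule poly_mapping_eqI)
      (auto simp: lookup_sum lookup_single when_def sum.delta in_keys_iff)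
  then show ?thesis
    using sum[OF finite_keys[of f]] by simp
qed

text \<open>A functional is encoded by its values \<open>\<phi>\<close> on the monomials.\<close>

definition pairing :: "('m \<Rightarrow> 'c) \<Rightarrow> ('m \<Rightarrow>\<^sub>0 'c) \<Rightarrow> 'c::comm_ring_1"
  where "pairing \<phi> f = (\<Sum>m\<in>keys f. lookup f m * \<phi> m)"

abbreviation (input) evaluate :: "'c \<Rightarrow> (int \<Rightarrow>\<^sub>0 'c) \<Rightarrow> 'c::field"
  where "evaluate y \<equiv> pairing (\<lambda>b. y powi b)"

lemma pairing_superset:
  "finite K \<Longrightarrow> keys f \<subseteq> K \<Longrightarrow> pairing \<phi> f = (\<Sum>m\<in>K. lookup f m * \<phi> m)"
  unfolding pairing_def by (rule sum.mono_neutral_left) (auto simp: in_keys_iff)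

lemma pairing_zero [simp]: "pairing \<phi> 0 = 0"
  by (simp add: pairing_def)

lemma pairing_single [simp]: "pairing \<phi> (single m c) = c * \<phi> m"
  by (cases "c = 0") (simp_all add: pairing_def)

lemma pairing_add: "pairing \<phi> (f + g) = pairing \<phi> f + pairing \<phi> g"
proof -
  let ?K = "keys f \<union> keys g"
  have "pairing \<phi> h = (\<Sum>m\<in>?K. lookup h m * \<phi> m)"
    if "h = f \<or> h = g \<or> h = f + g" for h
    using that Poly_Mapping.keys_add[of f g] by (intro pairing_superset) auto
  then show ?thesis
    by (simp add: lookup_add algebra_simps sum.distrib)
qed

lemma pairing_uminus: "pairing \<phi> (- f) = - pairing \<phi> f"
  using pairing_add[of \<phi> f "- f"] by (simp add: add_eq_0_iff)

lemma pairing_diff: "pairing \<phi> (f - g) = pairing \<phi> f - pairing \<phi> g"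
  using pairing_add[of \<phi> f "- g"] by (simp add: pairing_uminus)

lemma pairing_sum: "pairing \<phi> (sum f I) = (\<Sum>i\<in>I. pairing \<phi> (f i))"
  by (induction I rule: infinite_finite_induct) (simp_all add: pairing_add)

lemma lookup_single_zero_mult [simp]:
  fixes f :: "'m::cancel_comm_monoid_add \<Rightarrow>\<^sub>0 'c::comm_ring_1"
  shows "lookup (single 0 c * f) m = c * lookup f m"
  by (simp add: mult_map_scale_conv_mult[symmetric] Poly_Mapping.map.rep_eq when_def)

lemma pairing_scale: 
  fixes f :: "'m::cancel_comm_monoid_add \<Rightarrow>\<^sub>0 'c::comm_ring_1"
  shows "pairing \<phi> (single 0 c * f) = c * pairing \<phi> f"
  by (induction f rule: poly_mapping_additive_induct)
    (simp_all add: mult_single distrib_left pairing_add algebra_simps)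

lemma lookup_single_mult:
  fixes f :: "'m::ab_group_add \<Rightarrow>\<^sub>0 'c::comm_ring_1"
  shows "lookup (single k c * f) m = c * lookup f (m - k)"
  by (induction f rule: poly_mapping_additive_induct)
    (auto simp: mult_single distrib_left lookup_add algebra_simps lookup_single when_def)

lemma pairing_add_left: "pairing (\<lambda>m. \<phi> m + \<psi> m) f = pairing \<phi> f + pairing \<psi> f"
  by (simp add: pairing_def distrib_left sum.distrib)

lemma pairing_diff_left: "pairing (\<lambda>m. \<phi> m - \<psi> m) f = pairing \<phi> f - pairing \<psi> f"
  by (simp add: pairing_def right_diff_distrib sum_subtractf)

lemma pairing_scale_left: "pairing (\<lambda>m. c * \<phi> m) f = c * pairing \<phi> f"
  by (simp add: pairing_def sum_distrib_left mult_ac)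

text \<open>For \<open>\<phi> b = y\<^sup>b\<close> this is the substitution \<open>x \<mapsto> y x\<close>; the Adams operation is the case
  \<open>y = \<rho>\<close>.\<close>

definition rescale :: "('m \<Rightarrow> rat) \<Rightarrow> ('m \<Rightarrow>\<^sub>0 rat) \<Rightarrow> ('m \<Rightarrow>\<^sub>0 rat)"
  where "rescale \<phi> f =
    (\<Sum>m\<in>keys f. single m (lookup f m * \<phi> m))"

abbreviation (input) "substitute y \<equiv> rescale (\<lambda>b. y powi b)"

lemma lookup_rescale [simp]:
  "lookup (rescale \<phi> f) m = lookup f m * \<phi> m"
  by (auto simp: rescale_def lookup_sum lookup_single when_def sum.delta in_keys_iff)

lemma pairing_rescale: "pairing \<psi> (rescale \<phi> f) = pairing (\<lambda>m. \<phi> m * \<psi> m) f"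
proof -
  have "keys (rescale \<phi> f) \<subseteq> keys f"
    by (auto simp: in_keys_iff)
  then show ?thesis
    by (subst pairing_superset[of "keys f"]) (simp_all add: pairing_def mult_ac)
qed

section \<open>The local ring \<open>\<int>\<^sub>(\<^sub>p\<^sub>)\<close>\<close>

lemma carrier_Zloc [simp]: "carrier (Zloc p) = Zloc_set p"
  by (simp add: Zloc_def)

locale prime_localisation =
  fixes p :: nat
  assumes prime_p: "prime p"
begin

abbreviation Zp :: "rat set" where "Zp \<equiv> Zloc_set p"

lemma Zp_of_int [simp]: "of_int z \<in> Zp"
proof -
  have "of_int z = (of_int z / of_int 1 :: rat)" "\<not> int p dvd 1"
    using prime_p by auto
  then show ?thesis unfolding Zloc_set_def by blast
qed

lemma Zp_0 [simp]: "0 \<in> Zp" and Zp_1 [simp]: "1 \<in> Zp" 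
  and Zp_of_nat [simp]: "of_nat n \<in> Zp"
  using Zp_of_int[of 0] Zp_of_int[of 1] Zp_of_int[of "int n"] by simp_all

lemma Zp_add: "x \<in> Zp \<Longrightarrow> y \<in> Zp \<Longrightarrow> x + y \<in> Zp"
proof -
  assume "x \<in> Zp" "y \<in> Zp"
  then obtain a b c d where *: "x = of_int a / of_int b" "\<not> int p dvd b"
      "y = of_int c / of_int d" "\<not> int p dvd d"
    unfolding Zloc_set_def by blast
  then have "b \<noteq> 0" "d \<noteq> 0" by auto
  with * have "x + y = of_int (a * d + c * b) / of_int (b * d)"
    by (simp add: field_simps)
  moreover have "\<not> int p dvd b * d"
    using * prime_p by (simp add: prime_dvd_mult_iff)
  ultimately show "x + y \<in> Zp"
    unfolding Zloc_set_def by blast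
qed

lemma Zp_mult: "x \<in> Zp \<Longrightarrow> y \<in> Zp \<Longrightarrow> x * y \<in> Zp"
proof -
  assume "x \<in> Zp" "y \<in> Zp"
  then obtain a b c d where *: "x = of_int a / of_int b" "\<not> int p dvd b"
      "y = of_int c / of_int d" "\<not> int p dvd d"
    unfolding Zloc_set_def by blast
  then have "x * y = of_int (a * c) / of_int (b * d)"
    by simp
  moreover have "\<not> int p dvd b * d"
    using * prime_p by (simp add: prime_dvd_mult_iff)
  ultimately show "x * y \<in> Zp"
    unfolding Zloc_set_def by blast
qed

lemma Zp_uminus: "x \<in> Zp \<Longrightarrow> - x \<in> Zp"
  using Zp_mult[of "of_int (-1)" x] by (simp del: Zp_of_int add: Zp_of_int[of "-1", simplified])

lemma Zp_diff: "x \<in> Zp \<Longrightarrow> y \<in> Zp \<Longrightarrow> x - y \<in> Zp"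
  using Zp_add[of x "- y"] Zp_uminus[of y] by simp

lemma Zp_sum: "(\<And>i. i \<in> I \<Longrightarrow> f i \<in> Zp) \<Longrightarrow> sum f I \<in> Zp"
  by (induction I rule: infinite_finite_induct) (auto intro: Zp_add)

lemma Zp_power: "x \<in> Zp \<Longrightarrow> x ^ n \<in> Zp"
  by (induction n) (auto intro: Zp_mult)

lemma Zp_inverse_int: "\<not> int p dvd d \<Longrightarrow> 1 / of_int d \<in> Zp"
  unfolding Zloc_set_def by (rule CollectI, rule exI[of _ 1], rule exI[of _ d]) simp

lemma Zp_of_int_divide_iff: "of_int z / of_nat p ^ n \<in> Zp \<longleftrightarrow> int p ^ n dvd z"
proof
  assume "of_int z / of_nat p ^ n \<in> Zp"
  then obtain a b where ab: "of_int z / of_nat p ^ n = (of_int a / of_int b :: rat)" "\<not> int p dvd b"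
    unfolding Zloc_set_def by blast
  moreover have "b \<noteq> 0" "p \<noteq> 0"
    using ab prime_p by auto
  ultimately have "of_int (z * b) = (of_int (a * int p ^ n) :: rat)"
    by (simp add: field_simps)
  then have "int p ^ n dvd z * b"
    by (metis dvd_triv_right of_int_eq_iff)
  moreover have "coprime (int p ^ n) b"
    using ab(2) prime_p by (simp add: prime_imp_coprime)
  ultimately show "int p ^ n dvd z"
    by (simp add: coprime_dvd_mult_left_iff)
next
  assume "int p ^ n dvd z"
  then obtain w where "z = int p ^ n * w" ..
  then have "of_int z / of_nat p ^ n = (of_int w :: rat)"
    using prime_p by auto
  then show "of_int z / of_nat p ^ n \<in> Zp" by simp
qed

text \<open>The part of a denominator that is prime to \<open>p\<close> is a unit, so a power of \<open>p\<close> clears it.\<close>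

lemma Zp_absorbs_power:
  obtains N where "\<And>n. n \<ge> N \<Longrightarrow> x * of_nat p ^ n \<in> Zp"
proof -
  obtain a b :: int where ab: "x = of_int a / of_int b" "b > 0"
    by (metis Fract_of_int_quotient Rat_cases)
  define m where "m = multiplicity (int p) b"
  have "\<not> is_unit (int p)"
    using prime_p by (auto simp: prime_nat_iff)
  then obtain d where d: "b = int p ^ m * d" "\<not> int p dvd d"
    using multiplicity_decompose'[of b "int p"] ab(2) unfolding m_def by auto
  have "x * of_nat p ^ n \<in> Zp" if "n \<ge> m" for n
  proof -
    have "of_nat p ^ n = (of_nat p ^ m * of_nat p ^ (n - m) :: rat)"
      using that by (simp flip: power_add)
    then have "x * of_nat p ^ n = of_int (a * int p ^ (n - m)) * (1 / of_int d)"
      using ab d prime_p by (simp add: field_simps)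
    then show ?thesis
      by (metis Zp_mult Zp_of_int Zp_inverse_int d(2))
  qed
  then show thesis by (rule that)
qed

text \<open>By Fermat these contain the values \<open>l\<^sup>p\<^sup>-\<^sup>1/k\<^sup>p\<^sup>-\<^sup>1\<close> of \<open>w/u\<close> at which the elements of \<open>E(1)\<^sub>*E(1)\<close>
  have to be integral.\<close>

definition one_units :: "rat set"
  where "one_units = {1 + of_nat p * z | z. z \<in> Zp}"

lemma one_units_Zp: "y \<in> one_units \<Longrightarrow> y \<in> Zp"
  unfolding one_units_def by (auto intro!: Zp_add Zp_mult)

lemma one_units_mult: "y \<in> one_units \<Longrightarrow> y' \<in> one_units \<Longrightarrow> y * y' \<in> one_units"
proof -
  assume "y \<in> one_units" "y' \<in> one_units"
  then obtain z z' where z: "y = 1 + of_nat p * z" "z \<in> Zp" "y' = 1 + of_nat p * z'" "z' \<in> Zp"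
    unfolding one_units_def by blast
  then have "y * y' = 1 + of_nat p * (z + z' + of_nat p * z * z')"
    by (simp add: algebra_simps)
  moreover have "z + z' + of_nat p * z * z' \<in> Zp"
    using z by (intro Zp_add Zp_mult) auto
  ultimately show ?thesis
    unfolding one_units_def by blast
qed

lemma one_unitsE:
  assumes "y \<in> one_units"
  obtains s t where "y = of_int s / of_int t" "\<not> int p dvd t" "\<not> int p dvd s" "[s = t] (mod int p)"
proof -
  obtain a b where *: "y = 1 + of_nat p * (of_int a / of_int b)" "\<not> int p dvd b"
    using assms unfolding one_units_def Zloc_set_def by blast
  then have "b \<noteq> 0" by auto
  with * have "y = of_int (b + int p * a) / of_int b"
    by (simp add: field_simps)
  moreover have "[b + int p * a = b] (mod int p)"
    by (simp add: cong_def)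
  moreover from this * have "\<not> int p dvd b + int p * a"
    by (simp add: cong_dvd_iff)
  ultimately show thesis using that *(2) by blast
qed

lemma one_unitsI:
  assumes "\<not> int p dvd t" "[s = t] (mod int p)"
  shows "of_int s / of_int t \<in> one_units"
proof -
  obtain a where a: "s - t = int p * a"
    using assms(2) by (auto simp: cong_iff_dvd_diff elim: dvdE)
  have "t \<noteq> 0" using assms by auto
  moreover have "of_int s = (of_int t + of_nat p * of_int a :: rat)"
    using a by (metis add.commute diff_add_cancel of_int_add of_int_mult of_int_of_nat_eq)
  ultimately have "of_int s / of_int t = (1 + of_nat p * (of_int a * (1 / of_int t)) :: rat)"
    by (simp add: field_simps)
  then show ?thesis
    unfolding one_units_def using Zp_mult[OF Zp_of_int Zp_inverse_int[OF assms(1)]] by blast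
qed

lemma one_units_inverse: "y \<in> one_units \<Longrightarrow> inverse y \<in> one_units"
  by (erule one_unitsE) (auto intro!: one_unitsI intro: cong_sym)

lemma one_units_nonzero: "y \<in> one_units \<Longrightarrow> y \<noteq> 0"
  by (erule one_unitsE) auto

lemma one_units_1 [simp]: "1 \<in> one_units"
  unfolding one_units_def using Zp_0 by force

lemma one_units_power: "y \<in> one_units \<Longrightarrow> y ^ n \<in> one_units"
  by (induction n) (auto intro: one_units_mult)

lemma one_units_powi: "y \<in> one_units \<Longrightarrow> y powi b \<in> one_units"
  by (cases "b \<ge> 0") (auto simp: power_int_def intro!: one_units_power one_units_inverse)

lemma one_units_1_add: "1 + of_nat p * of_nat j \<in> one_units"
  unfolding one_units_def using Zp_of_nat by blast

lemma fermat_one_units: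
  assumes "\<not> int p dvd k"
  shows "of_int k ^ (p - 1) \<in> one_units"
proof -
  have "[k ^ (p - 1) = 1] (mod int p)"
  proof -
    have "[nat (k mod int p) ^ (p - 1) = 1] (mod p)"
    proof (rule fermat_theorem[OF prime_p])
      show "\<not> p dvd nat (k mod int p)"
        using assms prime_p by (metis dvd_mod_iff dvd_refl int_dvd_int_iff int_nat_eq mod_0_imp_dvd of_nat_0_less_iff pos_mod_sign prime_gt_0_nat)
    qed
    then have "[int (nat (k mod int p) ^ (p - 1)) = int 1] (mod int p)"
      by (simp only: cong_int_iff)
    then show ?thesis
      using prime_p by (simp add: cong_def power_mod prime_gt_0_nat)
  qed
  then have "of_int (k ^ (p - 1)) / of_int 1 \<in> one_units"
    by (intro one_unitsI) (use prime_p in auto)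
  then show ?thesis by simp
qed

section \<open>Integer-valued Laurent polynomials\<close>

text \<open>The degree zero part of \<open>E(1)\<^sub>*E(1)\<close>, as Laurent polynomials in \<open>x = w/u\<close>.\<close>

definition integer_valued :: "laurent set"
  where "integer_valued = {f. \<forall>y\<in>one_units. evaluate y f \<in> Zp}"

lemma integer_valuedD: "f \<in> integer_valued \<Longrightarrow> y \<in> one_units \<Longrightarrow> evaluate y f \<in> Zp"
  by (simp add: integer_valued_def)

lemma integer_valued_0 [simp]: "0 \<in> integer_valued"
  by (simp add: integer_valued_def)

lemma integer_valued_add: "f \<in> integer_valued \<Longrightarrow> g \<in> integer_valued \<Longrightarrow> f + g \<in> integer_valued"
  by (simp add: integer_valued_def pairing_add Zp_add)

lemma integer_valued_diff: "f \<in> integer_valued \<Longrightarrow> g \<in> integer_valued \<Longrightarrow> f - g \<in> integer_valued"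
  by (simp add: integer_valued_def pairing_diff Zp_diff)

lemma integer_valued_sum: "(\<And>i. i \<in> I \<Longrightarrow> f i \<in> integer_valued) \<Longrightarrow> sum f I \<in> integer_valued"
  by (induction I rule: infinite_finite_induct) (auto intro: integer_valued_add)

lemma integer_valued_scale:
  "c \<in> Zp \<Longrightarrow> f \<in> integer_valued \<Longrightarrow> single 0 c * f \<in> integer_valued"
  by (simp add: integer_valued_def pairing_scale Zp_mult)

lemma integer_valued_single: "c \<in> Zp \<Longrightarrow> single b c \<in> integer_valued"
  by (simp add: integer_valued_def Zp_mult one_units_Zp one_units_powi)

lemma pairing_powi_shift:
  fixes f :: laurent
  assumes "y \<noteq> 0"
  shows "evaluate y (single k c * f) = c * y powi k * evaluate y f"
  by (induction f rule: poly_mapping_additive_induct)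
    (simp_all add: mult_single distrib_left pairing_add power_int_add assms)

lemma integer_valued_shift:
  "f \<in> integer_valued \<Longrightarrow> single k 1 * f \<in> integer_valued"
  by (auto simp: integer_valued_def pairing_powi_shift one_units_nonzero
      intro!: Zp_mult intro: one_units_Zp one_units_powi)

lemma pairing_substitute: 
  fixes f :: laurent
  shows "evaluate y (substitute z f) = evaluate (z * y) f"
  by (simp add: pairing_rescale power_int_mult_distrib)

lemma integer_valued_substitute:
  "z \<in> one_units \<Longrightarrow> f \<in> integer_valued \<Longrightarrow> substitute z f \<in> integer_valued"
  by (simp add: integer_valued_def pairing_substitute one_units_mult)

lemma powi_diff_divisible:
  assumes "y \<in> one_units" "y' \<in> one_units" "(y' - y) / D \<in> Zp"
  shows "(y' powi b - y powi b) / D \<in> Zp"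
proof -
  have power: "(z' ^ n - z ^ n) / D \<in> Zp"
    if "z \<in> Zp" "z' \<in> Zp" "(z' - z) / D \<in> Zp" for z z' n
  proof (induction n)
    case (Suc n)
    have "(z' ^ Suc n - z ^ Suc n) / D = z' * ((z' ^ n - z ^ n) / D) + (z' - z) / D * z ^ n"
      by (cases "D = 0") (simp_all add: field_simps)
    then show ?case
      using Zp_add[OF Zp_mult[OF that(2) Suc] Zp_mult[OF that(3) Zp_power[OF that(1)]]] by metis
  qed simp
  show ?thesis
  proof (cases "b \<ge> 0")
    case True
    then show ?thesis
      using power[of y y' "nat b"] assms by (simp add: power_int_def one_units_Zp)
  next
    case False
    have "(inverse y' - inverse y) / D = - (inverse y * inverse y' * ((y' - y) / D))"
      using one_units_nonzero[OF assms(1)] one_units_nonzero[OF assms(2)]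
      by (cases "D = 0") (simp_all add: field_simps)
    moreover have "inverse y \<in> Zp" "inverse y' \<in> Zp"
      using assms one_units_inverse one_units_Zp by blast+
    ultimately show ?thesis
      using power[of "inverse y" "inverse y'" "nat (- b)"] assms(3) False
      by (metis Zp_mult Zp_uminus power_int_def)
  qed
qed

text \<open>Continuity for the \<open>p\<close>-adic topology: a Laurent polynomial has finitely many monomials, and one
  power of \<open>p\<close> clears all their denominators.\<close>

lemma pairing_powi_continuous:
  fixes f :: laurent
  assumes "y \<in> one_units"
  obtains N where "\<And>y'. y' \<in> one_units \<Longrightarrow> (y' - y) / of_nat p ^ N \<in> Zp \<Longrightarrow>
    evaluate y' f - evaluate y f \<in> Zp"
proof -
  have "\<exists>N. \<forall>n\<ge>N. \<forall>y'\<in>one_units. (y' - y) / of_nat p ^ n \<in> Zp \<longrightarrow>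
    evaluate y' f - evaluate y f \<in> Zp"
  proof (induction f rule: poly_mapping_additive_induct)
    case zero
    then show ?case by simp
  next
    case (single b c)
    obtain N where N: "\<And>n. n \<ge> N \<Longrightarrow> c * of_nat p ^ n \<in> Zp"
      using Zp_absorbs_power by blast
    have "c * y' powi b - c * y powi b \<in> Zp"
      if "n \<ge> N" "y' \<in> one_units" "(y' - y) / of_nat p ^ n \<in> Zp" for n y'
    proof -
      have "c * y' powi b - c * y powi b = (c * of_nat p ^ n) * ((y' powi b - y powi b) / of_nat p ^ n)"
        using prime_p by (simp add: field_simps)
      then show ?thesis
        using Zp_mult[OF N[OF that(1)] powi_diff_divisible[OF assms that(2,3)]] by simp
    qed
    then show ?case by auto
  next
    case (add f g)
    then obtain N N' where
      "\<forall>n\<ge>N. \<forall>y'\<in>one_units. (y' - y) / of_nat p ^ n \<in> Zp \<longrightarrow>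
        evaluate y' f - evaluate y f \<in> Zp"
      "\<forall>n\<ge>N'. \<forall>y'\<in>one_units. (y' - y) / of_nat p ^ n \<in> Zp \<longrightarrow>
        evaluate y' g - evaluate y g \<in> Zp"
      by blast
    then show ?case
      by (intro exI[of _ "max N N'"])
        (auto simp: pairing_add add_diff_add intro!: Zp_add)
  qed
  then show thesis using that by blast
qed

end

section \<open>Powers of a topological generator\<close>

lemma ord_eq_totient_if_generates:
  fixes g m :: nat
  assumes "1 < m" "coprime m g" and gen: "\<And>z. coprime m z \<Longrightarrow> \<exists>j. [g ^ j = z] (mod m)"
  shows "ord m g = totient m"
proof (rule antisym)
  have "ord m g dvd totient m"
    by (rule order_divides_totient[OF assms(2)])
  moreover have "totient m > 0"
    using assms(1) by simp
  ultimately show "ord m g \<le> totient m"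
    by (rule dvd_imp_le)
  have pos: "ord m g > 0"
    using assms(2) by simp
  have "totatives m \<subseteq> (\<lambda>j. g ^ j mod m) ` {..<ord m g}"
  proof
    fix z assume z: "z \<in> totatives m"
    then have "z < m"
      using assms(1) by (rule totatives_less)
    from z have "coprime m z"
      by (metis coprime_commute in_totatives_iff)
    then obtain j where "[g ^ j = z] (mod m)"
      using gen by blast
    moreover have "[g ^ j = g ^ (j mod ord m g)] (mod m)"
      by (subst order_divides_expdiff[OF assms(2)]) (simp add: cong_def)
    ultimately have "z = g ^ (j mod ord m g) mod m"
      using \<open>z < m\<close> by (simp add: cong_def)
    with pos show "z \<in> (\<lambda>j. g ^ j mod m) ` {..<ord m g}"
      by auto
  qed
  then have "card (totatives m) \<le> card {..<ord m g}"
    by (meson card_image_le card_mono finite_imageI finite_lessThan le_trans)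
  then show "totient m \<le> ord m g"
    by (simp add: totient_def)
qed

locale adams_generator = prime_localisation +
  fixes r :: int
  assumes odd_p: "odd p"
    and r_generates: "\<And>y. \<not> int p dvd y \<Longrightarrow> \<exists>j::nat. [r ^ j = y] (mod int p ^ 2)"
begin

lemma p_gt_2: "p > 2"
  using prime_p odd_p by (metis dvd_refl le_neq_implies_less prime_ge_2_nat)

lemma not_dvd_r: "\<not> int p dvd r"
proof
  assume r: "int p dvd r"
  have "\<not> int p dvd 2"
    using p_gt_2 zdvd_imp_le by fastforce
  then obtain j where j: "[r ^ j = 2] (mod int p ^ 2)"
    using r_generates by blast
  then have "[r ^ j = 2] (mod int p)"
    by (rule cong_dvd_modulus) (simp add: power2_eq_square)
  with r \<open>\<not> int p dvd 2\<close> have "j = 0"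
    by (metis cong_dvd_iff dvd_power neq0_conv dvd_trans)
  with \<open>[r ^ j = 2] (mod int p)\<close> show False
    using prime_p by (auto simp: cong_iff_dvd_diff)
qed

text \<open>This is the lifting criterion for primitive roots: a generator modulo \<open>p\<^sup>2\<close> has order \<open>p - 1\<close>
  modulo \<open>p\<close>, and its power with exponent \<open>p - 1\<close> is not \<open>1\<close> modulo \<open>p\<^sup>2\<close>.\<close>

lemma r_generates_power:
  assumes "\<not> int p dvd y"
  obtains j :: nat where "[r ^ j = y] (mod int p ^ N)"
proof -
  \<comment> \<open>The criterion is about natural numbers, so \<open>r\<close> is replaced by its residue modulo a power
    of \<open>p\<close> that is high enough for the congruences modulo \<open>p\<^sup>2\<close> and modulo \<open>p\<^sup>N\<close>.\<close>
  define M where "M = N + 2"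
  have gt1: "int p ^ M > 1"
    using p_gt_2 by (intro one_less_power) (simp_all add: M_def)
  define g where "g = nat (r mod int p ^ M)"
  have g: "int g = r mod int p ^ M"
  proof -
    have "0 \<le> r mod int p ^ M"
      by (rule pos_mod_sign) (use p_gt_2 in simp)
    then show ?thesis by (simp add: g_def)
  qed
  have cong_g: "[int g = r] (mod int p ^ m)" if "m \<le> M" for m
  proof (rule cong_dvd_modulus)
    show "[int g = r] (mod int p ^ M)" by (simp add: g)
    show "int p ^ m dvd int p ^ M" using that by (rule le_imp_power_dvd)
  qed
  have cop: "coprime p g"
  proof -
    have "[int g = r] (mod int p)"
      using cong_g[of 1] by (simp add: M_def)
    then have "\<not> int p dvd int g"
      using not_dvd_r cong_dvd_iff by blast
    then show ?thesis
      using prime_p by (simp add: prime_imp_coprime)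
  qed
  have gen: "\<exists>j. [g ^ j = z] (mod p ^ 2)" if "coprime p z" for z
  proof -
    have "\<not> int p dvd int z"
      using that prime_p by (metis coprime_common_divisor_nat dvd_refl int_dvd_int_iff not_prime_1)
    then obtain j where "[r ^ j = int z] (mod int p ^ 2)"
      using r_generates by blast
    moreover have "[int g ^ j = r ^ j] (mod int p ^ 2)"
      using cong_g[of 2] by (intro cong_pow) (simp add: M_def)
    ultimately have "[int (g ^ j) = int z] (mod int (p ^ 2))"
      using cong_trans by auto
    then show ?thesis by (auto simp only: cong_int_iff)
  qed
  have ord2: "ord (p ^ 2) g = totient (p ^ 2)"
  proof (rule ord_eq_totient_if_generates)
    show "1 < p ^ 2"
      using p_gt_2 by (intro one_less_power) simp_all
  qed (use cop gen in simp_all)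
  have neq1: "[g ^ (p - 1) \<noteq> 1] (mod p ^ 2)"
  proof
    assume "[g ^ (p - 1) = 1] (mod p ^ 2)"
    then have "ord (p ^ 2) g dvd p - 1"
      using ord_divides by blast
    then have "p * (p - 1) dvd p - 1"
      using ord2 prime_p by (simp add: totient_prime_power[of p 2])
    then show False
      using p_gt_2 dvd_imp_le[of "p * (p - 1)" "p - 1"] by simp
  qed
  have "residue_primroot p g"
  proof -
    have "ord p g = totient p"
    proof (rule ord_eq_totient_if_generates)
      fix z assume "coprime p z"
      then obtain j where "[g ^ j = z] (mod p ^ 2)"
        using gen by blast
      then have "[g ^ j = z] (mod p)"
        by (rule cong_dvd_modulus_nat) (simp add: power2_eq_square)
      then show "\<exists>j. [g ^ j = z] (mod p)" ..
    qed (use cop p_gt_2 in simp_all)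
    then show ?thesis
      using cop p_gt_2 prime_p by (simp add: residue_primroot_def totient_prime)
  qed
  moreover have "M > 0"
    by (simp add: M_def)
  ultimately have prim: "residue_primroot (p ^ M) g"
    using residue_primroot_prime_lift_iff[OF prime_p odd_p] neq1 by blast
  define z where "z = nat (y mod int p ^ M)"
  have z: "int z = y mod int p ^ M"
  proof -
    have "0 \<le> y mod int p ^ M"
      by (rule pos_mod_sign) (use p_gt_2 in simp)
    then show ?thesis by (simp add: z_def)
  qed
  have "\<not> int p dvd int z"
    unfolding z using assms by (simp add: M_def dvd_mod_iff)
  then have "coprime (p ^ M) z" "z \<noteq> 0"
    using prime_p by (auto simp: prime_imp_coprime intro!: Nat.gr0I)
  moreover have "int z < int (p ^ M)"
    unfolding z of_nat_power by (rule pos_mod_bound) (use p_gt_2 in simp)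
  ultimately have "z \<in> totatives (p ^ M)"
    by (metis coprime_commute in_totatives_iff less_imp_le of_nat_less_iff gr0I)
  moreover have "p ^ M > 1"
    using p_gt_2 by (intro one_less_power) (simp_all add: M_def)
  ultimately obtain j where "g ^ j mod p ^ M = z"
    using residue_primroot_is_generator[OF _ prim] by (metis (no_types, lifting) bij_betw_def imageE)
  then have "[g ^ j = z] (mod p ^ M)"
    by (auto simp: cong_def)
  then have "[int g ^ j = y] (mod int p ^ M)"
    using z by (metis cong_def cong_int_iff mod_mod_trivial of_nat_power)
  moreover have "[int g ^ j = r ^ j] (mod int p ^ M)"
    by (intro cong_pow cong_g) simp
  ultimately have "[r ^ j = y] (mod int p ^ M)"
    using cong_sym cong_trans by blast
  then have "[r ^ j = y] (mod int p ^ N)"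
    by (rule cong_dvd_modulus) (simp add: M_def le_imp_power_dvd)
  then show thesis by (rule that)
qed

definition rho :: rat where "rho = of_int r ^ (p - 1)"

lemma rho_one_units: "rho \<in> one_units"
  unfolding rho_def by (rule fermat_one_units[OF not_dvd_r])

lemma rho_nonzero [simp]: "rho \<noteq> 0"
  using one_units_nonzero[OF rho_one_units] .

lemma rho_powi_nontrivial:
  assumes "T \<noteq> 0" shows "rho powi T \<noteq> 1"
proof -
  have "\<bar>r\<bar> \<noteq> 1"
  proof
    assume "\<bar>r\<bar> = 1"
    then have sq: "r ^ j = 1 \<or> r ^ j = - 1" for j
      by (induction j) (auto simp: abs_if split: if_splits)
    have "\<not> int p dvd 2"
      using p_gt_2 zdvd_imp_le by fastforce
    then obtain j where "[r ^ j = 2] (mod int p ^ 2)"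
      using r_generates by blast
    then have "int p ^ 2 dvd r ^ j - 2"
      by (simp add: cong_iff_dvd_diff)
    with sq[of j] have "int p ^ 2 dvd 1 \<or> int p ^ 2 dvd 3"
      by auto
    then have "int p ^ 2 \<le> 3"
      by (auto dest: zdvd_imp_le)
    moreover have "int p ^ 2 \<ge> 3 ^ 2"
      using p_gt_2 by (intro power_mono) auto
    ultimately show False by simp
  qed
  moreover have "r \<noteq> 0"
    using not_dvd_r by auto
  ultimately have "\<bar>r\<bar> > 1" by linarith
  then have "\<bar>of_int r :: rat\<bar> > 1"
    by (metis of_int_1_less_iff of_int_abs)
  then have "\<bar>rho\<bar> > 1"
    using p_gt_2 unfolding rho_def by (simp add: power_abs one_less_power)
  moreover have "\<bar>rho\<bar> = rho"
    unfolding rho_def using odd_p by (simp add: zero_le_even_power)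
  ultimately have "rho > 1" by simp
  then have "rho ^ n \<noteq> 1" if "n > 0" for n
    using one_less_power[of rho n] that by (metis less_irrefl)
  note neq = this
  show ?thesis
  proof (cases "T > 0")
    case True
    then show ?thesis
      using neq[of "nat T"] by (simp add: power_int_def)
  next
    case False
    then have "rho powi T = inverse (rho ^ nat (- T))"
      using assms by (simp add: power_int_def power_inverse)
    then show ?thesis
      using neq[of "nat (- T)"] False assms by simp
  qed
qed

text \<open>If \<open>y\<close> is congruent to \<open>1\<close> modulo \<open>p\<close> and \<open>r\<^sup>i\<close> approximates \<open>y\<close>, then \<open>r\<^sup>i\<close> is \<open>1\<close> modulo \<open>p\<close>, so
  \<open>p - 1\<close> divides \<open>i\<close> and \<open>r\<^sup>i\<close> is a power of \<open>rho\<close>.\<close>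

lemma rho_power_dense:
  assumes "y \<in> one_units"
  obtains j where "(rho ^ j - y) / of_nat p ^ N \<in> Zp"
proof -
  \<comment> \<open>One extra factor \<open>p\<close>, since the argument also needs the congruence modulo \<open>p\<close> when \<open>N = 0\<close>.\<close>
  define M where "M = N + 1"
  obtain s t where st: "y = of_int s / of_int t" "\<not> int p dvd t" "\<not> int p dvd s" "[s = t] (mod int p)"
    using assms by (rule one_unitsE)
  have "coprime (int p ^ M) t"
    using st(2) prime_p by (simp add: prime_imp_coprime)
  then have "coprime t (int p ^ M)"
    by (rule coprime_commute[THEN iffD1])
  then obtain t' where t': "[t * t' = 1] (mod int p ^ M)"
    using cong_solve_coprime_int by blast
  then have t'p: "[t * t' = 1] (mod int p)"
    by (rule cong_dvd_modulus) (simp add: M_def)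
  have "\<not> int p dvd t'"
  proof
    assume "int p dvd t'"
    then have "int p dvd t * t'" by simp
    then have "int p dvd 1"
      using cong_dvd_iff[OF t'p] by simp
    then show False
      using prime_p by simp
  qed
  then have "\<not> int p dvd s * t'"
    using st prime_p by (simp add: prime_dvd_mult_iff)
  then obtain i where i: "[r ^ i = s * t'] (mod int p ^ M)"
    by (rule r_generates_power)
  then have "[r ^ i = s * t'] (mod int p)"
    by (rule cong_dvd_modulus) (simp add: M_def)
  also have "[s * t' = t * t'] (mod int p)"
    using st(4) by (rule cong_scalar_right)
  finally have ri: "[r ^ i = 1] (mod int p)"
    using t'p cong_trans by blast
  have "p - 1 dvd i"
  proof -
    obtain a :: nat where a: "ord p a = p - 1" "coprime p a"
      using residue_primroot_odd_prime_power_exists[OF prime_p odd_p]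
      by (metis prime_p residue_primroot_def totient_prime zero_less_one power_one_right)
    then have "\<not> int p dvd int a"
      using prime_p by (metis coprime_common_divisor_nat dvd_refl int_dvd_int_iff not_prime_1)
    then obtain l where "[r ^ l = int a] (mod int p ^ 2)"
      using r_generates by blast
    then have "[r ^ l = int a] (mod int p)"
      by (rule cong_dvd_modulus) (simp add: power2_eq_square)
    then have "[int a ^ i = (r ^ l) ^ i] (mod int p)"
      by (intro cong_pow) (rule cong_sym)
    also have "(r ^ l) ^ i = (r ^ i) ^ l"
      by (simp flip: power_mult add: mult.commute)
    also have "[(r ^ i) ^ l = 1 ^ l] (mod int p)"
      using ri by (rule cong_pow)
    finally have "[int (a ^ i) = int 1] (mod int p)"
      by simp
    then have "[a ^ i = 1] (mod p)"
      by (simp only: cong_int_iff)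
    then have "ord p a dvd i"
      using ord_divides by blast
    with a(1) show ?thesis by simp
  qed
  then obtain j where j: "i = (p - 1) * j" ..
  have "int p ^ N dvd r ^ i * t - s"
  proof -
    have "[r ^ i * t = s * t' * t] (mod int p ^ M)"
      using i by (rule cong_scalar_right)
    also have "s * t' * t = s * (t * t')" by simp
    also have "[s * (t * t') = s * 1] (mod int p ^ M)"
      using t' by (rule cong_scalar_left)
    finally show ?thesis
      by (auto simp: cong_iff_dvd_diff M_def elim: dvd_mult_right)
  qed
  then obtain w where w: "r ^ i * t - s = int p ^ N * w" ..
  have "t \<noteq> 0" "p \<noteq> 0" using st prime_p by auto
  have "rho ^ j = of_int (r ^ i)"
    by (simp add: rho_def j power_mult)
  then have "rho ^ j - y = of_int (r ^ i * t - s) / of_int t"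
    using \<open>t \<noteq> 0\<close> by (simp add: st(1) field_simps)
  then have "(rho ^ j - y) / of_nat p ^ N = of_int w * (1 / of_int t)"
    unfolding w using \<open>p \<noteq> 0\<close> by simp
  then show thesis
    using that Zp_mult[OF Zp_of_int Zp_inverse_int[OF st(2)]] by metis
qed

text \<open>By density and continuity, integrality at the powers of \<open>rho\<close> suffices.\<close>

lemma integer_valued_if_integral_at_rho_powers:
  assumes "\<And>j. evaluate (rho ^ j) f \<in> Zp"
  shows "f \<in> integer_valued"
  unfolding integer_valued_def
proof safe
  fix y assume y: "y \<in> one_units"
  obtain N where N: "\<And>y'. y' \<in> one_units \<Longrightarrow> (y' - y) / of_nat p ^ N \<in> Zp \<Longrightarrow>
      evaluate y' f - evaluate y f \<in> Zp"
    using pairing_powi_continuous[OF y] by blast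
  obtain j where "(rho ^ j - y) / of_nat p ^ N \<in> Zp"
    using rho_power_dense[OF y] by blast
  then have "evaluate (rho ^ j) f - evaluate y f \<in> Zp"
    using rho_one_units by (intro N one_units_power)
  then show "evaluate y f \<in> Zp"
    using Zp_diff[OF assms[of j]] by fastforce
qed

text \<open>The values of \<open>h\<close> at the powers of \<open>rho\<close> differ from \<open>h(1)\<close> by sums of values of
  \<open>(\<Psi>\<^sup>r - 1) h\<close>. This is the exactness of the resolution at \<open>I\<^sup>0\<close> and, applied to \<open>h/D\<close>, also its
  exactness modulo \<open>D\<close>.\<close>

lemma integer_valued_if_adams_diff:
  assumes "substitute rho h - h \<in> integer_valued"
  shows "h - single 0 (pairing (\<lambda>_. 1) h) \<in> integer_valued"
proof (rule integer_valued_if_integral_at_rho_powers)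
  fix j
  have "evaluate (rho ^ j) h - pairing (\<lambda>_. 1) h \<in> Zp"
  proof (induction j)
    case (Suc j)
    have "evaluate (rho ^ j) (substitute rho h - h) \<in> Zp"
      using assms rho_one_units by (intro integer_valuedD one_units_power)
    then have "evaluate (rho ^ Suc j) h - evaluate (rho ^ j) h \<in> Zp"
      by (simp add: pairing_diff pairing_substitute)
    from Zp_add[OF this Suc] show ?case by simp
  qed simp
  then show "evaluate (rho ^ j) (h - single 0 (pairing (\<lambda>_. 1) h)) \<in> Zp"
    by (simp add: pairing_diff)
qed

section \<open>A basis of the integer-valued Laurent polynomials\<close>

text \<open>The polynomial \<open>binom((x - 1)/p, n)\<close>.\<close>

primrec binomial_poly :: "nat \<Rightarrow> laurent" where
  "binomial_poly 0 = 1"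
| "binomial_poly (Suc n) = single 0 (1 / (of_nat p * of_nat (Suc n))) *
     (single 1 1 * binomial_poly n
      - single 0 (1 + of_nat p * of_nat n) * binomial_poly n)"

lemma p_neq_0 [simp]: "p \<noteq> 0"
  using p_gt_2 by simp

lemma pairing_powi_binomial_poly:
  assumes "y \<noteq> 0"
  shows "evaluate y (binomial_poly n) = ((y - 1) / of_nat p) gchoose n"
proof (induction n)
  case 0
  show ?case
    using pairing_single[of "\<lambda>b. y powi b" 0 1] by simp
next
  case (Suc n)
  define a where "a = (y - 1) / of_nat p"
  have "a * (a gchoose n) = of_nat n * (a gchoose n) + of_nat (Suc n) * (a gchoose Suc n)"
    by (rule gbinomial_mult_1)
  then have a: "a gchoose Suc n = (a - of_nat n) * (a gchoose n) / of_nat (Suc n)"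
    by (simp add: field_simps del: of_nat_Suc)
  have y: "y = 1 + of_nat p * a"
    by (simp add: a_def)
  have "evaluate y (binomial_poly (Suc n)) =
      1 / (of_nat p * of_nat (Suc n)) * (y * (a gchoose n) - (1 + of_nat p * of_nat n) * (a gchoose n))"
    using Suc by (simp add: pairing_scale pairing_diff pairing_powi_shift[OF assms] a_def del: of_nat_Suc)
  also have "\<dots> = 1 / (of_nat p * of_nat (Suc n)) * (y - (1 + of_nat p * of_nat n)) * (a gchoose n)"
    by (simp only: left_diff_distrib mult.assoc)
  also have "\<dots> = a gchoose Suc n"
    unfolding a by (subst y) (simp add: field_simps del: of_nat_Suc)
  finally show ?case by (simp add: a_def)
qed

lemma binomial_poly_at_nat:
  "evaluate (1 + of_nat p * of_nat i) (binomial_poly n) = of_nat (i choose n)"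
proof -
  have "(0::rat) \<le> of_nat p * of_nat i" by simp
  then have "1 + of_nat p * of_nat i \<noteq> (0::rat)" by linarith
  then show ?thesis
    by (simp add: pairing_powi_binomial_poly binomial_gbinomial)
qed

lemma rho_power_nat: "\<exists>m. rho ^ j = 1 + of_nat p * of_nat m"
proof -
  obtain z where z: "rho ^ j = 1 + of_nat p * z" "z \<in> Zp"
    using one_units_power[OF rho_one_units, of j] unfolding one_units_def by blast
  have R: "rho ^ j = of_int (r ^ ((p - 1) * j))"
    by (simp add: rho_def power_mult)
  then have "of_int (r ^ ((p - 1) * j) - 1) / of_nat p ^ 1 = z"
    using z(1) by (simp add: field_simps)
  then have "int p ^ 1 dvd r ^ ((p - 1) * j) - 1"
    using z(2) Zp_of_int_divide_iff[of "r ^ ((p - 1) * j) - 1" 1] by simp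
  then obtain w where w: "r ^ ((p - 1) * j) - 1 = int p * w"
    by auto
  have "even (p - 1)"
    using odd_p by simp
  then have "r ^ ((p - 1) * j) \<ge> 0"
    by (simp add: zero_le_even_power)
  then have "int p * w \<ge> - 1"
    using w by linarith
  moreover have "int p * w \<le> int p * - 1" if "w < 0"
    using that by (intro mult_left_mono) auto
  ultimately have "w \<ge> 0"
    using p_gt_2 by (cases "w < 0") auto
  then obtain m where "w = int m"
    using nonneg_int_cases by blast
  with w have "r ^ ((p - 1) * j) = 1 + int p * int m"
    by simp
  then have "rho ^ j = of_int (1 + int p * int m)"
    unfolding R by simp
  then show ?thesis by auto
qed

text \<open>At \<open>x = rho\<^sup>j\<close> the integer \<open>(x - 1)/p\<close> is not negative, because the exponent \<open>p - 1\<close> of \<open>r\<close> in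
  \<open>rho\<close> is even; the value is then an ordinary binomial coefficient.\<close>

lemma binomial_poly_integer_valued: "binomial_poly n \<in> integer_valued"
proof (rule integer_valued_if_integral_at_rho_powers)
  fix j
  show "evaluate (rho ^ j) (binomial_poly n) \<in> Zp"
    using rho_power_nat[of j] by (auto simp: binomial_poly_at_nat)
qed

lemma lookup_binomial_poly_Suc:
  "lookup (binomial_poly (Suc n)) k = 1 / (of_nat p * of_nat (Suc n)) *
     (lookup (binomial_poly n) (k - 1)
      - (1 + of_nat p * of_nat n) * lookup (binomial_poly n) k)"
  by (simp add: lookup_minus lookup_single_mult)

declare binomial_poly.simps(2) [simp del]

lemma lookup_binomial_poly_outside:
  "k < 0 \<or> int n < k \<Longrightarrow> lookup (binomial_poly n) k = 0"
proof (induction n arbitrary: k)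
  case 0
  then show ?case by (auto simp: lookup_one when_def)
next
  case (Suc n)
  from Suc.prems have "k - 1 < 0 \<or> int n < k - 1" "k < 0 \<or> int n < k" by auto
  then show ?case
    using Suc.IH by (simp add: lookup_binomial_poly_Suc)
qed

lemma lookup_binomial_poly_top_nonzero:
  "lookup (binomial_poly n) (int n) \<noteq> 0"
  by (induction n) (simp_all add: lookup_binomial_poly_Suc lookup_binomial_poly_outside)

lemma lookup_binomial_poly_0_Suc:
  "lookup (binomial_poly (Suc n)) 0 =
     - ((1 + of_nat p * of_nat n) / (of_nat p * of_nat (Suc n))) * lookup (binomial_poly n) 0"
  by (simp add: lookup_binomial_poly_Suc lookup_binomial_poly_outside)

lemma one_add_multiple_nonzero: "1 + of_nat p * of_nat n \<noteq> (0::rat)"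
  using one_units_nonzero[OF one_units_1_add] .

lemma lookup_binomial_poly_0_nonzero: "lookup (binomial_poly n) 0 \<noteq> 0"
  by (induction n) (simp_all add: lookup_binomial_poly_0_Suc one_add_multiple_nonzero del: of_nat_Suc)

text \<open>The constant term of \<open>binomial_poly n\<close> is a unit divided by \<open>p\<^sup>n n!\<close>.\<close>

lemma binomial_poly_0_quotient:
  assumes "j \<le> n"
  shows "lookup (binomial_poly j) 0 / lookup (binomial_poly n) 0 \<in> Zp"
  using assms
proof (induction n rule: dec_induct)
  case base
  then show ?case by (simp add: lookup_binomial_poly_0_nonzero)
next
  case (step n)
  have "inverse (1 + of_nat p * of_nat n) \<in> Zp"
    by (rule one_units_Zp[OF one_units_inverse[OF one_units_1_add]])
  then have "- (of_nat (p * Suc n) * inverse (1 + of_nat p * of_nat n)) \<in> Zp"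
    by (intro Zp_uminus Zp_mult Zp_of_nat)
  moreover have "a / (- (s / (c * d)) * b) = - (c * d * inverse s) * (a / b)" for a b c d s :: rat
    by (simp add: divide_inverse mult_ac)
  ultimately show ?case
    unfolding lookup_binomial_poly_0_Suc using Zp_mult[OF _ step.IH] by (simp only: of_nat_mult)
qed

text \<open>The matrix of values of \<open>binomial_poly j\<close> at \<open>1 + p i\<close> is \<open>i choose j\<close>, which is unitriangular; so
  integrality of the values at these points passes to the coefficients.\<close>

lemma newton_expansion:
  assumes "\<And>k. k < 0 \<or> int n < k \<Longrightarrow> lookup f k = 0"
  obtains c where "f = (\<Sum>j\<le>n. single 0 (c j) * binomial_poly j)"
    and "f \<in> integer_valued \<Longrightarrow> (\<And>j. j \<le> n \<Longrightarrow> c j \<in> Zp)"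
proof -
  have "\<exists>c. f = (\<Sum>j\<le>n. single 0 (c j) * binomial_poly j)"
    using assms
  proof (induction n arbitrary: f)
    case 0
    then have "lookup f k = 0" if "k \<noteq> 0" for k
      using that by (cases "k < 0") auto
    then have "f = single 0 (lookup f 0)"
      by (intro poly_mapping_eqI) (auto simp: lookup_single when_def)
    then show ?case by (auto intro!: exI[of _ "\<lambda>_. lookup f 0"])
  next
    case (Suc n)
    define t where "t = lookup f (int (Suc n)) /
      lookup (binomial_poly (Suc n)) (int (Suc n))"
    define g where "g = f - single 0 t * binomial_poly (Suc n)"
    have "lookup g k = 0" if "k < 0 \<or> int n < k" for k
    proof (cases "k = int (Suc n)")
      case True
      then show ?thesis
        using lookup_binomial_poly_top_nonzero[of "Suc n"] by (simp add: g_def t_def lookup_minus)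
    next
      case False
      with that have "k < 0 \<or> int (Suc n) < k" by auto
      then show ?thesis
        using Suc.prems lookup_binomial_poly_outside by (simp add: g_def lookup_minus)
    qed
    then obtain c where "g = (\<Sum>j\<le>n. single 0 (c j) * binomial_poly j)"
      using Suc.IH by blast
    then have "f = (\<Sum>j\<le>Suc n. single 0 ((c(Suc n := t)) j) * binomial_poly j)"
      by (simp add: g_def algebra_simps)
    then show ?case by blast
  qed
  then obtain c where c: "f = (\<Sum>j\<le>n. single 0 (c j) * binomial_poly j)" ..
  have "c i \<in> Zp" if "f \<in> integer_valued" "i \<le> n" for i
    using \<open>i \<le> n\<close>
  proof (induction i rule: less_induct)
    case (less i)
    have "evaluate (1 + of_nat p * of_nat i) f = (\<Sum>j\<le>n. c j * of_nat (i choose j))"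
      by (subst c) (simp add: pairing_sum pairing_scale binomial_poly_at_nat)
    also have "\<dots> = (\<Sum>j\<le>i. c j * of_nat (i choose j))"
      using less.prems by (intro sum.mono_neutral_right) auto
    also have "\<dots> = (\<Sum>j<i. c j * of_nat (i choose j)) + c i"
      by (simp flip: lessThan_Suc_atMost)
    finally have "c i = evaluate (1 + of_nat p * of_nat i) f
        - (\<Sum>j<i. c j * of_nat (i choose j))"
      by simp
    moreover have "evaluate (1 + of_nat p * of_nat i) f \<in> Zp"
      by (rule integer_valuedD[OF \<open>f \<in> integer_valued\<close> one_units_1_add])
    moreover have "(\<Sum>j<i. c j * of_nat (i choose j)) \<in> Zp"
      using less by (intro Zp_sum Zp_mult Zp_of_nat) auto
    ultimately show ?case by (simp add: Zp_diff)
  qed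
  with c show thesis by (rule that)
qed

text \<open>Both the top coefficient and the constant term of \<open>binomial_poly n\<close> have the largest denominator
  possible for an integer-valued polynomial of degree at most \<open>n\<close>. For the constant term this is
  where \<open>1 + p i\<close> being a unit matters.\<close>

lemma extreme_coefficients:
  assumes "f \<in> integer_valued" "\<And>k. k < 0 \<or> int n < k \<Longrightarrow> lookup f k = 0"
  shows "lookup f (int n) / lookup (binomial_poly n) (int n) \<in> Zp"
    and "lookup f 0 / lookup (binomial_poly n) 0 \<in> Zp"
proof -
  obtain c where c: "f = (\<Sum>j\<le>n. single 0 (c j) * binomial_poly j)"
      "\<And>j. j \<le> n \<Longrightarrow> c j \<in> Zp"
    using newton_expansion[OF assms(2)] assms(1) by metis
  have lookup_f: "lookup f k = (\<Sum>j\<le>n. c j * lookup (binomial_poly j) k)" for k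
    by (subst c(1)) (simp add: lookup_sum)
  have "lookup f (int n) = c n * lookup (binomial_poly n) (int n)"
    unfolding lookup_f by (subst sum.mono_neutral_right[of _ "{n}"]) (auto simp: lookup_binomial_poly_outside)
  then show "lookup f (int n) / lookup (binomial_poly n) (int n) \<in> Zp"
    using c(2) lookup_binomial_poly_top_nonzero by simp
  have "lookup f 0 / lookup (binomial_poly n) 0 =
      (\<Sum>j\<le>n. c j * (lookup (binomial_poly j) 0 / lookup (binomial_poly n) 0))"
    by (simp add: lookup_f sum_divide_distrib)
  also have "\<dots> \<in> Zp"
    using c(2) by (intro Zp_sum Zp_mult binomial_poly_0_quotient) auto
  finally show "lookup f 0 / lookup (binomial_poly n) 0 \<in> Zp" .
qed

text \<open>The shift by half the degree makes the interval of exponents grow alternately upwards and downwards,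
  so that all monomials are reached; it does not affect integrality, as \<open>x\<close> takes unit values.\<close>

definition basis :: "nat \<Rightarrow> laurent"
  where "basis n = single (- int (n div 2)) 1 * binomial_poly n"

text \<open>The exponent that occurs in \<open>basis n\<close> but in no earlier element. It is the top exponent of
  \<open>basis n\<close> for odd \<open>n\<close> and the bottom one for even \<open>n\<close>.\<close>

definition new_exponent :: "nat \<Rightarrow> int"
  where "new_exponent n = (if even n then - int (n div 2) else int (n - n div 2))"

lemma basis_integer_valued: "basis n \<in> integer_valued"
  unfolding basis_def by (rule integer_valued_shift[OF binomial_poly_integer_valued])

lemma lookup_basis: "lookup (basis n) b = lookup (binomial_poly n) (b + int (n div 2))"
  by (simp add: basis_def lookup_single_mult)

lemma lookup_basis_outside:
  "b < - int (n div 2) \<or> int (n - n div 2) < b \<Longrightarrow> lookup (basis n) b = 0"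
  unfolding lookup_basis by (rule lookup_binomial_poly_outside) auto

lemma lookup_basis_new_exponent: "lookup (basis n) (new_exponent n) \<noteq> 0"
proof (cases "even n")
  case True
  then show ?thesis
    by (simp add: lookup_basis new_exponent_def lookup_binomial_poly_0_nonzero)
next
  case False
  then have "new_exponent n + int (n div 2) = int n"
    by (simp add: new_exponent_def)
  then show ?thesis
    by (simp add: lookup_basis lookup_binomial_poly_top_nonzero)
qed

lemma lookup_basis_later_exponent: "j < n \<Longrightarrow> lookup (basis j) (new_exponent n) = 0"
proof (rule lookup_basis_outside)
  assume "j < n"
  then show "new_exponent n < - int (j div 2) \<or> int (j - j div 2) < new_exponent n"
    unfolding new_exponent_def by (cases "even n") (auto elim!: evenE oddE)
qed

text \<open>The coefficient of \<open>f\<close> at the newest exponent is an extreme one, so it is an integral multiple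
  of that of \<open>basis n\<close>; subtracting this multiple of \<open>basis n\<close> shortens the interval of exponents.\<close>

lemma basis_expansion_exists:
  assumes "\<And>b. b < - int (n div 2) \<or> int (n - n div 2) < b \<Longrightarrow> lookup f b = 0"
  shows "\<exists>c. f = (\<Sum>j\<le>n. single 0 (c j) * basis j) \<and>
    (f \<in> integer_valued \<longrightarrow> (\<forall>j\<le>n. c j \<in> Zp))"
  using assms
proof (induction n arbitrary: f)
  case 0
  then have "lookup f k = 0" if "k \<noteq> 0" for k
    using that by (cases "k < 0") auto
  then have f: "f = single 0 (lookup f 0)"
    by (intro poly_mapping_eqI) (auto simp: lookup_single when_def)
  have "lookup f 0 \<in> Zp" if "f \<in> integer_valued"
  proof -
    have "evaluate 1 f \<in> Zp"
      by (rule integer_valuedD[OF that one_units_1])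
    then show ?thesis by (subst (asm) f) simp
  qed
  then show ?case
    by (intro exI[of _ "\<lambda>_. lookup f 0"]) (use f in \<open>simp add: basis_def\<close>)
next
  case (Suc n)
  define t where "t = lookup f (new_exponent (Suc n)) /
    lookup (basis (Suc n)) (new_exponent (Suc n))"
  define g where "g = f - single 0 t * basis (Suc n)"
  have g0: "lookup g b = 0" if "b < - int (n div 2) \<or> int (n - n div 2) < b" for b
  proof (cases "b = new_exponent (Suc n)")
    case True
    then show ?thesis
      using lookup_basis_new_exponent[of "Suc n"] by (simp add: g_def t_def lookup_minus)
  next
    case False
    with that have b: "b < - int (Suc n div 2) \<or> int (Suc n - Suc n div 2) < b"
      unfolding new_exponent_def by (cases "even n") (auto elim!: evenE oddE)
    then show ?thesis
      using Suc.prems[OF b] lookup_basis_outside[OF b] by (simp add: g_def lookup_minus)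
  qed
  obtain c where c: "g = (\<Sum>j\<le>n. single 0 (c j) * basis j)"
      "g \<in> integer_valued \<longrightarrow> (\<forall>j\<le>n. c j \<in> Zp)"
    using Suc.IH[OF g0] by blast
  have t: "t \<in> Zp" if f: "f \<in> integer_valued"
  proof -
    define f' where "f' = single (int (Suc n div 2)) 1 * f"
    have "f' \<in> integer_valued"
      unfolding f'_def by (rule integer_valued_shift[OF f])
    moreover have "lookup f' k = 0" if "k < 0 \<or> int (Suc n) < k" for k
      unfolding f'_def lookup_single_mult using that by (subst Suc.prems) auto
    ultimately have
      "lookup f' (int (Suc n)) / lookup (binomial_poly (Suc n)) (int (Suc n)) \<in> Zp
       \<and> lookup f' 0 / lookup (binomial_poly (Suc n)) 0 \<in> Zp"
      by (intro conjI extreme_coefficients)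
    moreover have "lookup f (new_exponent (Suc n)) =
        lookup f' (new_exponent (Suc n) + int (Suc n div 2))"
      by (simp add: f'_def lookup_single_mult)
    moreover have "new_exponent (Suc n) + int (Suc n div 2) = (if even (Suc n) then 0 else int (Suc n))"
      by (simp add: new_exponent_def)
    ultimately show ?thesis
      unfolding t_def lookup_basis by (cases "even (Suc n)") simp_all
  qed
  have "f = (\<Sum>j\<le>Suc n. single 0 ((c(Suc n := t)) j) * basis j)"
    using c(1) by (simp add: g_def algebra_simps)
  moreover have "(c(Suc n := t)) j \<in> Zp" if f: "f \<in> integer_valued" and j: "j \<le> Suc n" for j
  proof -
    have "g \<in> integer_valued"
      unfolding g_def by (intro integer_valued_diff f integer_valued_scale t basis_integer_valued)
    then show ?thesis
      using c(2) t[OF f] j by auto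
  qed
  ultimately show ?case by blast
qed

lemma basis_independent:
  assumes "(\<Sum>j<n. single 0 (c j) * basis j) = 0" "j < n"
  shows "c j = 0"
  using assms
proof (induction n)
  case (Suc n)
  have "lookup (\<Sum>j<Suc n. single 0 (c j) * basis j) (new_exponent n) = 0"
    using Suc.prems by simp
  then have "c n = 0"
    using lookup_basis_new_exponent[of n] by (simp add: lookup_add lookup_sum lookup_basis_later_exponent)
  with Suc show ?case by (cases "j = n") simp_all
qed simp

definition expands :: "laurent \<Rightarrow> (nat \<Rightarrow> rat) \<Rightarrow> bool"
  where "expands f c \<longleftrightarrow> (\<exists>N. (\<forall>j\<ge>N. c j = 0) \<and> f = (\<Sum>j<N. single 0 (c j) * basis j))"

lemma expands_from:
  assumes "expands f c"
  obtains N where "\<And>j. j \<ge> N \<Longrightarrow> c j = 0"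
    and "\<And>n. n \<ge> N \<Longrightarrow> f = (\<Sum>j<n. single 0 (c j) * basis j)"
proof -
  obtain N where N: "\<forall>j\<ge>N. c j = 0" "f = (\<Sum>j<N. single 0 (c j) * basis j)"
    using assms unfolding expands_def by blast
  have "f = (\<Sum>j<n. single 0 (c j) * basis j)" if "n \<ge> N" for n
    unfolding N(2) using that N(1) by (intro sum.mono_neutral_left) auto
  with N(1) that show thesis by blast
qed

lemma expands_unique:
  assumes "expands f c" "expands f c'" shows "c = c'"
proof
  fix j
  obtain N where N: "\<And>n. n \<ge> N \<Longrightarrow> f = (\<Sum>j<n. single 0 (c j) * basis j)"
    using expands_from[OF assms(1)] by metis
  obtain N' where N': "\<And>n. n \<ge> N' \<Longrightarrow> f = (\<Sum>j<n. single 0 (c' j) * basis j)"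
    using expands_from[OF assms(2)] by metis
  define n where "n = N + N' + Suc j"
  have "(\<Sum>j<n. single 0 (c j - c' j) * basis j) = f - f"
    using N[of n] N'[of n] by (simp add: n_def single_diff left_diff_distrib sum_subtractf)
  then have "c j - c' j = 0"
    by (intro basis_independent[where c = "\<lambda>j. c j - c' j" and n = n]) (auto simp: n_def)
  then show "c j = c' j" by simp
qed

lemma expands_exists:
  obtains c where "expands f c" "f \<in> integer_valued \<longrightarrow> (\<forall>j. c j \<in> Zp)"
proof -
  obtain n where n: "\<And>b. b \<in> keys f \<Longrightarrow> \<bar>b\<bar> \<le> int n"
  proof -
    have "finite ((\<lambda>b. nat \<bar>b\<bar>) ` keys f)" by simp
    then obtain n where "\<forall>m\<in>(\<lambda>b. nat \<bar>b\<bar>) ` keys f. m \<le> n"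
      using finite_nat_set_iff_bounded_le by blast
    then show thesis by (intro that[of n]) force
  qed
  have "lookup f b = 0" if "b < - int ((2 * n) div 2) \<or> int (2 * n - (2 * n) div 2) < b" for b
  proof (rule ccontr)
    assume "lookup f b \<noteq> 0"
    then have "\<bar>b\<bar> \<le> int n"
      by (intro n) (simp add: in_keys_iff)
    with that show False by auto
  qed
  from basis_expansion_exists[OF this] obtain c where
    c: "f = (\<Sum>j\<le>2 * n. single 0 (c j) * basis j)"
       "f \<in> integer_valued \<longrightarrow> (\<forall>j\<le>2 * n. c j \<in> Zp)"
    by blast
  define c' where "c' j = (if j \<le> 2 * n then c j else 0)" for j
  have "f = (\<Sum>j<Suc (2 * n). single 0 (c' j) * basis j)"
    unfolding lessThan_Suc_atMost by (subst c(1)) (simp add: c'_def)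
  then have "expands f c'"
    unfolding expands_def by (intro exI[of _ "Suc (2 * n)"]) (auto simp: c'_def)
  moreover have "f \<in> integer_valued \<longrightarrow> (\<forall>j. c' j \<in> Zp)"
    using c(2) by (simp add: c'_def)
  ultimately show thesis by (rule that)
qed

definition coordinate :: "nat \<Rightarrow> int \<Rightarrow> rat"
  where "coordinate j b = (THE c. expands (single b 1) c) j"

lemma expands_scale:
  assumes "expands f c" shows "expands (single 0 a * f) (\<lambda>j. a * c j)"
proof -
  obtain N where N: "\<forall>j\<ge>N. c j = 0" "f = (\<Sum>j<N. single 0 (c j) * basis j)"
    using assms unfolding expands_def by blast
  have "single 0 a * f = (\<Sum>j<N. single 0 (a * c j) * basis j)"
    by (subst N(2)) (simp add: sum_distrib_left mult_single flip: mult.assoc)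
  with N(1) show ?thesis
    unfolding expands_def by auto
qed

lemma expands_add:
  assumes "expands f c" "expands g d" shows "expands (f + g) (\<lambda>j. c j + d j)"
proof -
  obtain N where N: "\<And>j. j \<ge> N \<Longrightarrow> c j = 0"
      "\<And>n. n \<ge> N \<Longrightarrow> f = (\<Sum>j<n. single 0 (c j) * basis j)"
    using expands_from[OF assms(1)] by metis
  obtain M where M: "\<And>j. j \<ge> M \<Longrightarrow> d j = 0"
      "\<And>n. n \<ge> M \<Longrightarrow> g = (\<Sum>j<n. single 0 (d j) * basis j)"
    using expands_from[OF assms(2)] by metis
  have "f + g = (\<Sum>j<N + M. single 0 (c j + d j) * basis j)"
    by (subst N(2)[of "N + M"], simp, subst M(2)[of "N + M"], simp)
      (simp add: single_add distrib_right sum.distrib)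
  with N(1) M(1) show ?thesis
    unfolding expands_def by (intro exI[of _ "N + M"]) auto
qed

lemma expands_coordinate: "expands f (\<lambda>j. pairing (coordinate j) f)"
proof (induction f rule: poly_mapping_additive_induct)
  case zero
  have "expands 0 (\<lambda>_. 0)"
    unfolding expands_def by (intro exI[of _ 0]) simp
  then show ?case by simp
next
  case (single b c)
  obtain d where d: "expands (single b 1) d"
    using expands_exists by blast
  then have "(THE c. expands (single b 1) c) = d"
    using expands_unique by blast
  then have "coordinate j b = d j" for j
    by (simp add: coordinate_def)
  then show ?case
    using expands_scale[OF d, of c] by (simp add: mult_single)
next
  case (add f g)
  then show ?case
    using expands_add by (simp add: pairing_add)
qed

text \<open>The ring \<open>E(1)\<^sup>0E(1)\<close> of operations, as functionals on the degree zero part of \<open>E(1)\<^sub>*E(1)\<close> given by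
  their values on the powers of \<open>x\<close>.\<close>

definition integral_functionals :: "(int \<Rightarrow> rat) set"
  where "integral_functionals = {\<phi>. \<forall>f\<in>integer_valued. pairing \<phi> f \<in> Zp}"

lemma integral_functionalsD:
  "\<phi> \<in> integral_functionals \<Longrightarrow> f \<in> integer_valued \<Longrightarrow> pairing \<phi> f \<in> Zp"
  by (simp add: integral_functionals_def)

lemma integral_functional_value: "\<phi> \<in> integral_functionals \<Longrightarrow> \<phi> b \<in> Zp"
  using integral_functionalsD[OF _ integer_valued_single[OF Zp_1], of \<phi> b] by simp

lemma integral_functionals_add:
  "\<phi> \<in> integral_functionals \<Longrightarrow> \<psi> \<in> integral_functionals \<Longrightarrow> (\<lambda>b. \<phi> b + \<psi> b) \<in> integral_functionals"
  by (simp add: integral_functionals_def pairing_add_left Zp_add)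

lemma integral_functionals_diff:
  "\<phi> \<in> integral_functionals \<Longrightarrow> \<psi> \<in> integral_functionals \<Longrightarrow> (\<lambda>b. \<phi> b - \<psi> b) \<in> integral_functionals"
  by (simp add: integral_functionals_def pairing_diff_left Zp_diff)

lemma integral_functionals_scale:
  "c \<in> Zp \<Longrightarrow> \<phi> \<in> integral_functionals \<Longrightarrow> (\<lambda>b. c * \<phi> b) \<in> integral_functionals"
  by (simp add: integral_functionals_def pairing_scale_left Zp_mult)

lemma integral_functionals_powi: "y \<in> one_units \<Longrightarrow> (\<lambda>b. y powi b) \<in> integral_functionals"
  by (simp add: integral_functionals_def integer_valuedD)

lemma integral_functionals_const: "c \<in> Zp \<Longrightarrow> (\<lambda>b. c) \<in> integral_functionals"
  using integral_functionals_scale[OF _ integral_functionals_powi[OF one_units_1], of c] by simp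

lemma integral_functionals_times_powi:
  "y \<in> one_units \<Longrightarrow> \<phi> \<in> integral_functionals \<Longrightarrow> (\<lambda>b. y powi b * \<phi> b) \<in> integral_functionals"
  by (simp add: integral_functionals_def integer_valued_substitute flip: pairing_rescale)

lemma coordinate_integral: "coordinate j \<in> integral_functionals"
  unfolding integral_functionals_def
proof safe
  fix f assume f: "f \<in> integer_valued"
  obtain c where c: "expands f c" "f \<in> integer_valued \<longrightarrow> (\<forall>j. c j \<in> Zp)"
    using expands_exists by blast
  have "(\<lambda>j. pairing (coordinate j) f) = c"
    by (rule expands_unique[OF expands_coordinate c(1)])
  then show "pairing (coordinate j) f \<in> Zp"
    using c(2) f by metis
qed

lemma basis_expansion:
  obtains N where "\<And>n. n \<ge> N \<Longrightarrow> f = (\<Sum>j<n. single 0 (pairing (coordinate j) f) * basis j)"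
    and "\<And>j. j \<ge> N \<Longrightarrow> pairing (coordinate j) f = 0"
  using expands_from[OF expands_coordinate] by metis

section \<open>Division of functionals by \<open>\<Psi>\<^sup>r - 1\<close>\<close>

text \<open>The map \<open>I\<^sup>1 \<rightarrow> I\<^sup>2\<close> is surjective because the constant terms of the binomial polynomials have
  arbitrarily large powers of \<open>p\<close> in the denominator.\<close>

lemma constant_term_surjective: "\<exists>g\<in>integer_valued. lookup g 0 = \<tau>"
proof -
  obtain N where N: "\<And>n. n \<ge> N \<Longrightarrow> \<tau> * of_nat p ^ n \<in> Zp"
    using Zp_absorbs_power by blast
  define b where "b n = lookup (binomial_poly n) 0" for n
  have "\<exists>u\<in>Zp. inverse (b n) = of_nat p ^ n * u" for n
  proof (induction n)
    case 0
    then show ?case by (simp add: b_def)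
  next
    case (Suc n)
    then obtain u where u: "u \<in> Zp" "inverse (b n) = of_nat p ^ n * u" by blast
    have "inverse (1 + of_nat p * of_nat n) \<in> Zp"
      by (rule one_units_Zp[OF one_units_inverse[OF one_units_1_add]])
    then have "- (of_nat (Suc n) * inverse (1 + of_nat p * of_nat n) * u) \<in> Zp"
      using u(1) by (intro Zp_uminus Zp_mult Zp_of_nat)
    moreover have "inverse (b (Suc n)) =
        of_nat p ^ Suc n * - (of_nat (Suc n) * inverse (1 + of_nat p * of_nat n) * u)"
    proof -
      have "inverse (- (s / (c * d)) * a) = - (c * d * inverse s) * inverse a" for a c d s :: rat
        by (simp add: divide_inverse mult_ac)
      then show ?thesis
        unfolding b_def lookup_binomial_poly_0_Suc using u(2) by (simp add: b_def mult_ac del: of_nat_Suc)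
    qed
    ultimately show ?case by blast
  qed
  then obtain u where u: "u \<in> Zp" "inverse (b N) = of_nat p ^ N * u" by blast
  define c where "c = \<tau> * inverse (b N)"
  have "c \<in> Zp"
    using Zp_mult[OF N[OF order_refl] u(1)] by (simp add: c_def u(2) mult.assoc)
  moreover have "c * b N = \<tau>"
    using lookup_binomial_poly_0_nonzero[of N] by (simp add: c_def b_def)
  ultimately show ?thesis
    by (intro bexI[of _ "single 0 c * binomial_poly N"])
      (simp_all add: b_def integer_valued_scale binomial_poly_integer_valued)
qed

text \<open>The only obstruction to dividing \<open>f\<close> coefficientwise by \<open>rho\<^sup>b - 1\<close> is its constant term, and an
  element \<open>g\<close> with constant term \<open>f\<^sub>0/D\<close> removes it. Exactness of the resolution makes the
  quotient integral up to a constant.\<close>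

lemma adams_diff_solvable:
  assumes "f \<in> integer_valued" "D \<noteq> 0" "D \<in> Zp"
  obtains h g where "h \<in> integer_valued" "g \<in> integer_valued"
    "f = substitute rho h - h + single 0 D * g"
proof -
  obtain g where g: "g \<in> integer_valued" "lookup g 0 = lookup f 0 / D"
    using constant_term_surjective by blast
  define f' where "f' = f - single 0 D * g"
  define h where "h = rescale (\<lambda>b. 1 / (rho powi b - 1)) f'"
  define h' where "h' = h - single 0 (pairing (\<lambda>_. 1) h)"
  have f'0: "lookup f' 0 = 0"
    using g(2) assms(2) by (simp add: f'_def lookup_minus)
  then have lookup: "lookup h b * (rho powi b - 1) = lookup f' b" for b
    using rho_powi_nontrivial[of b] by (cases "b = 0") (simp_all add: h_def)
  have diff: "substitute rho h - h = f'"
    using lookup by (intro poly_mapping_eqI) (simp add: lookup_minus algebra_simps)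
  have "substitute rho h' - h' = substitute rho h - h"
  proof (rule poly_mapping_eqI)
    fix k
    show "lookup (substitute rho h' - h') k =
        lookup (substitute rho h - h) k"
      by (cases "k = 0") (simp_all add: h'_def lookup_minus lookup_single left_diff_distrib)
  qed
  with diff have diff': "f = substitute rho h' - h' + single 0 D * g"
    by (simp add: f'_def)
  have "h' \<in> integer_valued"
    unfolding h'_def
  proof (rule integer_valued_if_adams_diff)
    show "substitute rho h - h \<in> integer_valued"
      unfolding diff f'_def by (intro integer_valued_diff integer_valued_scale assms g(1))
  qed
  from that[OF this g(1) diff'] show thesis .
qed

text \<open>Modulo \<open>D\<close>, every integer-valued Laurent polynomial is in the image of \<open>\<Psi>\<^sup>r - 1\<close>, and its
  preimage is unique up to a constant. A functional that vanishes on constants can therefore be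
  divided by \<open>\<Psi>\<^sup>r - 1\<close> modulo \<open>D\<close>, and the basis allows lifting the quotient to an integral
  functional.\<close>

lemma functional_divisible_by_adams_diff:
  assumes \<alpha>: "\<alpha> \<in> integral_functionals" and \<alpha>0: "\<alpha> 0 = 0" and D: "D \<noteq> 0" "D \<in> Zp"
  obtains a e where "a \<in> integral_functionals" "e \<in> integral_functionals"
    "\<And>j. \<alpha> j = D * a j + e j * (rho powi j - 1)"
proof -
  define \<Delta> where "\<Delta> h = substitute rho h - h" for h
  have "\<exists>h g. h \<in> integer_valued \<and> g \<in> integer_valued \<and>
      basis n = \<Delta> h + single 0 D * g" for n
    using adams_diff_solvable[OF basis_integer_valued D] unfolding \<Delta>_def by metis
  then obtain h g where h: "\<And>n. h n \<in> integer_valued" and g: "\<And>n. g n \<in> integer_valued"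
      and hg: "\<And>n. basis n = \<Delta> (h n) + single 0 D * g n"
    by metis
  have finite_coord: "\<exists>N. \<forall>j\<ge>N. coordinate j b = 0" for b
    using basis_expansion[of "single b 1"] by (metis mult_1 pairing_single)
  \<comment> \<open>The functional with value \<open>pairing \<alpha> (h n)\<close> on \<open>basis n\<close>; the sum is finite for each \<open>b\<close>.\<close>
  define e where "e b = (\<Sum>n\<in>{n. coordinate n b \<noteq> 0}. coordinate n b * pairing \<alpha> (h n))" for b
  have e_lessThan: "e b = (\<Sum>n<N. coordinate n b * pairing \<alpha> (h n))"
    if "\<And>j. j \<ge> N \<Longrightarrow> coordinate j b = 0" for b N
    unfolding e_def using that by (intro sum.mono_neutral_left) (auto simp: not_le[symmetric])
  have pairing_e: "\<exists>N. \<forall>n\<ge>N. pairing e f = (\<Sum>j<n. pairing (coordinate j) f * pairing \<alpha> (h j))" for f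
  proof (induction f rule: poly_mapping_additive_induct)
    case (single b c)
    obtain N where "\<forall>j\<ge>N. coordinate j b = 0" using finite_coord by blast
    then show ?case
      by (intro exI[of _ N] allI impI, subst pairing_single, subst e_lessThan)
        (auto simp: sum_distrib_left mult.assoc)
  next
    case (add f g)
    then obtain N M where NM:
      "\<forall>n\<ge>N. pairing e f = (\<Sum>j<n. pairing (coordinate j) f * pairing \<alpha> (h j))"
      "\<forall>n\<ge>M. pairing e g = (\<Sum>j<n. pairing (coordinate j) g * pairing \<alpha> (h j))"
      by blast
    show ?case
    proof (intro exI[of _ "N + M"] allI impI)
      fix n assume "N + M \<le> n"
      then have "N \<le> n" "M \<le> n" by auto
      then show "pairing e (f + g) = (\<Sum>j<n. pairing (coordinate j) (f + g) * pairing \<alpha> (h j))"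
        using NM(1)[rule_format, of n] NM(2)[rule_format, of n]
        by (simp add: pairing_add distrib_right sum.distrib)
    qed
  qed simp
  have e: "e \<in> integral_functionals"
    unfolding integral_functionals_def
  proof safe
    fix f assume f: "f \<in> integer_valued"
    obtain N where "pairing e f = (\<Sum>j<N. pairing (coordinate j) f * pairing \<alpha> (h j))"
      using pairing_e by blast
    moreover have "\<dots> \<in> Zp"
      using f h by (intro Zp_sum Zp_mult integral_functionalsD[OF \<alpha>]
        integral_functionalsD[OF coordinate_integral])
    ultimately show "pairing e f \<in> Zp" by simp
  qed
  define a where "a j = (\<alpha> j - e j * (rho powi j - 1)) / D" for j
  have "a \<in> integral_functionals"
    unfolding integral_functionals_def
  proof safe
    fix f assume f: "f \<in> integer_valued"
    have "\<Delta> f \<in> integer_valued"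
      unfolding \<Delta>_def by (intro integer_valued_diff integer_valued_substitute rho_one_units f)
    obtain N where N: "\<And>n. n \<ge> N \<Longrightarrow> \<Delta> f = (\<Sum>j<n. single 0 (pairing (coordinate j) (\<Delta> f)) * basis j)"
      using basis_expansion by metis
    obtain M where M: "\<And>n. n \<ge> M \<Longrightarrow> pairing e (\<Delta> f) = (\<Sum>j<n. pairing (coordinate j) (\<Delta> f) * pairing \<alpha> (h j))"
      using pairing_e by blast
    define n where "n = N + M"
    define c where "c j = pairing (coordinate j) (\<Delta> f)" for j
    have c: "c j \<in> Zp" for j
      unfolding c_def by (intro integral_functionalsD[OF coordinate_integral]) fact
    define H where "H = (\<Sum>j<n. single 0 (c j) * h j)"
    define G where "G = (\<Sum>j<n. single 0 (c j) * g j)"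
    have G: "G \<in> integer_valued"
      unfolding G_def by (intro integer_valued_sum integer_valued_scale c g)
    have \<Delta>_H: "\<Delta> H = (\<Sum>j<n. single 0 (c j) * \<Delta> (h j))"
      unfolding H_def \<Delta>_def
      by (intro poly_mapping_eqI) (simp add: lookup_minus lookup_sum sum_distrib_right
          right_diff_distrib sum_subtractf mult.assoc)
    have "\<Delta> f = (\<Sum>j<n. single 0 (c j) * basis j)"
      unfolding c_def by (rule N) (simp add: n_def)
    also have "\<dots> = \<Delta> H + single 0 D * G"
      unfolding \<Delta>_H G_def by (simp add: hg distrib_left sum.distrib sum_distrib_left mult.left_commute)
    finally have fHG: "\<Delta> f = \<Delta> H + single 0 D * G" .
    \<comment> \<open>Since \<open>\<Delta> k\<close> is integral, \<open>k\<close> is integral up to a constant, and \<open>\<alpha>\<close> vanishes on constants.\<close>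
    define k where "k = single 0 (1 / D) * (f - H)"
    have "\<Delta> k = G"
    proof (rule poly_mapping_eqI)
      fix b
      have "lookup (\<Delta> f) b = lookup (\<Delta> H) b + D * lookup G b"
        unfolding fHG by (simp add: lookup_add)
      moreover have "lookup (\<Delta> k) b = 1 / D *
          (lookup (\<Delta> f) b - lookup (\<Delta> H) b)"
        by (simp add: \<Delta>_def k_def lookup_minus diff_divide_distrib left_diff_distrib)
      ultimately show "lookup (\<Delta> k) b = lookup G b"
        using D(1) by simp
    qed
    then have k: "k - single 0 (pairing (\<lambda>_. 1) k) \<in> integer_valued"
      using G unfolding \<Delta>_def by (intro integer_valued_if_adams_diff) simp
    have "pairing e (\<Delta> f) = pairing \<alpha> H"
      using M[of n] unfolding H_def by (simp add: n_def c_def pairing_sum pairing_scale)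
    moreover have "pairing (\<lambda>j. e j * (rho powi j - 1)) f = pairing e (\<Delta> f)"
      by (simp add: \<Delta>_def pairing_diff pairing_rescale right_diff_distrib pairing_diff_left mult.commute)
    moreover have "pairing a f = 1 / D * pairing (\<lambda>j. \<alpha> j - e j * (rho powi j - 1)) f"
      unfolding a_def by (subst pairing_scale_left[symmetric]) simp
    ultimately have "pairing a f = pairing \<alpha> k"
      by (simp add: k_def pairing_scale pairing_diff pairing_diff_left)
    also have "\<dots> = pairing \<alpha> (k - single 0 (pairing (\<lambda>_. 1) k))"
      by (simp add: pairing_diff \<alpha>0)
    also have "\<dots> \<in> Zp"
      by (rule integral_functionalsD[OF \<alpha> k])
    finally show "pairing a f \<in> Zp" .
  qed
  moreover have "\<alpha> j = D * a j + e j * (rho powi j - 1)" for j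
    using D(1) by (simp add: a_def)
  ultimately show thesis
    using e that by blast
qed

end

section \<open>Maps out of tensor products\<close>

text \<open>This identifies the product formula in \<open>tensor_lift\<close> with the homomorphism that a map on the
  generators induces.\<close>

lemma hom_free_Abelian_group_finprod:
  assumes "comm_group G" and h: "h \<in> hom (free_Abelian_group S) G" and c: "keys c \<subseteq> S"
  shows "h c = finprod G (\<lambda>m. h (frag_of m) [^]\<^bsub>G\<^esub> lookup c m) (keys c)"
proof -
  interpret G: comm_group G by fact
  interpret F: group "free_Abelian_group S" by simp
  interpret h: group_hom "free_Abelian_group S" G h
    by (simp add: group_hom_def group_hom_axioms_def h F.group_axioms G.group_axioms)
  have "h (\<Sum>m\<in>K. frag_cmul (n m) (frag_of m)) = finprod G (\<lambda>m. h (frag_of m) [^]\<^bsub>G\<^esub> n m) K"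
    if "finite K" "K \<subseteq> S" for K and n :: "_ \<Rightarrow> int"
    using that
  proof (induction K rule: finite_induct)
    case empty
    then show ?case using h.hom_one by simp
  next
    case (insert m K)
    have closed: "h (frag_of m') \<in> carrier G" if "m' \<in> S" for m'
      using that by (intro h.hom_closed) simp
    have "(\<Sum>m\<in>K. frag_cmul (n m) (frag_of m)) \<in> carrier (free_Abelian_group S)"
      using insert.prems by (intro sum_closed_free_Abelian_group) auto
    moreover have "h (frag_cmul (n m) (frag_of m)) = h (frag_of m) [^]\<^bsub>G\<^esub> n m"
      using h.hom_int_pow[of "frag_of m" "n m"] insert.prems by simp
    moreover have "keys (frag_cmul (n m) (frag_of m)) \<subseteq> S"
      using insert.prems by (auto simp: keys_frag_of)
    ultimately have "h (frag_cmul (n m) (frag_of m) + (\<Sum>m\<in>K. frag_cmul (n m) (frag_of m))) =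
        h (frag_of m) [^]\<^bsub>G\<^esub> n m \<otimes>\<^bsub>G\<^esub> h (\<Sum>m\<in>K. frag_cmul (n m) (frag_of m))"
      using h.hom_mult[of "frag_cmul (n m) (frag_of m)" "\<Sum>m\<in>K. frag_cmul (n m) (frag_of m)"] insert.prems
      by simp
    moreover have "h (frag_of m') [^]\<^bsub>G\<^esub> n m' \<in> carrier G" if "m' \<in> insert m K" for m'
      using that insert.prems by (intro G.int_pow_closed closed) auto
    ultimately show ?case
      using insert by simp
  qed
  moreover have "c = (\<Sum>m\<in>keys c. frag_cmul (lookup c m) (frag_of m))"
    using frag_expansion[of c] by (simp add: frag_extend_def)
  ultimately show ?thesis
    using c by (metis finite_keys)
qed

lemma free_Abelian_group_hom_eqI:
  assumes "comm_group G" "h \<in> hom (free_Abelian_group S) G" "k \<in> hom (free_Abelian_group S) G"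
    and "\<And>m. m \<in> S \<Longrightarrow> h (frag_of m) = k (frag_of m)" and c: "keys c \<subseteq> S"
  shows "h c = k c"
proof -
  interpret G: comm_group G by fact
  have "h (frag_of m) \<in> carrier G" if "m \<in> S" for m
    using that assms(2) by (auto simp: hom_def)
  then have "finprod G (\<lambda>m. h (frag_of m) [^]\<^bsub>G\<^esub> lookup c m) (keys c) =
      finprod G (\<lambda>m. k (frag_of m) [^]\<^bsub>G\<^esub> lookup c m) (keys c)"
    using c assms(4) by (intro G.finprod_cong') auto
  then show ?thesis
    using hom_free_Abelian_group_finprod[OF assms(1,2) c] hom_free_Abelian_group_finprod[OF assms(1,3) c]
    by simp
qed

locale tensor_factors =
  fixes R :: "('r, 'x) ring_scheme" and M :: "('r, 'a, 'y) module_scheme" and N :: "('r, 'b, 'z) module_scheme"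
  assumes add_closed_M: "\<And>x y. x \<in> carrier M \<Longrightarrow> y \<in> carrier M \<Longrightarrow> x \<oplus>\<^bsub>M\<^esub> y \<in> carrier M"
    and add_closed_N: "\<And>x y. x \<in> carrier N \<Longrightarrow> y \<in> carrier N \<Longrightarrow> x \<oplus>\<^bsub>N\<^esub> y \<in> carrier N"
    and smult_closed_M: "\<And>a x. a \<in> carrier R \<Longrightarrow> x \<in> carrier M \<Longrightarrow> a \<odot>\<^bsub>M\<^esub> x \<in> carrier M"
    and smult_closed_N: "\<And>a x. a \<in> carrier R \<Longrightarrow> x \<in> carrier N \<Longrightarrow> a \<odot>\<^bsub>N\<^esub> x \<in> carrier N"
begin

abbreviation F where "F \<equiv> free_Abelian_group (carrier M \<times> carrier N)"
abbreviation rels where "rels \<equiv> tensor_rels R M N"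
abbreviation cls where "cls \<equiv> tensor_class R M N"

definition relators :: "('a \<times> 'b \<Rightarrow>\<^sub>0 int) set" where "relators =
      {frag_of (x \<oplus>\<^bsub>M\<^esub> x', y) - frag_of (x, y) - frag_of (x', y) | x x' y.
         x \<in> carrier M \<and> x' \<in> carrier M \<and> y \<in> carrier N} \<union>
      {frag_of (x, y \<oplus>\<^bsub>N\<^esub> y') - frag_of (x, y) - frag_of (x, y') | x y y'.
         x \<in> carrier M \<and> y \<in> carrier N \<and> y' \<in> carrier N} \<union>
      {frag_of (a \<odot>\<^bsub>M\<^esub> x, y) - frag_of (x, a \<odot>\<^bsub>N\<^esub> y) | a x y.
         a \<in> carrier R \<and> x \<in> carrier M \<and> y \<in> carrier N}"

lemma rels_eq: "rels = generate F relators"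
  by (simp add: tensor_rels_def relators_def)

lemma relators_subset: "relators \<subseteq> carrier F"
  unfolding relators_def
  by (auto simp: add_closed_M add_closed_N smult_closed_M smult_closed_N dest!: subsetD[OF keys_diff])

sublocale F: comm_group F
  by (rule abelian_free_Abelian_group)

lemma rels_subgroup: "subgroup rels F"
  unfolding rels_eq by (rule F.generate_is_subgroup[OF relators_subset])

sublocale rels: normal rels F
  by (rule F.normal_iff_subgroup[THEN iffD2, OF rels_subgroup])

sublocale T: comm_group "tensor_product R M N"
  unfolding tensor_product_def by (rule F.abelian_FactGroup[OF rels_subgroup])

lemma relsD: "c \<in> rels \<Longrightarrow> keys c \<subseteq> carrier M \<times> carrier N"
  by (rule carrier_free_Abelian_group_iff[THEN iffD1, OF subsetD[OF subgroup.subset[OF rels_subgroup]]])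

lemma rels_0 [simp]: "0 \<in> rels"
  using subgroup.one_closed[OF rels_subgroup] by simp

lemma rels_add: "c \<in> rels \<Longrightarrow> d \<in> rels \<Longrightarrow> c + d \<in> rels"
  using subgroup.m_closed[OF rels_subgroup] by simp

lemma rels_uminus: "c \<in> rels \<Longrightarrow> - c \<in> rels"
  using subgroup.m_inv_closed[OF rels_subgroup, of c] relsD[of c] by simp

lemma rels_diff: "c \<in> rels \<Longrightarrow> d \<in> rels \<Longrightarrow> c - d \<in> rels"
  using rels_add[of c "- d"] rels_uminus[of d] by simp

lemma rels_sum: "(\<And>i. i \<in> I \<Longrightarrow> c i \<in> rels) \<Longrightarrow> sum c I \<in> rels"
  by (induction I rule: infinite_finite_induct) (auto intro: rels_add)

lemma rels_add_left:
  "x \<in> carrier M \<Longrightarrow> x' \<in> carrier M \<Longrightarrow> y \<in> carrier N \<Longrightarrow>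
    frag_of (x \<oplus>\<^bsub>M\<^esub> x', y) - frag_of (x, y) - frag_of (x', y) \<in> rels"
  unfolding rels_eq by (rule generate.incl) (auto simp: relators_def)

lemma rels_add_right:
  "x \<in> carrier M \<Longrightarrow> y \<in> carrier N \<Longrightarrow> y' \<in> carrier N \<Longrightarrow>
    frag_of (x, y \<oplus>\<^bsub>N\<^esub> y') - frag_of (x, y) - frag_of (x, y') \<in> rels"
  unfolding rels_eq by (rule generate.incl) (auto simp: relators_def)

lemma rels_balanced:
  "a \<in> carrier R \<Longrightarrow> x \<in> carrier M \<Longrightarrow> y \<in> carrier N \<Longrightarrow>
    frag_of (a \<odot>\<^bsub>M\<^esub> x, y) - frag_of (x, a \<odot>\<^bsub>N\<^esub> y) \<in> rels"
  unfolding rels_eq by (rule generate.incl) (auto simp: relators_def)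

lemma cls_eq: 
  assumes "keys c \<subseteq> carrier M \<times> carrier N"
  shows "cls c = {d. keys d \<subseteq> carrier M \<times> carrier N \<and> d - c \<in> rels}"
proof -
  have "cls c = {b + c | b. b \<in> rels}"
    by (auto simp: tensor_class_def r_coset_def)
  also have "\<dots> = {d. keys d \<subseteq> carrier M \<times> carrier N \<and> d - c \<in> rels}"
    using relsD assms keys_add by (force intro: exI[of _ "_ - c"])
  finally show ?thesis .
qed

lemma cls_eq_iff:
  assumes "keys c \<subseteq> carrier M \<times> carrier N" "keys d \<subseteq> carrier M \<times> carrier N"
  shows "cls c = cls d \<longleftrightarrow> c - d \<in> rels"
proof
  assume "cls c = cls d"
  moreover have "c \<in> cls c"
    using assms(1) by (simp add: cls_eq)
  ultimately show "c - d \<in> rels"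
    using assms by (simp add: cls_eq)
next
  assume "c - d \<in> rels"
  then have "e - c \<in> rels \<longleftrightarrow> e - d \<in> rels" for e
    using rels_add[of "e - c" "c - d"] rels_diff[of "e - d" "c - d"] by auto
  then show "cls c = cls d"
    using assms by (simp add: cls_eq)
qed

lemma carrier_tensor_product: "carrier (tensor_product R M N) = cls ` carrier F"
  by (simp add: tensor_product_def tensor_class_def carrier_FactGroup)

lemma cls_hom: "cls \<in> hom F (tensor_product R M N)"
  unfolding tensor_product_def tensor_class_def[abs_def] by (rule rels.r_coset_hom_Mod)

text \<open>For a balanced map the induced homomorphism of the free abelian group kills the relators, so all
  formal sums in one class have the same image, which is the value of \<open>tensor_lift\<close>.\<close>

lemma tensor_lift_universal:
  assumes G: "comm_group G"
    and closed: "\<And>x y. x \<in> carrier M \<Longrightarrow> y \<in> carrier N \<Longrightarrow> \<mu> (x, y) \<in> carrier G"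
    and left: "\<And>x x' y. x \<in> carrier M \<Longrightarrow> x' \<in> carrier M \<Longrightarrow> y \<in> carrier N \<Longrightarrow>
      \<mu> (x \<oplus>\<^bsub>M\<^esub> x', y) = \<mu> (x, y) \<otimes>\<^bsub>G\<^esub> \<mu> (x', y)"
    and right: "\<And>x y y'. x \<in> carrier M \<Longrightarrow> y \<in> carrier N \<Longrightarrow> y' \<in> carrier N \<Longrightarrow>
      \<mu> (x, y \<oplus>\<^bsub>N\<^esub> y') = \<mu> (x, y) \<otimes>\<^bsub>G\<^esub> \<mu> (x, y')"
    and balanced: "\<And>a x y. a \<in> carrier R \<Longrightarrow> x \<in> carrier M \<Longrightarrow> y \<in> carrier N \<Longrightarrow>
      \<mu> (a \<odot>\<^bsub>M\<^esub> x, y) = \<mu> (x, a \<odot>\<^bsub>N\<^esub> y)"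
  shows "tensor_lift G \<mu> \<in> hom (tensor_product R M N) G"
    and "x \<in> carrier M \<Longrightarrow> y \<in> carrier N \<Longrightarrow> tensor_lift G \<mu> (cls (frag_of (x, y))) = \<mu> (x, y)"
proof -
  interpret G: comm_group G by fact
  have "\<mu> ` (carrier M \<times> carrier N) \<subseteq> carrier G"
    using closed by auto
  then obtain h where h: "h \<in> hom F G" and
    h_frag: "\<And>m. m \<in> carrier M \<times> carrier N \<Longrightarrow> h (frag_of m) = \<mu> m"
    using G.free_Abelian_group_universal[of \<mu> "carrier M \<times> carrier N"] by metis
  interpret h: group_hom F G h
    by (simp add: group_hom_def group_hom_axioms_def h F.group_axioms G.group_axioms)
  have h_diff: "h (c - d) = h c \<otimes>\<^bsub>G\<^esub> inv\<^bsub>G\<^esub> h d" if "c \<in> carrier F" "d \<in> carrier F" for c d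
    using h.hom_mult[of c "- d"] h.hom_inv[of d] that by simp
  have frag: "frag_of (x, y) \<in> carrier F" if "x \<in> carrier M" "y \<in> carrier N" for x y
    using that by simp
  have frag2: "frag_of (x, y) - frag_of (x', y') \<in> carrier F"
    if "x \<in> carrier M" "y \<in> carrier N" "x' \<in> carrier M" "y' \<in> carrier N" for x y x' y'
    using that keys_diff[of "frag_of (x, y)" "frag_of (x', y')"] by auto
  have cancel: "u \<otimes>\<^bsub>G\<^esub> v \<otimes>\<^bsub>G\<^esub> inv\<^bsub>G\<^esub> u \<otimes>\<^bsub>G\<^esub> inv\<^bsub>G\<^esub> v = \<one>\<^bsub>G\<^esub>"
    if "u \<in> carrier G" "v \<in> carrier G" for u v
    using that by (metis G.inv_closed G.m_assoc G.m_comm G.r_inv G.r_one G.m_closed)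
  have h_relators: "h c = \<one>\<^bsub>G\<^esub>" if "c \<in> relators" for c
    using that unfolding relators_def
    by (auto simp: h_diff frag frag2 h_frag left right balanced closed cancel G.r_inv
        add_closed_M add_closed_N smult_closed_M smult_closed_N
        simp del: carrier_free_Abelian_group_iff)
  have h_rels: "h c = \<one>\<^bsub>G\<^esub>" if "c \<in> rels" for c
    using that unfolding rels_eq
  proof (induction rule: generate.induct)
    case (inv c)
    then have "c \<in> carrier F"
      using relators_subset by (rule subsetD[rotated])
    then show ?case
      unfolding h.hom_inv[OF \<open>c \<in> carrier F\<close>] h_relators[OF inv] by simp
  next
    case (eng c d)
    then have "c \<in> carrier F" "d \<in> carrier F"
      using relators_subset F.generate_in_carrier by blast+
    with eng show ?case
      using h.hom_mult by simp
  qed (use h.hom_one in \<open>auto simp: h_relators\<close>)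
  have lift: "tensor_lift G \<mu> (cls c) = h c" if c: "keys c \<subseteq> carrier M \<times> carrier N" for c
  proof -
    have "finprod G (\<lambda>m. \<mu> m [^]\<^bsub>G\<^esub> lookup d m) (keys d) = h c" if "d \<in> cls c" for d
    proof -
      have d: "keys d \<subseteq> carrier M \<times> carrier N" "d - c \<in> rels"
        using that c by (auto simp: cls_eq)
      have "h d = finprod G (\<lambda>m. h (frag_of m) [^]\<^bsub>G\<^esub> lookup d m) (keys d)"
        by (rule hom_free_Abelian_group_finprod[OF G h d(1)])
      also have "\<dots> = finprod G (\<lambda>m. \<mu> m [^]\<^bsub>G\<^esub> lookup d m) (keys d)"
        using d(1) closed by (intro G.finprod_cong') (auto simp: h_frag subset_iff)
      finally have "finprod G (\<lambda>m. \<mu> m [^]\<^bsub>G\<^esub> lookup d m) (keys d) = h d"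
        by simp
      also have "h d = h (d - c) \<otimes>\<^bsub>G\<^esub> h c"
        using h.hom_mult[of "d - c" c] relsD[OF d(2)] c by simp
      also have "\<dots> = h c"
        using h_rels[OF d(2)] h.hom_closed[of c] c by simp
      finally show ?thesis .
    qed
    moreover have "c \<in> cls c"
      using c by (simp add: cls_eq)
    ultimately have "(\<lambda>d. finprod G (\<lambda>m. \<mu> m [^]\<^bsub>G\<^esub> lookup d m) (keys d)) ` cls c = {h c}"
      by (auto intro!: image_eqI[of _ _ c])
    then show ?thesis
      by (simp add: tensor_lift_def)
  qed
  show "tensor_lift G \<mu> \<in> hom (tensor_product R M N) G"
  proof (rule homI)
    fix X assume "X \<in> carrier (tensor_product R M N)"
    then show "tensor_lift G \<mu> X \<in> carrier G"
      using h.hom_closed by (auto simp: carrier_tensor_product lift)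
  next
    fix X Y assume "X \<in> carrier (tensor_product R M N)" "Y \<in> carrier (tensor_product R M N)"
    then obtain c d where cd: "X = cls c" "Y = cls d" "c \<in> carrier F" "d \<in> carrier F"
      by (auto simp: carrier_tensor_product)
    then have "X \<otimes>\<^bsub>tensor_product R M N\<^esub> Y = cls (c + d)"
      using hom_mult[OF cls_hom, of c d] by simp
    moreover have "keys (c + d) \<subseteq> carrier M \<times> carrier N"
      using cd F.m_closed[of c d] by simp
    ultimately show "tensor_lift G \<mu> (X \<otimes>\<^bsub>tensor_product R M N\<^esub> Y) = tensor_lift G \<mu> X \<otimes>\<^bsub>G\<^esub> tensor_lift G \<mu> Y"
      using cd h.hom_mult[of c d] by (simp add: lift)
  qed
  show "tensor_lift G \<mu> (cls (frag_of (x, y))) = \<mu> (x, y)" if "x \<in> carrier M" "y \<in> carrier N"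
    using that by (simp add: lift h_frag)
qed

end

section \<open>Laurent polynomials in two and three variables\<close>

lemma change_exponents_0 [simp]: "change_exponents \<phi> 0 = 0"
  by (simp add: change_exponents_def)

lemma change_exponents_single [simp]:
  "change_exponents \<phi> (single m c) = single (\<phi> m) c"
  by (cases "c = 0") (simp_all add: change_exponents_def)

lemma change_exponents_add: "change_exponents \<phi> (f + g) = change_exponents \<phi> f + change_exponents \<phi> g"
  unfolding change_exponents_def by (rule setsum_keys_plus_distrib) (simp_all add: single_add)

lemma change_exponents_mult:
  fixes \<phi> :: "'m::cancel_comm_monoid_add \<Rightarrow> 'n::cancel_comm_monoid_add"
  assumes "\<And>m m'. \<phi> (m + m') = \<phi> m + \<phi> m'"
  shows "change_exponents \<phi> (f * g) = change_exponents \<phi> f * change_exponents \<phi> g"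
proof (induction f rule: poly_mapping_additive_induct)
  case (single m c)
  show ?case
    by (induction g rule: poly_mapping_additive_induct)
      (simp_all add: mult_single distrib_left change_exponents_add assms)
qed (simp_all add: distrib_right change_exponents_add)

lemma lookup_single_mult_pair:
  fixes f :: laurent2
  shows "lookup (single (i, j) c * f) (a, b) = c * lookup f (a - i, b - j)"
  by (simp add: lookup_single_mult)

lemma lookup_eta_L: "lookup (eta_L a) (i, j) = (if j = 0 then lookup a i else 0)"
  by (induction a rule: poly_mapping_additive_induct)
    (auto simp: eta_L_def change_exponents_add lookup_add lookup_single when_def)

text \<open>The Laurent polynomial \<open>f(w/u)\<close>.\<close>

definition quotient_variable :: "laurent \<Rightarrow> laurent2"
  where "quotient_variable = change_exponents (\<lambda>b. (- b, b))"

lemma lookup_quotient_variable: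
  "lookup (quotient_variable f) (a, b) = (if a = - b then lookup f b else 0)"
  by (induction f rule: poly_mapping_additive_induct)
    (auto simp: quotient_variable_def change_exponents_add lookup_add lookup_single when_def)

text \<open>The part of degree \<open>d\<close>, divided by \<open>u\<^sup>d\<close>, as a Laurent polynomial in \<open>x = w/u\<close>.\<close>

definition degree_part :: "int \<Rightarrow> laurent2 \<Rightarrow> laurent"
  where "degree_part d = Poly_Mapping.map_key (\<lambda>b. (d - b, b))"

lemma lookup_degree_part [simp]:
  "lookup (degree_part d f) b = lookup f (d - b, b)"
  by (simp add: degree_part_def map_key.rep_eq inj_def)

lemma degree_part_0 [simp]: "degree_part d 0 = 0"
  by (rule poly_mapping_eqI) simp

lemma degree_part_add: "degree_part d (f + g) = degree_part d f + degree_part d g"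
  by (rule poly_mapping_eqI) (simp add: lookup_add)

lemma degree_part_uminus: "degree_part d (- f) = - degree_part d f"
  by (rule poly_mapping_eqI) simp

lemma degree_part_single_mult:
  "degree_part d (single (i, j) c * f) =
     single 0 c * (single j 1 * degree_part (d - i - j) f)"
  by (rule poly_mapping_eqI) (simp add: lookup_single_mult diff_right_commute diff_diff_eq add.commute)

lemma degree_part_quotient_variable: "degree_part d (quotient_variable f) = (if d = 0 then f else 0)"
  by (rule poly_mapping_eqI) (simp add: lookup_quotient_variable)

lemma eval2_add: "eval2 k l (f + g) = eval2 k l f + eval2 k l g"
  using setsum_keys_plus_distrib[of
      "\<lambda>m c. single (fst m + snd m) (c * k powi fst m * l powi snd m)" f g]
  by (simp add: eval2_def split_beta single_add distrib_right)

lemma lookup_eval2: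
  assumes "k \<noteq> 0"
  shows "lookup (eval2 k l f) d = k powi d * evaluate (l / k) (degree_part d f)"
proof (induction f rule: poly_mapping_additive_induct)
  case zero
  then show ?case by (simp add: eval2_def)
next
  case (single m c)
  obtain a b where m: "m = (a, b)" by force
  have "degree_part d (single (a, b) c) = (if a + b = d then single b c else 0)"
    by (rule poly_mapping_eqI) (auto simp: lookup_single when_def)
  moreover have "k powi (a + b) * (c * (l / k) powi b) = c * k powi a * l powi b"
    using assms by (simp add: power_int_add power_int_divide_distrib)
  moreover have "eval2 k l (single (a, b) c) = single (a + b) (c * k powi a * l powi b)"
    by (cases "c = 0") (simp_all add: eval2_def)
  ultimately show ?case
    unfolding m by (auto simp: lookup_single when_def)
next
  case (add f g)
  then show ?case
    by (simp add: eval2_add degree_part_add pairing_add lookup_add distrib_left)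
qed

section \<open>The modules of the resolution\<close>

context adams_generator begin

abbreviation A :: "laurent2 set" where "A \<equiv> E1E1 p"

text \<open>In degree \<open>d\<close>, evaluation at \<open>(k\<^sup>p\<^sup>-\<^sup>1, l\<^sup>p\<^sup>-\<^sup>1)\<close> is evaluation of the degree part at
  \<open>(l/k)\<^sup>p\<^sup>-\<^sup>1\<close>, up to a unit. For \<open>k = 1\<close> and \<open>l = r\<^sup>j\<close> these are the powers of \<open>rho\<close>, which
  suffice.\<close>

theorem E1E1_iff: "f \<in> A \<longleftrightarrow> (\<forall>d. degree_part d f \<in> integer_valued)"
proof
  assume f: "f \<in> A"
  show "\<forall>d. degree_part d f \<in> integer_valued"
  proof (intro allI integer_valued_if_integral_at_rho_powers)
    fix d j
    have "\<not> int p dvd r ^ j" "\<not> int p dvd 1"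
      using not_dvd_r prime_p prime_dvd_power[of "int p" r j] by auto
    then have "eval2 (of_int 1 ^ (p - 1)) (of_int (r ^ j) ^ (p - 1)) f \<in> carrier (E1 p)"
      using f unfolding E1E1_def by blast
    then have "lookup (eval2 1 (of_int (r ^ j) ^ (p - 1)) f) d \<in> Zp"
      by (simp add: E1_def)
    moreover have "of_int (r ^ j) ^ (p - 1) = rho ^ j"
      by (simp add: rho_def mult.commute flip: power_mult)
    ultimately show "evaluate (rho ^ j) (degree_part d f) \<in> Zp"
      by (simp add: lookup_eval2)
  qed
next
  assume f: "\<forall>d. degree_part d f \<in> integer_valued"
  show "f \<in> A"
    unfolding E1E1_def E1_def
  proof clarsimp
    fix k l :: int and d
    assume "\<not> int p dvd k" "\<not> int p dvd l"
    then have k: "of_int k ^ (p - 1) \<in> one_units" and l: "of_int l ^ (p - 1) \<in> one_units"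
      by - (rule fermat_one_units; assumption)+
    have "of_int l ^ (p - 1) / of_int k ^ (p - 1) \<in> one_units"
      using one_units_mult[OF l one_units_inverse[OF k]] by (simp add: divide_inverse)
    then have "evaluate (of_int l ^ (p - 1) / of_int k ^ (p - 1)) (degree_part d f) \<in> Zp"
      using f by (simp add: integer_valuedD)
    then show "lookup (eval2 (of_int k ^ (p - Suc 0)) (of_int l ^ (p - Suc 0)) f) d \<in> Zp"
      using one_units_nonzero[OF k] one_units_Zp[OF one_units_powi[OF k]]
      by (simp add: lookup_eval2 Zp_mult)
  qed
qed

lemma E1E1_0 [simp]: "0 \<in> A"
  by (simp add: E1E1_iff)

lemma E1E1_add: "f \<in> A \<Longrightarrow> g \<in> A \<Longrightarrow> f + g \<in> A"
  by (simp add: E1E1_iff degree_part_add integer_valued_add)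

lemma E1E1_uminus: "f \<in> A \<Longrightarrow> - f \<in> A"
  using integer_valued_diff[OF integer_valued_0] by (fastforce simp: E1E1_iff degree_part_uminus)

lemma E1E1_diff: "f \<in> A \<Longrightarrow> g \<in> A \<Longrightarrow> f - g \<in> A"
  using E1E1_add[of f "- g"] E1E1_uminus[of g] by simp

lemma E1E1_sum: "(\<And>i. i \<in> I \<Longrightarrow> f i \<in> A) \<Longrightarrow> sum f I \<in> A"
  by (induction I rule: infinite_finite_induct) (auto intro: E1E1_add)

lemma E1E1_single_mult: "c \<in> Zp \<Longrightarrow> f \<in> A \<Longrightarrow> single (i, j) c * f \<in> A"
  by (simp add: E1E1_iff degree_part_single_mult integer_valued_scale integer_valued_shift)

lemma E1E1_change_exponents_mult:
  assumes "a \<in> carrier (E1 p)" "f \<in> A" shows "change_exponents \<phi> a * f \<in> A"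
proof -
  have "single (\<phi> m) (lookup a m) * f \<in> A" for m
    using assms by (cases "\<phi> m") (simp add: E1_def E1E1_single_mult)
  then show ?thesis
    by (simp add: change_exponents_def sum_distrib_right E1E1_sum)
qed

lemma E1E1_quotient_variable: "f \<in> integer_valued \<Longrightarrow> quotient_variable f \<in> A"
  by (simp add: E1E1_iff degree_part_quotient_variable)

lemma E1E1_single: "c \<in> Zp \<Longrightarrow> single (i, j) c \<in> A"
proof -
  assume "c \<in> Zp"
  moreover have "quotient_variable (single 0 1) = single 0 1"
    by (simp add: quotient_variable_def zero_prod_def del: single_one)
  then have "1 \<in> A"
    using E1E1_quotient_variable[OF integer_valued_single[OF Zp_1, of 0]] by simp
  ultimately show ?thesis
    using E1E1_single_mult[of c 1 i j] by simp
qed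

lemma E1Q_iff: "f \<in> E1Q \<longleftrightarrow> (\<forall>a b. b \<noteq> 0 \<longrightarrow> lookup f (a, b) = 0)"
  by (auto simp: E1Q_def in_keys_iff)

definition res_set :: "int \<Rightarrow> laurent2 set"
  where "res_set j = (if j = 0 \<or> j = 1 then A else if j = 2 then E1Q else {0})"

lemma carrier_res_obj [simp]: "carrier (res_obj p j) = res_set j"
  by (simp add: res_obj_def res_set_def left_E1_module_def module.defs comodule.defs)

lemma res_obj_simps [simp]:
  "x \<oplus>\<^bsub>res_obj p j\<^esub> y = x + y" "\<zero>\<^bsub>res_obj p j\<^esub> = 0" "a \<odot>\<^bsub>res_obj p j\<^esub> x = eta_L a * x"
  "hcomp (res_obj p j) = internal_comp p (res_set j)"
  by (auto simp: res_obj_def res_set_def left_E1_module_def module.defs comodule.defs)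

lemma coact_res_obj: "coact (res_obj p j) =
  (if j = 0 \<or> j = 1 then coproduct p else if j = 2 then coact_Q p E1Q else coact_Q p {0})"
  by (simp add: res_obj_def module.defs comodule.defs)

lemma res_set_0 [simp]: "0 \<in> res_set j"
  by (simp add: res_set_def E1Q_iff)

lemma res_set_add: "x \<in> res_set j \<Longrightarrow> y \<in> res_set j \<Longrightarrow> x + y \<in> res_set j"
  by (auto simp: res_set_def E1Q_iff lookup_add E1E1_add split: if_splits)

lemma res_set_sum: "(\<And>i. i \<in> I \<Longrightarrow> x i \<in> res_set j) \<Longrightarrow> sum x I \<in> res_set j"
  by (induction I rule: infinite_finite_induct) (auto intro: res_set_add)

lemma E1Q_eta_L_mult: "x \<in> E1Q \<Longrightarrow> eta_L a * x \<in> E1Q"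
proof -
  assume x: "x \<in> E1Q"
  have "lookup (eta_L a * x) (i, b) = 0" if "b \<noteq> 0" for i b
    using that x
    by (induction a rule: poly_mapping_additive_induct)
      (simp_all add: eta_L_def change_exponents_add distrib_right lookup_add lookup_single_mult_pair E1Q_iff)
  then show ?thesis by (simp add: E1Q_iff)
qed

lemma res_set_eta_L: "a \<in> carrier (E1 p) \<Longrightarrow> x \<in> res_set j \<Longrightarrow> eta_L a * x \<in> res_set j"
  by (auto simp: res_set_def E1Q_eta_L_mult)
    (auto simp: eta_L_def E1E1_change_exponents_mult)

end

section \<open>Tensor products inside Laurent polynomials in three variables\<close>

abbreviation ex12 :: "laurent2 \<Rightarrow> laurent3" where "ex12 \<equiv> change_exponents (\<lambda>(a, b). (a, b, 0))"
abbreviation ex23 :: "laurent2 \<Rightarrow> laurent3" where "ex23 \<equiv> change_exponents (Pair 0)"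
abbreviation ex13 :: "laurent2 \<Rightarrow> laurent3" where "ex13 \<equiv> change_exponents (\<lambda>(a, b). (a, 0, b))"

lemma ex12_mult: "ex12 (f * g) = ex12 f * ex12 g"
  and ex23_mult: "ex23 (f * g) = ex23 f * ex23 g"
  by (rule change_exponents_mult; auto)+

lemma lookup_ex12: "lookup (ex12 f) (a, b, c) = (if c = 0 then lookup f (a, b) else 0)"
  by (induction f rule: poly_mapping_additive_induct)
    (auto simp: change_exponents_add lookup_add lookup_single when_def split: prod.splits)

lemma lookup_ex23: "lookup (ex23 f) (a, b, c) = (if a = 0 then lookup f (b, c) else 0)"
  by (induction f rule: poly_mapping_additive_induct)
    (auto simp: change_exponents_add lookup_add lookup_single when_def split: prod.splits)

lemma lookup_ex13: "lookup (ex13 f) (a, b, c) = (if b = 0 then lookup f (a, c) else 0)"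
  by (induction f rule: poly_mapping_additive_induct)
    (auto simp: change_exponents_add lookup_add lookup_single when_def split: prod.splits)

lemma poly_mapping3_eqI:
  "(\<And>a b c. lookup f (a, b, c) = lookup g (a, b, c)) \<Longrightarrow> f = g"
  by (rule poly_mapping_eqI) auto

lemma poly_mapping2_eqI:
  "(\<And>a b. lookup f (a, b) = lookup g (a, b)) \<Longrightarrow> f = g"
  by (rule poly_mapping_eqI) auto

lemma ex_balanced: "ex12 (eta_R a * g) * ex23 h = ex12 g * ex23 (eta_L a * h)"
proof -
  have "ex12 (eta_R a) = ex23 (eta_L a)"
    by (induction a rule: poly_mapping_additive_induct)
      (simp_all add: eta_L_def eta_R_def change_exponents_add)
  then show ?thesis
    by (simp add: ex12_mult ex23_mult mult_ac)
qed

text \<open>The coefficients of \<open>g(x, y) f(z/y)\<close> are products of a coefficient of \<open>f\<close> and one of \<open>g\<close>, so linear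
  independence over \<open>\<rat>\<close> of the \<open>f\<close> gives independence of the \<open>f(z/y)\<close> over Laurent polynomials in \<open>x\<close> and \<open>y\<close>.\<close>

lemma lookup_ex12_mult_quotient_variable:
  "lookup (ex12 g * ex23 (quotient_variable f)) (a, b, c) =
     lookup f c * lookup g (a, b + c)"
proof (induction f rule: poly_mapping_additive_induct)
  case (single m t)
  have "lookup (single (0, - m, m) t * ex12 g) (a, b, c) =
      t * lookup (ex12 g) ((a, b, c) - (0, - m, m))"
    by (rule lookup_single_mult)
  then show ?case
    by (simp add: quotient_variable_def lookup_ex12 mult.commute[of "ex12 g"] lookup_single when_def)
qed (simp_all add: quotient_variable_def change_exponents_add distrib_left distrib_right lookup_add)

lemma tensor_value_0 [simp]: "tensor_value 0 = 0"
  by (simp add: tensor_value_def)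

lemma tensor_value_add: "tensor_value (c + d) = tensor_value c + tensor_value d"
  using setsum_keys_plus_distrib[of
      "\<lambda>m t. of_int t * (ex12 (fst m) * ex23 (snd m))" c d]
  by (simp add: tensor_value_def split_beta distrib_right)

lemma tensor_value_uminus: "tensor_value (- c) = - tensor_value c"
  using tensor_value_add[of c "- c"] by (simp add: add_eq_0_iff)

lemma tensor_value_diff: "tensor_value (c - d) = tensor_value c - tensor_value d"
  using tensor_value_add[of c "- d"] by (simp add: tensor_value_uminus)

lemma tensor_value_sum: "tensor_value (sum c I) = (\<Sum>i\<in>I. tensor_value (c i))"
  by (induction I rule: infinite_finite_induct) (simp_all add: tensor_value_add)

lemma tensor_value_frag_of [simp]: "tensor_value (frag_of (g, h)) = ex12 g * ex23 h"
  by (simp add: tensor_value_def keys_frag_of)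

context adams_generator begin

lemma right_E1E1_simps [simp]:
  "carrier (right_E1E1 p) = A" "x \<oplus>\<^bsub>right_E1E1 p\<^esub> y = x + y" "a \<odot>\<^bsub>right_E1E1 p\<^esub> x = eta_R a * x"
  by (simp_all add: right_E1E1_def)

lemma E1E1_eta_R: "a \<in> carrier (E1 p) \<Longrightarrow> x \<in> A \<Longrightarrow> eta_R a * x \<in> A"
  by (simp add: eta_R_def E1E1_change_exponents_mult)

lemma single_in_E1: "c \<in> Zp \<Longrightarrow> single i c \<in> carrier (E1 p)"
  by (auto simp: E1_def lookup_single when_def)

text \<open>The coactions of the resolution take values in the following tensor products.\<close>

lemma tensor_factors_res: "tensor_factors (E1 p) (right_E1E1 p) (res_obj p j)"
  by unfold_locales (simp_all add: E1E1_add res_set_add E1E1_eta_R res_set_eta_L)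

interpretation res: tensor_factors "E1 p" "right_E1E1 p" "res_obj p j" for j
  by (rule tensor_factors_res)

abbreviation T_mod where "T_mod j \<equiv> tensor_product (E1 p) (right_E1E1 p) (res_obj p j)"
abbreviation cls where "cls j \<equiv> tensor_class (E1 p) (right_E1E1 p) (res_obj p j)"
abbreviation qbasis where "qbasis i \<equiv> quotient_variable (basis i)"
abbreviation Hom where "Hom t i j \<equiv> comodule_hom (E1 p) (right_E1E1 p) t (res_obj p i) (res_obj p j)"
abbreviation rels where "rels j \<equiv> tensor_rels (E1 p) (right_E1E1 p) (res_obj p j)"

lemma rels_zero_left: "y \<in> res_set j \<Longrightarrow> frag_of (0, y) \<in> rels j"
  using res.rels_uminus[OF res.rels_add_left[of 0 0 y j]] by simp

lemma rels_diff_left: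
  "x \<in> A \<Longrightarrow> x' \<in> A \<Longrightarrow> y \<in> res_set j \<Longrightarrow>
    frag_of (x, y) - frag_of (x', y) - frag_of (x - x', y) \<in> rels j"
  using res.rels_add_left[of "x - x'" x' y j] by (simp add: E1E1_diff diff_diff_eq add.commute)

lemma rels_zero_right: "x \<in> A \<Longrightarrow> frag_of (x, 0) \<in> rels j"
  using res.rels_uminus[OF res.rels_add_right[of x 0 j 0]] by simp

lemma rels_sum_right:
  assumes "x \<in> A" "finite I" "\<And>i. i \<in> I \<Longrightarrow> y i \<in> res_set j"
  shows "frag_of (x, sum y I) - (\<Sum>i\<in>I. frag_of (x, y i)) \<in> rels j"
  using assms(2,3)
proof (induction I rule: finite_induct)
  case empty
  then show ?case using rels_zero_right[OF assms(1)] by simp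
next
  case (insert i I)
  have "frag_of (x, y i + sum y I) - frag_of (x, y i) - frag_of (x, sum y I) \<in> rels j"
    using res.rels_add_right[of x "y i" j "sum y I"] assms(1) insert by (simp add: res_set_sum)
  from res.rels_add[OF this insert.IH] show ?case
    using insert by (simp add: algebra_simps)
qed

lemma tensor_value_rels:
  assumes "c \<in> rels j" shows "tensor_value c = 0"
  using assms unfolding res.rels_eq
proof (induction rule: generate.induct)
  case (incl c)
  then show ?case
    unfolding res.relators_def
    by (auto simp: tensor_value_diff change_exponents_add distrib_left distrib_right ex_balanced)
next
  case (inv c)
  then have "tensor_value c = 0"
    unfolding res.relators_def
    by (auto simp: tensor_value_diff change_exponents_add distrib_left distrib_right ex_balanced)
  moreover have "c \<in> carrier (free_Abelian_group (carrier (right_E1E1 p) \<times> carrier (res_obj p j)))"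
    using inv res.relators_subset by blast
  ultimately show ?case
    by (simp add: tensor_value_uminus)
qed (simp_all add: tensor_value_add)

text \<open>\<open>E(1)\<^sub>*E(1)\<close> is free as a left \<open>E(1)\<^sub>*\<close>-module: expanding each degree part along the basis gives
  the coefficient of \<open>v\<^sub>1\<^sup>d\<close> in each \<open>a j\<close>.\<close>

lemma E1E1_basis_expansion:
  assumes "y \<in> A"
  obtains n a where "\<And>j. a j \<in> carrier (E1 p)" 
    "y = (\<Sum>j<n. eta_L (a j) * qbasis j)"
proof -
  define D where "D = (\<lambda>(a, b). a + b) ` keys y"
  have D: "finite D" by (simp add: D_def)
  have "\<exists>N. \<forall>n\<ge>N. degree_part d y =
      (\<Sum>j<n. single 0 (pairing (coordinate j) (degree_part d y)) * basis j)" for d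
    using basis_expansion by metis
  then obtain N where N: "\<And>d n. n \<ge> N d \<Longrightarrow> degree_part d y =
      (\<Sum>j<n. single 0 (pairing (coordinate j) (degree_part d y)) * basis j)"
    by metis
  define n where "n = (\<Sum>d\<in>D. N d)"
  define a where "a j = (\<Sum>d\<in>D. single d (pairing (coordinate j) (degree_part d y)))" for j
  have "a j \<in> carrier (E1 p)" for j
  proof -
    have "pairing (coordinate j) (degree_part d y) \<in> Zp" for d
      using assms by (intro integral_functionalsD[OF coordinate_integral]) (simp add: E1E1_iff)
    then show ?thesis
      by (auto simp: a_def E1_def lookup_sum lookup_single when_def intro!: Zp_sum)
  qed
  moreover have "y = (\<Sum>j<n. eta_L (a j) * qbasis j)"
  proof (rule poly_mapping2_eqI)
    fix i b
    have lookup: "lookup (eta_L (a j) * qbasis j) (i, b) =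
        (\<Sum>d\<in>D. if d = i + b then pairing (coordinate j) (degree_part d y) * lookup (basis j) b else 0)" for j
    proof -
      have "eta_L (a j) = (\<Sum>d\<in>D. single (d, 0) (pairing (coordinate j) (degree_part d y)))"
        by (rule poly_mapping2_eqI)
          (auto simp: lookup_eta_L a_def lookup_sum lookup_single when_def intro!: sum.cong)
      then show ?thesis
        by (auto simp: sum_distrib_right lookup_sum lookup_single_mult_pair lookup_quotient_variable
            intro!: sum.cong)
    qed
    show "lookup y (i, b) =
        lookup (\<Sum>j<n. eta_L (a j) * qbasis j) (i, b)"
    proof (cases "i + b \<in> D")
      case True
      then have "n \<ge> N (i + b)"
        unfolding n_def using D by (intro member_le_sum) auto
      from arg_cong[OF N[OF this], of "\<lambda>f. lookup f b"]
      have "lookup y (i, b) = (\<Sum>j<n. pairing (coordinate j) (degree_part (i + b) y) *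
          lookup (basis j) b)"
        by (simp add: lookup_sum)
      then show ?thesis
        using D True by (simp add: lookup_sum lookup sum.delta)
    next
      case False
      then have "(i, b) \<notin> keys y"
        by (force simp: D_def)
      with False D show ?thesis
        by (simp add: lookup_sum lookup sum.delta in_keys_iff)
    qed
  qed
  ultimately show thesis by (rule that)
qed

lemma res_set_0_1: "j = 0 \<or> j = 1 \<Longrightarrow> res_set j = A"
  by (auto simp: res_set_def)

text \<open>Expand the right factor along the basis and move the coefficients in \<open>E(1)\<^sub>*\<close> across the tensor
  sign. Allowing every large \<open>n\<close> makes it possible to add two such expressions.\<close>

lemma tensor_normal_form:
  assumes j: "j = 0 \<or> j = 1" and c: "keys c \<subseteq> A \<times> A"
  shows "\<exists>g N. (\<forall>i. g i \<in> A) \<and> (\<forall>n\<ge>N. c - (\<Sum>i<n. frag_of (g i, qbasis i)) \<in> rels j)"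
  using c
proof (induction c rule: frag_induction)
  case zero
  have "0 - (\<Sum>i<n. frag_of (0, qbasis i)) \<in> rels j" for n
    using j by (intro res.rels_diff res.rels_0 res.rels_sum rels_zero_left)
      (simp add: res_set_0_1 E1E1_quotient_variable basis_integer_valued)
  then show ?case by (intro exI[of _ "\<lambda>_. 0"]) auto
next
  case (diff c d)
  then obtain g N h M where
    g: "\<And>i. g i \<in> A" "\<And>n. n \<ge> N \<Longrightarrow> c - (\<Sum>i<n. frag_of (g i, qbasis i)) \<in> rels j" and
    h: "\<And>i. h i \<in> A" "\<And>n. n \<ge> M \<Longrightarrow> d - (\<Sum>i<n. frag_of (h i, qbasis i)) \<in> rels j"
    by blast
  have "c - d - (\<Sum>i<n. frag_of (g i - h i, qbasis i)) \<in> rels j" if n: "n \<ge> N + M" for n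
  proof -
    have gh: "(\<Sum>i<n. frag_of (g i, qbasis i) - frag_of (h i, qbasis i)
        - frag_of (g i - h i, qbasis i)) \<in> rels j"
      using j g(1) h(1) by (intro res.rels_sum rels_diff_left)
        (simp_all add: res_set_0_1 E1E1_quotient_variable basis_integer_valued)
    have "N \<le> n" "M \<le> n" using n by auto
    from res.rels_add[OF res.rels_diff[OF g(2)[OF this(1)] h(2)[OF this(2)]] gh] show ?thesis
      by (simp add: sum_subtractf sum.distrib algebra_simps)
  qed
  then show ?case
    using E1E1_diff[OF g(1) h(1)] by (intro exI[of _ "\<lambda>i. g i - h i"] exI[of _ "N + M"]) auto
next
  case (one m)
  obtain x y where m: "m = (x, y)" and x: "x \<in> A" and y: "y \<in> A"
    using one by force
  obtain n a where a: "\<And>i. a i \<in> carrier (E1 p)" 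
      and ya: "y = (\<Sum>i<n. eta_L (a i) * qbasis i)"
    using E1E1_basis_expansion[OF y] by metis
  define g where "g i = (if i < n then eta_R (a i) * x else 0)" for i
  have gA: "g i \<in> A" for i
    using a x by (simp add: g_def E1E1_eta_R)
  have B: "qbasis i \<in> res_set j" for i
    using j by (simp add: res_set_0_1 E1E1_quotient_variable basis_integer_valued)
  have "frag_of (x, y) - (\<Sum>i<l. frag_of (g i, qbasis i)) \<in> rels j" if "l \<ge> n" for l
  proof -
    have "frag_of (x, y) - (\<Sum>i<n. frag_of (x, eta_L (a i) * qbasis i)) \<in> rels j"
      unfolding ya using x a B by (intro rels_sum_right) (simp_all add: res_set_eta_L)
    moreover have "(\<Sum>i<n. frag_of (eta_R (a i) * x, qbasis i) -
        frag_of (x, eta_L (a i) * qbasis i)) \<in> rels j"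
      using res.rels_balanced[of _ x _ j] a x B by (intro res.rels_sum) simp
    ultimately have "frag_of (x, y) - (\<Sum>i<n. frag_of (g i, qbasis i)) \<in> rels j"
      by (force dest: res.rels_diff simp: sum_subtractf g_def)
    moreover have "(\<Sum>i\<in>{n..<l}. frag_of (g i, qbasis i)) \<in> rels j"
      using B by (intro res.rels_sum) (simp add: g_def rels_zero_left)
    moreover have "(\<Sum>i<l. frag_of (g i, qbasis i)) =
        (\<Sum>i<n. frag_of (g i, qbasis i)) + (\<Sum>i\<in>{n..<l}. frag_of (g i, qbasis i))"
      using that by (simp add: sum.lessThan_Suc lessThan_atLeast0 sum.atLeastLessThan_concat)
    ultimately show ?thesis
      using res.rels_diff by (fastforce simp: algebra_simps)
  qed
  then show ?case
    unfolding m using gA by blast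
qed

lemma common_denominator:
  fixes f :: "'m \<Rightarrow>\<^sub>0 rat"
  obtains N :: nat where "N > 0" "\<And>m. of_nat N * lookup f m \<in> \<int>"
proof -
  have "\<exists>N::nat. N > 0 \<and> (\<forall>m. of_nat N * lookup f m \<in> \<int>)"
  proof (induction f rule: poly_mapping_additive_induct)
    case zero
    show ?case by (intro exI[of _ 1]) simp
  next
    case (single m c)
    obtain a b :: int where ab: "c = of_int a / of_int b" "b > 0"
      by (metis Fract_of_int_quotient Rat_cases)
    then have "of_nat (nat b) * c = of_int a" by simp
    then have "of_nat (nat b) * c \<in> \<int>" by simp
    then show ?case
      using ab(2) by (intro exI[of _ "nat b"]) (auto simp: lookup_single when_def)
  next
    case (add f g)
    then obtain N M :: nat where NM: "N > 0" "\<And>m. of_nat N * lookup f m \<in> \<int>"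
        "M > 0" "\<And>m. of_nat M * lookup g m \<in> \<int>" by blast
    have "of_nat (N * M) * lookup (f + g) m =
        of_nat M * (of_nat N * lookup f m) + of_nat N * (of_nat M * lookup g m)" for m
      by (simp add: lookup_add algebra_simps)
    moreover have "of_nat M * (of_nat N * lookup f m) +
        of_nat N * (of_nat M * lookup g m) \<in> \<int>" for m
      by (rule Ints_add[OF Ints_mult[OF Ints_of_nat NM(2)] Ints_mult[OF Ints_of_nat NM(4)]])
    ultimately have "of_nat (N * M) * lookup (f + g) m \<in> \<int>" for m
      by simp
    with NM(1,3) show ?case
      by (intro exI[of _ "N * M"]) auto
  qed
  with that show thesis by blast
qed

lemma Ints_Zp: "x \<in> \<int> \<Longrightarrow> x \<in> Zp"
  by (auto elim: Ints_cases)

lemma constant_in_E1Q: "single 0 t \<in> res_set 2"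
  unfolding zero_prod_def by (auto simp: res_set_def E1Q_iff lookup_single when_def)

text \<open>Moving numerators across the tensor sign leaves only a common denominator on the right.\<close>

lemma tensor_normal_form_rational:
  assumes "keys c \<subseteq> A \<times> E1Q"
  shows "\<exists>g N. g \<in> A \<and> N > 0 \<and> c - frag_of (g, single 0 (1 / of_nat N)) \<in> rels 2"
  using assms
proof (induction c rule: frag_induction)
  case zero
  have "0 - frag_of (0, single 0 (1 / of_nat 1)) \<in> rels 2"
    by (intro res.rels_diff res.rels_0 rels_zero_left constant_in_E1Q)
  then show ?case by (metis E1E1_0 zero_less_one)
next
  case (diff c d)
  then obtain g N h M where
    g: "g \<in> A" "N > 0" "c - frag_of (g, single 0 (1 / of_nat N)) \<in> rels 2" and
    h: "h \<in> A" "M > 0" "d - frag_of (h, single 0 (1 / of_nat M)) \<in> rels 2"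
    by blast
  note in_S = constant_in_E1Q
  have change: "frag_of (eta_R (of_nat L) * f, single 0 (1 / of_nat (K * L))) -
      frag_of (f, single 0 (1 / of_nat K)) \<in> rels 2" if "f \<in> A" "L > 0" for f K L
  proof -
    have L: "of_nat L = single (0::int) (of_nat L :: rat)"
      by (simp add: single_of_nat)
    have "of_nat L \<in> carrier (E1 p)"
      unfolding L by (rule single_in_E1) simp
    moreover have "eta_L (of_nat L) * single 0 (1 / of_nat (K * L)) =
        single 0 (1 / of_nat K)"
      unfolding L eta_L_def using that(2)
      by (simp add: mult_single del: single_of_nat flip: zero_prod_def)
    ultimately show ?thesis
      using res.rels_balanced[of "of_nat L" f "single 0 (1 / of_nat (K * L))" 2] that(1) in_S
      by simp
  qed
  define g' where "g' = eta_R (of_nat M) * g"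
  define h' where "h' = eta_R (of_nat N) * h"
  define u where "u = (single 0 (1 / of_nat (N * M)) :: laurent2)"
  have A': "g' \<in> A" "h' \<in> A"
  proof -
    have "of_nat L \<in> carrier (E1 p)" for L
      using single_in_E1[OF Zp_of_nat, of 0 L] by (simp add: single_of_nat)
    then show "g' \<in> A" "h' \<in> A"
      using g h by (simp_all add: g'_def h'_def E1E1_eta_R)
  qed
  have gu: "frag_of (g', u) - frag_of (g, single 0 (1 / of_nat N)) \<in> rels 2"
    unfolding g'_def u_def by (rule change[OF g(1) h(2)])
  have hu: "frag_of (h', u) - frag_of (h, single 0 (1 / of_nat M)) \<in> rels 2"
    unfolding h'_def u_def mult.commute[of N M] by (rule change[OF h(1) g(2)])
  have ghu: "frag_of (g', u) - frag_of (h', u) - frag_of (g' - h', u) \<in> rels 2"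
    unfolding u_def by (intro rels_diff_left A' in_S)
  from res.rels_add[OF res.rels_diff[OF res.rels_diff[OF g(3) gu] res.rels_diff[OF h(3) hu]] ghu]
  have "c - d - frag_of (g' - h', u) \<in> rels 2"
    by (simp add: algebra_simps)
  then show ?case
    unfolding u_def using A' E1E1_diff g(2) h(2) by (metis nat_0_less_mult_iff)
next
  case (one m)
  obtain x y where m: "m = (x, y)" and x: "x \<in> A" and y: "y \<in> E1Q"
    using one by force
  obtain N :: nat where N: "N > 0" "\<And>m. of_nat N * lookup y m \<in> \<int>"
    using common_denominator by blast
  define a where "a = Poly_Mapping.map_key (\<lambda>i. (i, 0::int)) (single 0 (of_nat N) * y)"
  have lookup_a: "lookup a i = of_nat N * lookup y (i, 0)" for i
    by (simp add: a_def map_key.rep_eq inj_def del: single_of_nat)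
  have a: "a \<in> carrier (E1 p)"
    using N(2) by (auto simp: E1_def lookup_a intro: Ints_Zp)
  have u: "single 0 (1 / of_nat N) \<in> res_set 2"
    by (rule constant_in_E1Q)
  have "eta_L a * single 0 (1 / of_nat N) = y"
    using y N(1) by (intro poly_mapping2_eqI)
      (auto simp: mult.commute[of "eta_L a"] lookup_eta_L lookup_a E1Q_iff)
  then have "frag_of (eta_R a * x, single 0 (1 / of_nat N)) - frag_of (x, y) \<in> rels 2"
    using res.rels_balanced[of a x "single 0 (1 / of_nat N)" 2] a x u by simp
  from res.rels_uminus[OF this] show ?case
    unfolding m using E1E1_eta_R[OF a x] N(1) by force
qed

text \<open>Flatness of \<open>E(1)\<^sub>*E(1)\<close>: in the normal forms above the tensor value determines the left factors,
  because the basis is linearly independent over the Laurent polynomials in \<open>x\<close> and \<open>y\<close>, respectively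
  because \<open>1/N\<close> is not zero.\<close>

theorem tensor_value_injective:
  assumes c: "keys c \<subseteq> A \<times> res_set j" and v: "tensor_value c = 0"
  shows "c \<in> rels j"
proof -
  consider "j = 0 \<or> j = 1" | "j = 2" | "j \<notin> {0, 1, 2}" by auto
  then show ?thesis
  proof cases
    case 1
    then have "keys c \<subseteq> A \<times> A"
      using c by (simp add: res_set_0_1)
    from tensor_normal_form[OF 1 this] obtain g n where g: "\<And>i. g i \<in> A"
        and n: "c - (\<Sum>i<n. frag_of (g i, qbasis i)) \<in> rels j"
      by blast
    have "tensor_value c - (\<Sum>i<n. ex12 (g i) * ex23 (qbasis i)) = 0"
      using tensor_value_rels[OF n] by (simp add: tensor_value_diff tensor_value_sum)
    then have sum0: "(\<Sum>i<n. ex12 (g i) * ex23 (qbasis i)) = 0"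
      using v by simp
    have "g i = 0" if "i < n" for i
    proof (rule poly_mapping2_eqI)
      fix a b
      have "(\<Sum>i<n. single 0 (lookup (g i) (a, b)) * basis i) = 0"
      proof (rule poly_mapping_eqI)
        fix k
        have "(\<Sum>i<n. lookup (basis i) k * lookup (g i) (a, b - k + k)) = 0"
          using arg_cong[OF sum0, of "\<lambda>f. lookup f (a, b - k, k)"]
          by (simp only: lookup_sum lookup_ex12_mult_quotient_variable lookup_zero)
        then show "lookup (\<Sum>i<n. single 0 (lookup (g i) (a, b)) * basis i) k =
            lookup 0 k"
          by (simp add: lookup_sum mult.commute[of "lookup (g _) _"])
      qed
      from basis_independent[OF this that] show "lookup (g i) (a, b) = lookup 0 (a, b)"
        by simp
    qed
    then have "(\<Sum>i<n. frag_of (g i, qbasis i)) \<in> rels j"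
      using 1 by (intro res.rels_sum)
        (simp add: rels_zero_left res_set_0_1 E1E1_quotient_variable basis_integer_valued)
    from res.rels_add[OF n this] show ?thesis by simp
  next
    case 2
    then have "keys c \<subseteq> A \<times> E1Q"
      using c by (simp add: res_set_def)
    from tensor_normal_form_rational[OF this] obtain g and N :: nat where g: "g \<in> A" "N > 0"
        and n: "c - frag_of (g, single 0 (1 / of_nat N)) \<in> rels 2"
      by blast
    have "ex12 g * ex23 (single 0 (1 / of_nat N)) = 0"
      using tensor_value_rels[OF n] v by (simp add: tensor_value_diff)
    then have "single 0 (1 / of_nat N) * ex12 g = 0"
      by (simp add: mult.commute zero_prod_def split_beta)
    then have "1 / of_nat N * lookup (ex12 g) (a, b, 0) = 0" for a b
      by (metis lookup_single_zero_mult lookup_zero)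
    then have "g = 0"
      using g(2) by (intro poly_mapping2_eqI) (simp add: lookup_ex12)
    then have "frag_of (g, single 0 (1 / of_nat N)) \<in> rels 2"
      by (simp only: rels_zero_left constant_in_E1Q)
    from res.rels_add[OF n this] show ?thesis
      using 2 by simp
  next
    case 3
    then have "keys c \<subseteq> A \<times> {0}"
      using c by (simp add: res_set_def)
    then show ?thesis
    proof (induction c rule: frag_induction)
      case (one m)
      then show ?case using rels_zero_right by auto
    qed (auto intro: res.rels_diff)
  qed
qed

lemma cls_res_obj:
  assumes "keys c \<subseteq> A \<times> res_set j"
  shows "cls j c =
    {d. keys d \<subseteq> A \<times> res_set j \<and> tensor_value d = tensor_value c}"
proof -
  have "d - c \<in> rels j \<longleftrightarrow> tensor_value d = tensor_value c" if "keys d \<subseteq> A \<times> res_set j" for d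
  proof -
    have "keys (d - c) \<subseteq> A \<times> res_set j"
      using keys_diff[of d c] that assms by blast
    then show ?thesis
      using tensor_value_injective[of "d - c" j] tensor_value_rels[of "d - c" j]
      by (auto simp: tensor_value_diff)
  qed
  then show ?thesis
    using assms by (subst res.cls_eq) auto
qed

text \<open>The operator \<open>u\<^sup>a w\<^sup>b \<mapsto> \<phi>\<^sub>b u\<^sup>a w\<^sup>b\<^sup>+\<^sup>T\<close>.\<close>

definition multiplier :: "(int \<Rightarrow> rat) \<Rightarrow> int \<Rightarrow> laurent2 \<Rightarrow> laurent2"
  where "multiplier \<phi> T f = single (0, T) 1 * rescale (\<lambda>(a, b). \<phi> b) f"

lemma lookup_multiplier [simp]:
  "lookup (multiplier \<phi> T f) (a, b) = lookup f (a, b - T) * \<phi> (b - T)"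
  by (simp add: multiplier_def lookup_single_mult_pair)

text \<open>At \<open>x = y\<close> the result takes the value of the functional \<open>\<phi>\<close> on the substituted polynomial
  \<open>f(y x)\<close>, which is again integer-valued.\<close>

lemma multiplier_E1E1:
  assumes "\<phi> \<in> integral_functionals" "f \<in> A" shows "multiplier \<phi> T f \<in> A"
proof -
  have "rescale (\<lambda>(a, b). \<phi> b) f \<in> A"
    unfolding E1E1_iff integer_valued_def
  proof safe
    fix d y assume y: "y \<in> one_units"
    have "degree_part d (rescale (\<lambda>(a, b). \<phi> b) f) = rescale \<phi> (degree_part d f)"
      by (rule poly_mapping_eqI) simp
    then have "evaluate y (degree_part d (rescale (\<lambda>(a, b). \<phi> b) f)) =
        pairing (\<lambda>b. y powi b * \<phi> b) (degree_part d f)"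
      by (simp add: pairing_rescale mult.commute)
    also have "\<dots> \<in> Zp"
      using assms y by (auto intro!: integral_functionalsD integral_functionals_times_powi simp: E1E1_iff)
    finally show "evaluate y (degree_part d (rescale (\<lambda>(a, b). \<phi> b) f)) \<in> Zp" .
  qed
  then show ?thesis
    unfolding multiplier_def by (rule E1E1_single_mult[OF Zp_1])
qed

lemma multiplier_E1E1_iff: "(\<forall>f\<in>A. multiplier \<phi> T f \<in> A) \<longleftrightarrow> \<phi> \<in> integral_functionals"
proof
  assume R: "\<forall>f\<in>A. multiplier \<phi> T f \<in> A"
  show "\<phi> \<in> integral_functionals"
    unfolding integral_functionals_def
  proof safe
    fix f assume "f \<in> integer_valued"
    then have "multiplier \<phi> T (quotient_variable f) \<in> A"
      using R by (simp add: E1E1_quotient_variable)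
    then have "degree_part T (multiplier \<phi> T (quotient_variable f)) \<in> integer_valued"
      by (simp add: E1E1_iff)
    from integer_valuedD[OF this one_units_1]
    have "pairing (\<lambda>_. 1) (degree_part T (multiplier \<phi> T (quotient_variable f))) \<in> Zp"
      by simp
    moreover have "degree_part T (multiplier \<phi> T (quotient_variable f)) = single T 1 * rescale \<phi> f"
      by (rule poly_mapping_eqI) (simp add: lookup_quotient_variable lookup_single_mult)
    moreover have "evaluate 1 (single T 1 * rescale \<phi> f) = pairing \<phi> f"
      by (subst pairing_powi_shift) (simp_all add: pairing_rescale)
    ultimately show "pairing \<phi> f \<in> Zp" by simp
  qed
qed (use multiplier_E1E1 in blast)

text \<open>The Laurent polynomial \<open>f(x, z)\<close> expands along the basis in \<open>z/y\<close>. The coefficient of the \<open>i\<close>-th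
  basis element is the image of \<open>f\<close> under the multiplier of the \<open>i\<close>-th coordinate, which is integral.\<close>

lemma coproduct_exists:
  assumes "x \<in> A"
  shows "\<exists>c. keys c \<subseteq> A \<times> A \<and> tensor_value c = ex13 x"
proof -
  have "\<exists>N. \<forall>n\<ge>N. single b 1 =
      (\<Sum>i<n. single 0 (pairing (coordinate i) (single b 1)) * basis i)" for b
    using basis_expansion by metis
  then obtain N where N: "\<And>b n. n \<ge> N b \<Longrightarrow> single b 1 =
      (\<Sum>i<n. single 0 (pairing (coordinate i) (single b 1)) * basis i)"
    by metis
  define n where "n = (\<Sum>m\<in>keys x. N (snd m))"
  define c where "c = (\<Sum>i<n. frag_of (multiplier (coordinate i) 0 x, qbasis i))"
  have "c \<in> carrier (free_Abelian_group (A \<times> A))"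
    unfolding c_def using assms
    by (intro sum_closed_free_Abelian_group)
      (simp add: multiplier_E1E1 coordinate_integral E1E1_quotient_variable basis_integer_valued)
  moreover have "tensor_value c = ex13 x"
  proof (rule poly_mapping3_eqI)
    fix a b k
    have "lookup (tensor_value c) (a, b, k) =
        (\<Sum>i<n. lookup (basis i) k * (lookup x (a, b + k) * coordinate i (b + k)))"
      by (simp add: c_def tensor_value_sum lookup_sum lookup_ex12_mult_quotient_variable)
    also have "\<dots> = lookup x (a, b + k) * (\<Sum>i<n. coordinate i (b + k) * lookup (basis i) k)"
      by (simp add: sum_distrib_left mult_ac)
    also have "\<dots> = lookup x (a, b + k) * (1 when b = 0)"
    proof (cases "(a, b + k) \<in> keys x")
      case True
      then have "N (snd (a, b + k)) \<le> n"
        unfolding n_def by (intro member_le_sum) auto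
      then have "N (b + k) \<le> n" by simp
      from arg_cong[OF N[OF this], of "\<lambda>f. lookup f k"]
      have "(1 when b + k = k) = (\<Sum>i<n. coordinate i (b + k) * lookup (basis i) k)"
        by (simp add: lookup_sum lookup_single)
      then show ?thesis by simp
    qed (simp add: in_keys_iff)
    also have "\<dots> = lookup (ex13 x) (a, b, k)"
      by (simp add: lookup_ex13)
    finally show "lookup (tensor_value c) (a, b, k) = lookup (ex13 x) (a, b, k)" .
  qed
  ultimately show ?thesis by auto
qed

lemma tensor_product_left_E1_module:
  "tensor_product (E1 p) (right_E1E1 p) (left_E1_module (res_set j)) =
     T_mod j"
  "tensor_class (E1 p) (right_E1E1 p) (left_E1_module (res_set j)) =
     cls j"
proof -
  have "tensor_rels (E1 p) (right_E1E1 p) (left_E1_module (res_set j)) = rels j"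
    by (simp add: tensor_rels_def left_E1_module_def)
  then show "tensor_product (E1 p) (right_E1E1 p) (left_E1_module (res_set j)) =
      T_mod j"
    "tensor_class (E1 p) (right_E1E1 p) (left_E1_module (res_set j)) =
      cls j"
    by (simp_all add: tensor_product_def tensor_class_def fun_eq_iff left_E1_module_def)
qed

text \<open>All terms of the resolution have the same coaction in terms of tensor values. For
  \<open>E(1)\<^sub>*E(1)\<close> this shows that its coproduct is well defined: existence is the preceding expansion,
  and uniqueness is injectivity of tensor values.\<close>

theorem coact_res_obj_eq:
  assumes x: "x \<in> res_set j"
  shows "coact (res_obj p j) x = {c. keys c \<subseteq> A \<times> res_set j \<and> tensor_value c = ex13 x}"
    and "coact (res_obj p j) x \<noteq> {}"
proof -
  have "\<exists>c. keys c \<subseteq> A \<times> res_set j \<and> tensor_value c = ex13 x \<and>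
    coact (res_obj p j) x = cls j c"
  proof (cases "j = 0 \<or> j = 1")
    case True
    then have S: "res_set j = A" by (rule res_set_0_1)
    obtain c where c: "keys c \<subseteq> A \<times> res_set j" "tensor_value c = ex13 x"
      using coproduct_exists x S by metis
    have "coproduct p x = cls j c"
      unfolding coproduct_def
    proof (rule the_equality)
      have "cls j c \<in>
          carrier (T_mod j)"
        using c(1) by (simp add: res.carrier_tensor_product)
      then show "cls j c \<in>
          carrier (tensor_product (E1 p) (right_E1E1 p) (left_E1_module A)) \<and>
          (\<forall>d\<in>cls j c. tensor_value d = ex13 x)"
        using c cls_res_obj[OF c(1)] tensor_product_left_E1_module(1)[of j] S by auto
    next
      fix X assume X: "X \<in> carrier (tensor_product (E1 p) (right_E1E1 p) (left_E1_module A)) \<and>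
          (\<forall>c\<in>X. tensor_value c = ex13 x)"
      then have "X \<in> carrier (T_mod j)"
        using tensor_product_left_E1_module(1)[of j] S by simp
      then obtain d where d: "X = cls j d"
          "keys d \<subseteq> A \<times> res_set j"
        by (auto simp: res.carrier_tensor_product)
      then have "d \<in> X"
        by (simp add: cls_res_obj)
      with X have "tensor_value d = ex13 x" by blast
      then show "X = cls j c"
        using d c by (simp add: cls_res_obj)
    qed
    then show ?thesis
      using True c by (auto simp: coact_res_obj)
  next
    case False
    define c where "c = (\<Sum>(a, b)\<in>keys x.
         frag_of (single (a, 0) 1 :: laurent2,
                  single (0, 0) (lookup x (a, b)) :: laurent2))"
    have xE: "x \<in> E1Q"
      using x False by (auto simp: res_set_def E1Q_iff split: if_splits)
    have "coact (res_obj p j) x = coact_Q p (res_set j) x"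
      using False by (simp add: coact_res_obj res_set_def)
    also have "\<dots> = cls j c"
      by (simp add: coact_Q_def c_def tensor_product_left_E1_module)
    finally have "coact (res_obj p j) x = cls j c" .
    moreover have "c \<in> carrier (free_Abelian_group (A \<times> res_set j))"
      unfolding c_def
    proof (rule sum_closed_free_Abelian_group)
      fix m assume "m \<in> keys x"
      then have "single (0, 0) t \<in> res_set j" for t
        using x False by (auto simp: res_set_def E1Q_iff lookup_single when_def split: if_splits)
      then show "(case m of (a, b) \<Rightarrow> frag_of (single (a, 0) 1,
          single (0, 0) (lookup x (a, b)))) \<in> carrier (free_Abelian_group (A \<times> res_set j))"
        by (cases m) (simp add: E1E1_single)
    qed
    moreover have "tensor_value c = ex13 x"
    proof -
      have "tensor_value c = (\<Sum>(a, b)\<in>keys x. single (a, 0, 0) (lookup x (a, b)))"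
        by (auto simp: c_def tensor_value_sum mult_single intro!: sum.cong)
      also have "\<dots> = (\<Sum>m\<in>keys x. single (case m of (a, b) \<Rightarrow> (a, 0, b)) (lookup x m))"
        using xE by (auto simp: E1Q_def intro!: sum.cong)
      finally show ?thesis
        by (simp add: change_exponents_def)
    qed
    ultimately show ?thesis by auto
  qed
  then obtain c where c: "keys c \<subseteq> A \<times> res_set j" "tensor_value c = ex13 x"
      "coact (res_obj p j) x = cls j c"
    by blast
  then show *: "coact (res_obj p j) x = {c. keys c \<subseteq> A \<times> res_set j \<and> tensor_value c = ex13 x}"
    by (simp add: cls_res_obj)
  show "coact (res_obj p j) x \<noteq> {}"
    unfolding * using c by blast
qed

section \<open>Comodule maps are multipliers\<close>

lemma multiplier_0 [simp]: "multiplier \<phi> T 0 = 0"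
  by (rule poly_mapping2_eqI) simp

lemma multiplier_add: "multiplier \<phi> T (f + g) = multiplier \<phi> T f + multiplier \<phi> T g"
  by (rule poly_mapping2_eqI) (simp add: lookup_add distrib_right)

lemma multiplier_single: "multiplier \<phi> T (single (a, b) c) = single (a, b + T) (c * \<phi> b)"
  by (rule poly_mapping2_eqI) (auto simp: lookup_single when_def)

lemma multiplier_eta_L: "multiplier \<phi> T (eta_L a * f) = eta_L a * multiplier \<phi> T f"
proof (induction a rule: poly_mapping_additive_induct)
  case (single m c)
  show ?case
    by (rule poly_mapping2_eqI) (simp add: eta_L_def lookup_single_mult_pair)
qed (simp_all add: eta_L_def change_exponents_add distrib_right multiplier_add)

lemma multiplier_multiplier:
  "multiplier \<psi> U (multiplier \<phi> T f) = multiplier (\<lambda>b. \<phi> b * \<psi> (b + T)) (T + U) f"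
  by (rule poly_mapping2_eqI) (simp add: diff_diff_eq add.commute mult.assoc)

definition multiplier3 :: "(int \<Rightarrow> rat) \<Rightarrow> int \<Rightarrow> laurent3 \<Rightarrow> laurent3"
  where "multiplier3 \<phi> T f = single (0, 0, T) 1 * rescale (\<lambda>(a, b, c). \<phi> c) f"

lemma lookup_multiplier3 [simp]:
  "lookup (multiplier3 \<phi> T f) (a, b, c) = lookup f (a, b, c - T) * \<phi> (c - T)"
  by (simp add: multiplier3_def lookup_single_mult)

lemma multiplier3_0 [simp]: "multiplier3 \<phi> T 0 = 0"
  by (rule poly_mapping3_eqI) simp

lemma multiplier3_add: "multiplier3 \<phi> T (f + g) = multiplier3 \<phi> T f + multiplier3 \<phi> T g"
  by (rule poly_mapping3_eqI) (simp add: lookup_add distrib_right)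

lemma multiplier3_diff: "multiplier3 \<phi> T (f - g) = multiplier3 \<phi> T f - multiplier3 \<phi> T g"
  by (rule poly_mapping3_eqI) (simp add: lookup_minus left_diff_distrib)

lemma ex13_multiplier: "ex13 (multiplier \<phi> T f) = multiplier3 \<phi> T (ex13 f)"
  by (rule poly_mapping3_eqI) (simp add: lookup_ex13)

lemma ex23_multiplier: "ex12 g * ex23 (multiplier \<phi> T h) = multiplier3 \<phi> T (ex12 g * ex23 h)"
proof (induction h rule: poly_mapping_additive_induct)
  case (single m t)
  obtain m1 m2 where m: "m = (m1, m2)" by force
  have shift: "lookup (ex12 g * single (0, m1, k) u) (a, b, c) =
      u * lookup (ex12 g) (a, b - m1, c - k)" for k u a b c
    using lookup_single_mult[of "(0, m1, k)" u "ex12 g" "(a, b, c)"]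
    by (simp add: mult.commute)
  show ?case
    unfolding m by (rule poly_mapping3_eqI) (auto simp: multiplier_single shift lookup_ex12)
qed (simp_all add: multiplier_add change_exponents_add distrib_left multiplier3_add)

lemma tensor_value_multiplier:
  "tensor_value (frag_extend (\<lambda>(g, y). frag_of (g, multiplier \<phi> T y)) c) = multiplier3 \<phi> T (tensor_value c)"
proof -
  have "keys c \<subseteq> UNIV" by simp
  then show ?thesis
  proof (induction c rule: frag_induction)
    case (one m)
    then show ?case by (cases m) (simp add: ex23_multiplier)
  qed (simp_all add: frag_extend_diff tensor_value_diff multiplier3_diff)
qed

definition multiplier_on :: "int \<Rightarrow> (int \<Rightarrow> rat) \<Rightarrow> int \<Rightarrow> laurent2 \<Rightarrow> laurent2"
  where "multiplier_on i \<phi> T x = (if x \<in> res_set i then multiplier \<phi> T x else 0)"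

text \<open>The map in the comodule condition is \<open>id \<otimes> f\<close>: two homomorphisms that agree on the generators of
  a free abelian group are equal.\<close>

lemma tensor_lift_linear:
  assumes closed: "\<And>x. x \<in> res_set i \<Longrightarrow> f x \<in> res_set j"
    and add: "\<And>x y. x \<in> res_set i \<Longrightarrow> y \<in> res_set i \<Longrightarrow> f (x + y) = f x + f y"
    and smult: "\<And>a x. a \<in> carrier (E1 p) \<Longrightarrow> x \<in> res_set i \<Longrightarrow> f (eta_L a * x) = eta_L a * f x"
    and c: "keys c \<subseteq> A \<times> res_set i"
  shows "tensor_lift (T_mod j) (\<lambda>(g, y). cls j (frag_of (g, f y))) (cls i c) =
    cls j (frag_extend (\<lambda>(g, y). frag_of (g, f y)) c)"
proof -
  define \<mu> where "\<mu> = (\<lambda>(g, y). cls j (frag_of (g, f y)))"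
  have plus: "cls j c = cls j d \<otimes>\<^bsub>T_mod j\<^esub> cls j e"
    if "keys c \<subseteq> A \<times> res_set j" "keys d \<subseteq> A \<times> res_set j"
      "keys e \<subseteq> A \<times> res_set j" "c - d - e \<in> rels j" for c d e
  proof -
    have "cls j d \<otimes>\<^bsub>T_mod j\<^esub> cls j e = cls j (d + e)"
      using hom_mult[OF res.cls_hom, of d j e] that by simp
    moreover have "keys (d + e) \<subseteq> A \<times> res_set j"
      using keys_add[of d e] that by blast
    ultimately show ?thesis
      using res.cls_eq_iff[of c j "d + e"] that by (simp add: diff_diff_eq)
  qed
  have comm: "comm_group (T_mod j)"
    by (rule res.T.comm_group_axioms)
  have closed': "\<mu> (x, y) \<in> carrier (T_mod j)" if "x \<in> A" "y \<in> res_set i" for x y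
    using that closed by (auto simp: \<mu>_def res.carrier_tensor_product)
  have left: "\<mu> (x + x', y) = \<mu> (x, y) \<otimes>\<^bsub>T_mod j\<^esub> \<mu> (x', y)"
    if "x \<in> A" "x' \<in> A" "y \<in> res_set i" for x x' y
    unfolding \<mu>_def prod.case using that closed res.rels_add_left[of x x' "f y" j]
    by (intro plus) (simp_all add: E1E1_add)
  have right: "\<mu> (x, y + y') = \<mu> (x, y) \<otimes>\<^bsub>T_mod j\<^esub> \<mu> (x, y')"
    if "x \<in> A" "y \<in> res_set i" "y' \<in> res_set i" for x y y'
    unfolding \<mu>_def prod.case using that closed res.rels_add_right[of x "f y" j "f y'"]
    by (intro plus) (simp_all add: add res_set_add)
  have balanced: "\<mu> (eta_R a * x, y) = \<mu> (x, eta_L a * y)"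
    if "a \<in> carrier (E1 p)" "x \<in> A" "y \<in> res_set i" for a x y
    using that closed res.rels_balanced[of a x "f y" j]
    by (simp add: \<mu>_def smult res.cls_eq_iff E1E1_eta_R res_set_eta_L)
  have lift_hom: "tensor_lift (T_mod j) \<mu> \<in> hom (T_mod i) (T_mod j)"
    by (rule res.tensor_lift_universal(1)[OF comm]) (simp_all add: closed' left right balanced)
  have lift_frag: "tensor_lift (T_mod j) \<mu> (cls i (frag_of (x, y))) = \<mu> (x, y)"
    if "x \<in> A" "y \<in> res_set i" for x y
    by (rule res.tensor_lift_universal(2)[OF comm]) (simp_all add: closed' left right balanced that)
  have h: "(\<lambda>c. tensor_lift (T_mod j) \<mu> (cls i c)) \<in> hom (free_Abelian_group (A \<times> res_set i)) (T_mod j)"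
    using hom_compose[OF res.cls_hom[of i] lift_hom] by (simp add: comp_def)
  have push: "keys (frag_extend (\<lambda>(g, y). frag_of (g, f y)) d) \<subseteq> A \<times> res_set j"
    if "keys d \<subseteq> A \<times> res_set i" for d
    using that closed keys_frag_extend[of "\<lambda>(g, y). frag_of (g, f y)" d]
    by (force simp: keys_frag_of)
  have k: "(\<lambda>c. cls j (frag_extend (\<lambda>(g, y). frag_of (g, f y)) c)) \<in>
      hom (free_Abelian_group (A \<times> res_set i)) (T_mod j)"
  proof (rule homI)
    fix d assume "d \<in> carrier (free_Abelian_group (A \<times> res_set i))"
    then show "cls j (frag_extend (\<lambda>(g, y). frag_of (g, f y)) d) \<in> carrier (T_mod j)"
      using push by (auto simp: res.carrier_tensor_product)
  next
    fix d e assume "d \<in> carrier (free_Abelian_group (A \<times> res_set i))"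
      "e \<in> carrier (free_Abelian_group (A \<times> res_set i))"
    then show "cls j (frag_extend (\<lambda>(g, y). frag_of (g, f y)) (d \<otimes>\<^bsub>free_Abelian_group (A \<times> res_set i)\<^esub> e)) =
        cls j (frag_extend (\<lambda>(g, y). frag_of (g, f y)) d) \<otimes>\<^bsub>T_mod j\<^esub>
        cls j (frag_extend (\<lambda>(g, y). frag_of (g, f y)) e)"
      using hom_mult[OF res.cls_hom[of j], of "frag_extend (\<lambda>(g, y). frag_of (g, f y)) d"
          "frag_extend (\<lambda>(g, y). frag_of (g, f y)) e"] push
      by (simp add: frag_extend_add)
  qed
  have "tensor_lift (T_mod j) \<mu> (cls i c) = cls j (frag_extend (\<lambda>(g, y). frag_of (g, f y)) c)"
  proof (rule free_Abelian_group_hom_eqI[OF comm h k _ c])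
    fix m assume "m \<in> A \<times> res_set i"
    then obtain x y where m: "m = (x, y)" and xy: "x \<in> A" "y \<in> res_set i"
      by auto
    show "tensor_lift (T_mod j) \<mu> (cls i (frag_of m)) =
        cls j (frag_extend (\<lambda>(g, y). frag_of (g, f y)) (frag_of m))"
      unfolding m lift_frag[OF xy] by (simp add: \<mu>_def)
  qed
  then show ?thesis
    by (simp add: \<mu>_def)
qed

lemma coact_eq_cls:
  "x \<in> res_set j \<Longrightarrow> keys c \<subseteq> A \<times> res_set j \<Longrightarrow> tensor_value c = ex13 x \<Longrightarrow>
    coact (res_obj p j) x = cls j c"
  by (simp add: coact_res_obj_eq cls_res_obj)

abbreviation q :: int where "q \<equiv> 2 * int p - 2"

lemma multiplier_on_comodule_hom:
  assumes maps: "\<And>x. x \<in> res_set i \<Longrightarrow> multiplier \<phi> T x \<in> res_set j" and t: "t = q * T \<or> (\<forall>b. \<phi> b = 0)"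
  shows "multiplier_on i \<phi> T \<in> Hom t i j"
  unfolding comodule_hom_def
proof (intro CollectI conjI ballI allI impI)
  fix m x assume x: "x \<in> hcomp (res_obj p i) m"
  then have "q * (a + b) = m + t" if "(a, b) \<in> keys (multiplier \<phi> T x)" for a b
  proof -
    have "(a, b - T) \<in> keys x" "t = q * T"
      using that t by (auto simp: in_keys_iff)
    then have "q * (a + (b - T)) = m"
      using x by (auto simp: internal_comp_def)
    then show ?thesis
      using \<open>t = q * T\<close> by (simp add: right_diff_distrib distrib_left)
  qed
  then show "multiplier_on i \<phi> T x \<in> hcomp (res_obj p j) (m + t)"
    using x maps by (auto simp: internal_comp_def multiplier_on_def)
next
  fix x assume "x \<in> carrier (res_obj p i)"
  then have x: "x \<in> res_set i" by simp
  obtain c where c: "keys c \<subseteq> A \<times> res_set i" "tensor_value c = ex13 x"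
    using coact_res_obj_eq[OF x] by auto
  let ?f = "multiplier_on i \<phi> T"
  have eq: "frag_extend (\<lambda>(g, y). frag_of (g, ?f y)) c = frag_extend (\<lambda>(g, y). frag_of (g, multiplier \<phi> T y)) c"
    using c(1) by (intro frag_extend_eq) (auto simp: multiplier_on_def)
  have keys: "keys (frag_extend (\<lambda>(g, y). frag_of (g, multiplier \<phi> T y)) c) \<subseteq> A \<times> res_set j"
    using c(1) maps keys_frag_extend[of "\<lambda>(g, y). frag_of (g, multiplier \<phi> T y)" c]
    by (force simp: keys_frag_of)
  have "tensor_lift (T_mod j) (\<lambda>(g, y). cls j (frag_of (g, ?f y))) (coact (res_obj p i) x) =
      cls j (frag_extend (\<lambda>(g, y). frag_of (g, ?f y)) c)"
    unfolding coact_eq_cls[OF x c]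
    by (rule tensor_lift_linear)
      (use c(1) maps in \<open>auto simp: multiplier_on_def multiplier_add multiplier_eta_L res_set_add res_set_eta_L\<close>)
  also have "\<dots> = coact (res_obj p j) (?f x)"
    unfolding eq using x maps c(2) keys
    by (intro coact_eq_cls[symmetric]) (simp_all add: multiplier_on_def tensor_value_multiplier ex13_multiplier)
  finally show "coact (res_obj p j) (?f x) =
      tensor_lift (T_mod j) (\<lambda>(g, y). cls j (frag_of (g, ?f y))) (coact (res_obj p i) x)" ..
qed (use maps in \<open>auto simp: multiplier_on_def multiplier_add multiplier_eta_L res_set_add res_set_eta_L\<close>)

lemma power_of_w_in_res_set:
  assumes "x \<in> res_set i" "(a, b) \<in> keys x" shows "single (0, b) 1 \<in> res_set i"
  using assms
  by (auto simp: res_set_def E1E1_single E1Q_def lookup_single in_keys_iff split: if_splits)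

text \<open>The powers of \<open>w\<close> are primitive, so their images are primitive too, which leaves only powers of
  \<open>w\<close>, and the degree determines which one. Every element is a combination of the
  \<open>u\<^sup>a w\<^sup>b\<close> with coefficients in \<open>\<int>\<^sub>(\<^sub>p\<^sub>)\<close> after multiplication by an integer, and the targets are
  torsion-free.\<close>

theorem comodule_hom_multiplier:
  assumes f: "f \<in> Hom t i j"
  obtains \<phi> where "f = multiplier_on i \<phi> (t div q)"
    "\<And>x. x \<in> res_set i \<Longrightarrow> multiplier \<phi> (t div q) x \<in> res_set j"
    "\<not> q dvd t \<Longrightarrow> f = (\<lambda>_. 0)"
proof -
  have closed: "\<And>x. x \<in> res_set i \<Longrightarrow> f x \<in> res_set j"
    and outside: "\<And>x. x \<notin> res_set i \<Longrightarrow> f x = 0"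
    and add: "\<And>x y. x \<in> res_set i \<Longrightarrow> y \<in> res_set i \<Longrightarrow> f (x + y) = f x + f y"
    and smult: "\<And>a x. a \<in> carrier (E1 p) \<Longrightarrow> x \<in> res_set i \<Longrightarrow> f (eta_L a * x) = eta_L a * f x"
    and degree: "\<And>m x. x \<in> internal_comp p (res_set i) m \<Longrightarrow> f x \<in> internal_comp p (res_set j) (m + t)"
    and coact: "\<And>x. x \<in> res_set i \<Longrightarrow> coact (res_obj p j) (f x) =
      tensor_lift (T_mod j) (\<lambda>(g, y). cls j (frag_of (g, f y))) (coact (res_obj p i) x)"
    using f unfolding comodule_hom_def by auto
  define T where "T = t div q"
  define w :: "int \<Rightarrow> laurent2" where "w b = single (0, b) 1" for b
  define \<phi> where "\<phi> b = (if q dvd t \<and> w b \<in> res_set i then lookup (f (w b)) (0, b + T) else 0)" for b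
  have q: "q \<noteq> 0" using p_gt_2 by simp
  have fw: "f (w b) = single (0, b + T) (\<phi> b)" if w: "w b \<in> res_set i" for b
  proof (rule poly_mapping2_eqI)
    fix a c
    have one: "single (0, 0) 1 \<in> A" by (simp add: E1E1_single)
    have frag: "keys (frag_of (single (0, 0) 1, w b)) \<subseteq> A \<times> res_set i"
      using w one by simp
    have "coact (res_obj p i) (w b) = cls i (frag_of (single (0, 0) 1, w b))"
      using frag by (intro coact_eq_cls w) (simp_all add: w_def mult_single)
    then have "coact (res_obj p j) (f (w b)) = cls j (frag_of (single (0, 0) 1, f (w b)))"
      using coact[OF w] tensor_lift_linear[OF closed add smult frag] by simp
    moreover have keys: "keys (frag_of (single (0, 0) 1, f (w b))) \<subseteq> A \<times> res_set j"
      using closed[OF w] one by simp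
    then have "frag_of (single (0, 0) 1, f (w b)) \<in> cls j (frag_of (single (0, 0) 1, f (w b)))"
      by (simp add: cls_res_obj)
    ultimately have "frag_of (single (0, 0) 1, f (w b)) \<in> coact (res_obj p j) (f (w b))"
      by simp
    then have "tensor_value (frag_of (single (0, 0) 1, f (w b))) = ex13 (f (w b))"
      unfolding coact_res_obj_eq(1)[OF closed[OF w]] by blast
    moreover have "ex12 (single (0, 0) 1) = 1"
      unfolding single_one[symmetric] zero_prod_def by simp
    ultimately have "ex23 (f (w b)) = ex13 (f (w b))"
      unfolding tensor_value_frag_of by simp
    from arg_cong[OF this, of "\<lambda>f. lookup f (a, 0, c)"]
    have a: "lookup (f (w b)) (a, c) = 0" if "a \<noteq> 0"
      using that by (simp add: lookup_ex13 lookup_ex23)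
    have "w b \<in> internal_comp p (res_set i) (q * b)"
      using w by (auto simp: internal_comp_def w_def)
    from degree[OF this] have deg: "q * (a + c) = q * b + t" if "lookup (f (w b)) (a, c) \<noteq> 0"
      using that by (auto simp: internal_comp_def in_keys_iff)
    show "lookup (f (w b)) (a, c) = lookup (single (0, b + T) (\<phi> b)) (a, c)"
    proof (cases "lookup (f (w b)) (a, c) = 0")
      case True
      then show ?thesis
        by (auto simp: lookup_single when_def \<phi>_def)
    next
      case False
      then have "a = 0" using a by blast
      then have "t = q * (c - b)"
        using deg[OF False] by (simp add: right_diff_distrib)
      then have "T = c - b" "q dvd t"
        using q by (auto simp: T_def)
      then show ?thesis
        using \<open>a = 0\<close> w by (simp add: \<phi>_def)
    qed
  qed
  have f0: "f 0 = 0"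
    using add[of 0 0] by simp
  have f_sum: "f (sum x I) = (\<Sum>l\<in>I. f (x l))" if "\<And>l. l \<in> I \<Longrightarrow> x l \<in> res_set i" "finite I"
    for x :: "int \<times> int \<Rightarrow> laurent2" and I
    using that(2,1) by (induction I rule: finite_induct) (simp_all add: f0 add res_set_sum)
  have f_x: "f x = multiplier \<phi> T x" if x: "x \<in> res_set i" for x
  proof -
    obtain N :: nat where N: "N > 0" "\<And>m. of_nat N * lookup x m \<in> \<int>"
      using common_denominator by blast
    define c where "c m = of_nat N * lookup x m" for m
    have c: "c m \<in> Zp" for m
      using N(2) by (simp add: c_def Ints_Zp)
    define n where "n = single (0::int) (of_nat N :: rat)"
    have n: "n \<in> carrier (E1 p)"
      unfolding n_def by (rule single_in_E1) simp
    have eta_n: "lookup (eta_L n * y) m = of_nat N * lookup y m" for y m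
      unfolding n_def eta_L_def
      by (simp add: zero_prod_def[symmetric] del: single_of_nat)
    have mono: "single (a, b) (c (a, b)) = eta_L (single a (c (a, b))) * w b" for a b
      by (simp add: eta_L_def w_def mult_single)
    have w: "w b \<in> res_set i" if "(a, b) \<in> keys x" for a b
      unfolding w_def by (rule power_of_w_in_res_set[OF x that])
    have monomial: "single m (c m) \<in> res_set i" if "m \<in> keys x" for m
      using that w c by (cases m) (simp add: mono res_set_eta_L single_in_E1)
    have f_term: "f (single m (c m)) = multiplier \<phi> T (single m (c m))"
      if "m \<in> keys x" for m
    proof -
      obtain a b where m: "m = (a, b)" by force
      have "f (single m (c m)) = eta_L (single a (c m)) * f (w b)"
        using that w c unfolding m mono by (intro smult single_in_E1) auto
      also have "\<dots> = eta_L (single a (c m)) * multiplier \<phi> T (w b)"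
        using that w m by (subst fw) (auto simp: multiplier_single w_def)
      finally show ?thesis
        unfolding m mono multiplier_eta_L .
    qed
    have nx: "eta_L n * x = (\<Sum>m\<in>keys x. single m (c m))"
      by (rule poly_mapping_eqI)
        (auto simp: eta_n lookup_sum lookup_single when_def c_def in_keys_iff)
    have mult_sum: "multiplier \<phi> T (sum y I) = (\<Sum>l\<in>I. multiplier \<phi> T (y l))" for y :: "int \<times> int \<Rightarrow> laurent2" and I
      by (induction I rule: infinite_finite_induct) (simp_all add: multiplier_add)
    have "eta_L n * f x = f (eta_L n * x)"
      using smult[OF n x] by simp
    also have "\<dots> = multiplier \<phi> T (eta_L n * x)"
      unfolding nx using monomial by (simp add: f_sum mult_sum f_term)
    finally have "eta_L n * f x = eta_L n * multiplier \<phi> T x"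
      by (simp add: multiplier_eta_L)
    then show ?thesis
      using N(1) by (intro poly_mapping_eqI) (metis eta_n mult_left_cancel of_nat_0_less_iff less_irrefl)
  qed
  show thesis
  proof
    show "f = multiplier_on i \<phi> (t div q)"
      using f_x outside by (auto simp: multiplier_on_def T_def fun_eq_iff)
    show "multiplier \<phi> (t div q) x \<in> res_set j" if "x \<in> res_set i" for x
      using f_x closed that by (metis T_def)
    show "f = (\<lambda>_. 0)" if "\<not> q dvd t"
    proof
      fix x
      have "multiplier \<phi> T x = 0"
        using that by (intro poly_mapping2_eqI) (simp add: \<phi>_def)
      then show "f x = 0"
        using f_x outside by (cases "x \<in> res_set i") auto
    qed
  qed
qed

section \<open>The endomorphism dga in coordinates\<close>

lemma q_pos: "q \<ge> 4"
  using p_gt_2 by simp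

lemma multiplier_on_0 [simp]: "multiplier_on i \<phi> T 0 = 0"
  by (simp add: multiplier_on_def)

lemma res_d_0: "res_d p r 0 = multiplier_on 0 (\<lambda>b. rho powi b - 1) 0"
proof
  fix x
  have "adams_op p r x - x = multiplier (\<lambda>b. rho powi b - 1) 0 x"
  proof (rule poly_mapping2_eqI)
    fix a b
    have "adams_op p r x = (\<Sum>m\<in>keys x. single m (lookup x m * rho powi (snd m)))"
      by (auto simp: adams_op_def rho_def intro!: sum.cong)
    also have "\<dots> = rescale (\<lambda>m. rho powi (snd m)) x"
      by (simp add: rescale_def)
    finally show "lookup (adams_op p r x - x) (a, b) =
        lookup (multiplier (\<lambda>b. rho powi b - 1) 0 x) (a, b)"
      by (simp add: lookup_minus right_diff_distrib)
  qed
  then show "res_d p r 0 x = multiplier_on 0 (\<lambda>b. rho powi b - 1) 0 x"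
    by (simp add: res_d_def multiplier_on_def)
qed

lemma lookup_rational_map:
  "lookup (rational_map x) (a, b) = (if b = 0 then lookup x (a, b) else 0)"
proof -
  have "rational_map x = (\<Sum>m\<in>{m \<in> keys x. snd m = 0}. single m (lookup x m))"
    by (auto simp: rational_map_def intro!: sum.cong)
  then show ?thesis
    by (auto simp: lookup_sum lookup_single when_def sum.delta in_keys_iff)
qed

lemma res_d_1: "res_d p r 1 = multiplier_on 1 (\<lambda>b. if b = 0 then 1 else 0) 0"
proof
  fix x
  have "rational_map x = multiplier (\<lambda>b. if b = 0 then 1 else 0) 0 x"
    by (rule poly_mapping2_eqI) (simp add: lookup_rational_map)
  then show "res_d p r 1 x = multiplier_on 1 (\<lambda>b. if b = 0 then 1 else 0) 0 x"
    by (simp add: res_d_def multiplier_on_def)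
qed

lemma res_d_other: "j \<noteq> 0 \<Longrightarrow> j \<noteq> 1 \<Longrightarrow> res_d p r j = (\<lambda>_. 0)"
  by (auto simp: res_d_def)

lemma res_d_zero [simp]: "res_d p r j 0 = 0"
  by (cases "j = 0"; cases "j = 1") (simp_all add: res_d_0 res_d_1 res_d_other)

lemma multiplier_on_multiplier_on:
  assumes "\<And>x. x \<in> res_set i \<Longrightarrow> multiplier \<phi> T x \<in> res_set j"
  shows "multiplier_on j \<psi> U (multiplier_on i \<phi> T x) = multiplier_on i (\<lambda>b. \<phi> b * \<psi> (b + T)) (T + U) x"
  using assms by (auto simp: multiplier_on_def multiplier_multiplier)

lemma multiplier_on_E1E1_inject:
  assumes "multiplier_on i \<phi> T = multiplier_on i \<psi> T" "i = 0 \<or> i = 1" shows "\<phi> = \<psi>"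
proof
  fix b
  have "lookup (multiplier_on i \<phi> T (single (0, b) 1)) (0, b + T) =
      lookup (multiplier_on i \<psi> T (single (0, b) 1)) (0, b + T)"
    using assms(1) by simp
  then show "\<phi> b = \<psi> b"
    using assms(2) by (simp add: multiplier_on_def res_set_0_1 E1E1_single)
qed

lemma multiplier_E1E1_E1Q_iff:
  "(\<forall>x\<in>A. multiplier \<phi> T x \<in> E1Q) \<longleftrightarrow> (\<forall>b. b \<noteq> - T \<longrightarrow> \<phi> b = 0)"
proof
  assume R: "\<forall>x\<in>A. multiplier \<phi> T x \<in> E1Q"
  show "\<forall>b. b \<noteq> - T \<longrightarrow> \<phi> b = 0"
  proof (intro allI impI)
    fix b assume "b \<noteq> - T"
    have "multiplier \<phi> T (single (0, b) 1) \<in> E1Q"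
      using R by (simp add: E1E1_single)
    then have "lookup (multiplier \<phi> T (single (0, b) 1)) (0, b + T) = 0"
      using \<open>b \<noteq> - T\<close> unfolding E1Q_iff by (metis add.commute add_eq_0_iff)
    then show "\<phi> b = 0" by simp
  qed
qed (auto simp: E1Q_iff)

text \<open>The image of \<open>c \<in> \<rat>\<close> is \<open>\<phi>\<^sub>0 c w\<^sup>T\<close>. This is divisible, which is impossible in
  \<open>E(1)\<^sub>*E(1)\<close>, and it lies in \<open>\<rat>[u\<^sup>\<plusminus>]\<close> only for \<open>T = 0\<close>.\<close>

lemma multiplier_on_E1Q:
  assumes maps: "\<And>x. x \<in> res_set 2 \<Longrightarrow> multiplier \<phi> T x \<in> res_set j" and nz: "multiplier_on 2 \<phi> T \<noteq> (\<lambda>_. 0)"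
  shows "j = 2 \<and> T = 0"
proof -
  have const: "single (0, T) (c * \<phi> 0) \<in> res_set j" for c
    using maps[OF constant_in_E1Q, of c] by (simp add: zero_prod_def multiplier_single)
  have "\<phi> 0 \<noteq> 0"
  proof
    assume "\<phi> 0 = 0"
    have "multiplier \<phi> T x = 0" if "x \<in> res_set 2" for x
    proof (rule poly_mapping2_eqI)
      fix a b
      show "lookup (multiplier \<phi> T x) (a, b) = lookup 0 (a, b)"
        using that \<open>\<phi> 0 = 0\<close> by (cases "b - T = 0") (simp_all add: res_set_def E1Q_iff)
    qed
    then have "multiplier_on 2 \<phi> T = (\<lambda>_. 0)"
      by (auto simp: multiplier_on_def fun_eq_iff)
    with nz show False ..
  qed
  have "j \<noteq> 0 \<and> j \<noteq> 1"
  proof (rule ccontr)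
    assume "\<not> (j \<noteq> 0 \<and> j \<noteq> 1)"
    then have "single (0, T) (1 / (of_nat p * \<phi> 0) * \<phi> 0) \<in> A"
      using const[of "1 / (of_nat p * \<phi> 0)"] by (metis res_set_0_1)
    then have "single (0, T) (1 / of_nat p) \<in> A"
      using \<open>\<phi> 0 \<noteq> 0\<close> by simp
    then have "degree_part T (single (0, T) (1 / of_nat p)) \<in> integer_valued"
      by (simp add: E1E1_iff)
    moreover have "degree_part T (single (0, T) (1 / of_nat p)) = single T (1 / of_nat p)"
      by (rule poly_mapping_eqI) (auto simp: lookup_single when_def)
    ultimately have "of_int 1 / of_nat p ^ 1 \<in> Zp"
      using integer_valuedD[OF _ one_units_1] by fastforce
    then have "int p ^ 1 dvd 1"
      by (subst (asm) Zp_of_int_divide_iff) auto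
    then show False
      using prime_p by simp
  qed
  moreover have "j \<in> {0, 1, 2}"
  proof (rule ccontr)
    assume "j \<notin> {0, 1, 2}"
    then have "single (0, T) (1 * \<phi> 0) = (0::laurent2)"
      using const[of 1] by (simp add: res_set_def)
    then show False
      using \<open>\<phi> 0 \<noteq> 0\<close> by (metis lookup_single_eq lookup_zero mult_1)
  qed
  ultimately have "j = 2" by auto
  moreover have "T = 0"
    using const[of 1] \<open>\<phi> 0 \<noteq> 0\<close> \<open>j = 2\<close> by (force simp: res_set_def E1Q_iff)
  ultimately show ?thesis by simp
qed

lemma comodule_hom_nonzero:
  assumes f: "f \<in> Hom t i j" "f \<noteq> (\<lambda>_. 0)"
  shows "q dvd t" "i \<in> {0, 1, 2}" "j \<in> {0, 1, 2}" "i = 2 \<Longrightarrow> j = 2 \<and> t = 0"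
proof -
  obtain \<phi> where \<phi>: "f = multiplier_on i \<phi> (t div q)"
    "\<And>x. x \<in> res_set i \<Longrightarrow> multiplier \<phi> (t div q) x \<in> res_set j"
    "\<not> q dvd t \<Longrightarrow> f = (\<lambda>_. 0)"
    using comodule_hom_multiplier[OF f(1)] by metis
  show dvd: "q dvd t" using \<phi>(3) f(2) by blast
  show "i \<in> {0, 1, 2}"
  proof (rule ccontr)
    assume "i \<notin> {0, 1, 2}"
    then have "f = (\<lambda>_. 0)"
      by (auto simp: \<phi>(1) multiplier_on_def res_set_def fun_eq_iff)
    with f(2) show False ..
  qed
  show "j \<in> {0, 1, 2}"
  proof (rule ccontr)
    assume "j \<notin> {0, 1, 2}"
    then have "f = (\<lambda>_. 0)"
      using \<phi>(2) by (auto simp: \<phi>(1) multiplier_on_def res_set_def fun_eq_iff)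
    with f(2) show False ..
  qed
  show "j = 2 \<and> t = 0" if "i = 2"
  proof -
    have "j = 2 \<and> t div q = 0"
      using \<phi>(1,2) f(2) that by (intro multiplier_on_E1Q) auto
    then show ?thesis
      using dvd dvd_div_eq_0_iff by blast
  qed
qed

lemma zero_comodule_hom:
  "(\<lambda>_. 0) \<in> Hom t i j"
proof -
  have z: "multiplier (\<lambda>_. 0) 0 x = 0" for x
    by (rule poly_mapping2_eqI) simp
  have "multiplier_on i (\<lambda>_. 0) 0 \<in> Hom t i j"
    by (intro multiplier_on_comodule_hom) (simp_all add: z)
  moreover have "multiplier_on i (\<lambda>_. 0) 0 = (\<lambda>_. 0)"
    by (auto simp: multiplier_on_def z fun_eq_iff)
  ultimately show ?thesis by simp
qed

text \<open>In degree \<open>n\<close> the component with shift \<open>s\<close> vanishes unless \<open>q\<close> divides \<open>n - s\<close>, and maps out of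
  \<open>I\<^sup>2\<close> have shift \<open>0\<close>. So \<open>s\<close> is between \<open>-1\<close> and \<open>2\<close>, and as \<open>q \<ge> 4\<close>, only the value \<open>0\<close>, \<open>1\<close> or
  \<open>2\<close> remains in the degrees \<open>qT\<close>, \<open>qT + 1\<close> and \<open>2\<close>. A map from \<open>E(1)\<^sub>*E(1)\<close> to \<open>I\<^sup>2\<close> of degree
  \<open>qT\<close> sees only the power \<open>w\<^bsup>-T\<^esup>\<close>. In \<open>cochain0\<close> the component \<open>I\<^sup>2 \<rightarrow> I\<^sup>2\<close> is absent because it is
  zero for \<open>T \<noteq> 0\<close>.\<close>

definition cochain0 :: "int \<Rightarrow> (int \<Rightarrow> rat) \<Rightarrow> (int \<Rightarrow> rat) \<Rightarrow> cochain"
  where "cochain0 T a b = (\<lambda>i s. if s = 0 \<and> i = 0 then multiplier_on 0 a T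
     else if s = 0 \<and> i = 1 then multiplier_on 1 b T else (\<lambda>_. 0))"

definition cochain1 :: "int \<Rightarrow> (int \<Rightarrow> rat) \<Rightarrow> rat \<Rightarrow> cochain"
  where "cochain1 T \<alpha> l = (\<lambda>i s. if s = 1 \<and> i = 0 then multiplier_on 0 \<alpha> T
     else if s = 1 \<and> i = 1 then multiplier_on 1 (\<lambda>b. if b = - T then l else 0) T else (\<lambda>_. 0))"

definition cochain2 :: "int \<Rightarrow> rat \<Rightarrow> cochain"
  where "cochain2 T l = (\<lambda>i s. if s = 2 \<and> i = 0 then multiplier_on 0 (\<lambda>b. if b = - T then l else 0) T
     else (\<lambda>_. 0))"

lemma res_set_2: "res_set 2 = E1Q"
  by (simp add: res_set_def)

lemma E1E1_hom:
  assumes f: "f \<in> Hom (q * T) i j"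
    and i: "i = 0 \<or> i = 1" and j: "j = 0 \<or> j = 1"
  shows "\<exists>\<phi>\<in>integral_functionals. f = multiplier_on i \<phi> T"
proof -
  have "q * T div q = T" using q_pos by simp
  then obtain \<phi> where "f = multiplier_on i \<phi> T" "\<And>x. x \<in> res_set i \<Longrightarrow> multiplier \<phi> T x \<in> res_set j"
    using comodule_hom_multiplier[OF f] by metis
  then show ?thesis
    using multiplier_E1E1_iff[of \<phi> T] i j by (auto simp: res_set_0_1)
qed

lemma E1Q_hom:
  assumes f: "f \<in> Hom (q * T) i 2"
    and i: "i = 0 \<or> i = 1"
  shows "\<exists>l. f = multiplier_on i (\<lambda>b. if b = - T then l else 0) T"
proof -
  have "q * T div q = T" using q_pos by simp
  then obtain \<phi> where \<phi>: "f = multiplier_on i \<phi> T" "\<And>x. x \<in> res_set i \<Longrightarrow> multiplier \<phi> T x \<in> res_set 2"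
    using comodule_hom_multiplier[OF f] by metis
  then have "\<forall>b. b \<noteq> - T \<longrightarrow> \<phi> b = 0"
    using i by (subst multiplier_E1E1_E1Q_iff[symmetric]) (auto simp: res_set_0_1 res_set_2)
  then have "\<phi> = (\<lambda>b. if b = - T then \<phi> (- T) else 0)"
    by auto
  with \<phi>(1) show ?thesis by metis
qed

lemma integral_functional_hom:
  "\<phi> \<in> integral_functionals \<Longrightarrow> i = 0 \<or> i = 1 \<Longrightarrow> j = 0 \<or> j = 1 \<Longrightarrow> t = q * T \<Longrightarrow>
    multiplier_on i \<phi> T \<in> Hom t i j"
  by (rule multiplier_on_comodule_hom) (auto simp: res_set_0_1 multiplier_E1E1)

lemma delta_hom:
  "i = 0 \<or> i = 1 \<Longrightarrow> t = q * T \<Longrightarrow>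
    multiplier_on i (\<lambda>b. if b = - T then l else 0) T \<in> Hom t i 2"
  using multiplier_E1E1_E1Q_iff[of "\<lambda>b. if b = - T then l else 0" T]
  by (intro multiplier_on_comodule_hom) (auto simp: res_set_0_1 res_set_2)

lemma C_setD:
  "f \<in> C_set p n \<Longrightarrow> f i s \<in> Hom (n - s) i (i + s)"
  by (simp add: C_set_def)

lemma small_multiple_of_q: "q dvd x \<Longrightarrow> \<bar>x\<bar> < 4 \<Longrightarrow> x = 0"
  using q_pos zdvd_imp_le[of q "\<bar>x\<bar>"] by (cases "x = 0") auto

lemma C_set_0:
  assumes "T \<noteq> 0"
  shows "C_set p (q * T) = {cochain0 T a b | a b. a \<in> integral_functionals \<and> b \<in> integral_functionals}"
proof safe
  fix f assume f: "f \<in> C_set p (q * T)"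
  have nz: "s = 0 \<and> (i = 0 \<or> i = 1)" if "f i s \<noteq> (\<lambda>_. 0)" for i s
  proof -
    note hom = comodule_hom_nonzero[OF C_setD[OF f] that]
    obtain w where "q * T - s = q * w"
      using hom(1) by (rule dvdE)
    then have "s = q * (T - w)"
      by (simp add: algebra_simps)
    then have "q dvd s" by (rule dvdI)
    moreover have "\<bar>s\<bar> < 4"
      using hom(2,3) by auto
    ultimately have "s = 0"
      by (intro small_multiple_of_q) simp_all
    moreover have "i \<noteq> 2"
      using hom(4) \<open>s = 0\<close> assms q_pos by auto
    ultimately show ?thesis
      using hom(2) by auto
  qed
  obtain a where a: "a \<in> integral_functionals" "f 0 0 = multiplier_on 0 a T"
    using E1E1_hom[of "f 0 0" T 0 0] C_setD[OF f, of 0 0] by auto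
  obtain b where b: "b \<in> integral_functionals" "f 1 0 = multiplier_on 1 b T"
    using E1E1_hom[of "f 1 0" T 1 1] C_setD[OF f, of 1 0] by auto
  have "f i s = (cochain0 T a b) i s" for i s
  proof (cases "s = 0 \<and> (i = 0 \<or> i = 1)")
    case True
    then show ?thesis
      using a(2) b(2) by (auto simp: cochain0_def)
  next
    case False
    then have "f i s = (\<lambda>_. 0)"
      using nz by blast
    with False show ?thesis
      by (auto simp: cochain0_def)
  qed
  then have "f = cochain0 T a b"
    by (intro ext) simp
  with a(1) b(1) show "\<exists>a b. f = cochain0 T a b \<and> a \<in> integral_functionals \<and> b \<in> integral_functionals"
    by blast
next
  fix a b assume "a \<in> integral_functionals" "b \<in> integral_functionals"
  then show "cochain0 T a b \<in> C_set p (q * T)"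
    by (auto simp: C_set_def cochain0_def zero_comodule_hom integral_functional_hom)
qed

lemma C_set_1:
  "C_set p (q * T + 1) = {cochain1 T \<alpha> l | \<alpha> l. \<alpha> \<in> integral_functionals}"
proof safe
  fix f assume f: "f \<in> C_set p (q * T + 1)"
  have nz: "s = 1 \<and> (i = 0 \<or> i = 1)" if "f i s \<noteq> (\<lambda>_. 0)" for i s
  proof -
    note hom = comodule_hom_nonzero[OF C_setD[OF f] that]
    obtain w where "q * T + 1 - s = q * w"
      using hom(1) by (rule dvdE)
    then have "1 - s = q * (w - T)"
      by (simp add: algebra_simps)
    then have "q dvd 1 - s" by (rule dvdI)
    moreover have "\<bar>1 - s\<bar> < 4"
      using hom(2,3) by auto
    ultimately have "1 - s = 0"
      by (intro small_multiple_of_q) simp_all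
    then have "s = 1" by simp
    with hom(2,3) show ?thesis by auto
  qed
  obtain \<alpha> where \<alpha>: "\<alpha> \<in> integral_functionals" "f 0 1 = multiplier_on 0 \<alpha> T"
    using E1E1_hom[of "f 0 1" T 0 1] C_setD[OF f, of 0 1] by auto
  obtain l where l: "f 1 1 = multiplier_on 1 (\<lambda>b. if b = - T then l else 0) T"
    using E1Q_hom[of "f 1 1" T 1] C_setD[OF f, of 1 1] by auto
  have "f i s = (cochain1 T \<alpha> l) i s" for i s
  proof (cases "s = 1 \<and> (i = 0 \<or> i = 1)")
    case True
    then show ?thesis
      using \<alpha>(2) l by (auto simp: cochain1_def)
  next
    case False
    then have "f i s = (\<lambda>_. 0)"
      using nz by blast
    with False show ?thesis
      by (auto simp: cochain1_def)
  qed
  then have "f = cochain1 T \<alpha> l"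
    by (intro ext) simp
  with \<alpha>(1) show "\<exists>\<alpha> l. f = cochain1 T \<alpha> l \<and> \<alpha> \<in> integral_functionals"
    by blast
next
  fix \<alpha> l assume "\<alpha> \<in> integral_functionals"
  then show "cochain1 T \<alpha> l \<in> C_set p (q * T + 1)"
    by (auto simp: C_set_def cochain1_def zero_comodule_hom integral_functional_hom delta_hom)
qed

lemma C_set_2: "C_set p 2 = range (cochain2 0)"
proof safe
  fix f assume f: "f \<in> C_set p 2"
  have nz: "s = 2 \<and> i = 0" if "f i s \<noteq> (\<lambda>_. 0)" for i s
  proof -
    note hom = comodule_hom_nonzero[OF C_setD[OF f] that]
    \<comment> \<open>For \<open>p = 3\<close> the shift \<open>-2\<close> is congruent to \<open>2\<close> modulo \<open>q = 4\<close>, but it would be a map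
      \<open>I\<^sup>2 \<rightarrow> I\<^sup>0\<close>.\<close>
    have "s \<noteq> - 2"
      using hom(2-4) by auto
    then have "\<bar>2 - s\<bar> < 4"
      using hom(2,3) by auto
    then have "2 - s = 0"
      using hom(1) by (intro small_multiple_of_q) simp_all
    then have "s = 2" by simp
    with hom(2,3) show ?thesis by auto
  qed
  obtain l where l: "f 0 2 = multiplier_on 0 (\<lambda>b. if b = - 0 then l else 0) 0"
    using E1Q_hom[of "f 0 2" 0 0] C_setD[OF f, of 0 2] by auto
  have "f i s = (cochain2 0 l) i s" for i s
  proof (cases "s = 2 \<and> i = 0")
    case True
    then show ?thesis
      using l by (auto simp: cochain2_def)
  next
    case False
    then have "f i s = (\<lambda>_. 0)"
      using nz by blast
    with False show ?thesis
      by (auto simp: cochain2_def)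
  qed
  then have "f = cochain2 0 l"
    by (intro ext) simp
  then show "f \<in> range (cochain2 0)" by blast
next
  fix l
  show "cochain2 0 l \<in> C_set p 2"
    using delta_hom[of 0 0 0 l] by (auto simp: C_set_def cochain2_def zero_comodule_hom)
qed

lemma compose_1_d:
  assumes "\<phi> \<in> integral_functionals"
  shows "multiplier_on 1 \<psi> U (multiplier_on 0 \<phi> T x) = multiplier_on 0 (\<lambda>b. \<phi> b * \<psi> (b + T)) (T + U) x"
    and "multiplier_on 0 \<psi> U (multiplier_on 0 \<phi> T x) = multiplier_on 0 (\<lambda>b. \<phi> b * \<psi> (b + T)) (T + U) x"
    and "multiplier_on 1 \<psi> U (multiplier_on 1 \<phi> T x) = multiplier_on 1 (\<lambda>b. \<phi> b * \<psi> (b + T)) (T + U) x"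
  using assms by (intro multiplier_on_multiplier_on; simp add: res_set_0_1 multiplier_E1E1)+

lemma adams_diff_integral: "(\<lambda>b. rho powi b - 1) \<in> integral_functionals"
  by (intro integral_functionals_diff integral_functionals_powi integral_functionals_const rho_one_units Zp_1)

lemma multiplier_on_plus: "multiplier_on i \<phi> T x + multiplier_on i \<psi> T x = multiplier_on i (\<lambda>b. \<phi> b + \<psi> b) T x"
  unfolding multiplier_on_def
  by (auto intro!: poly_mapping2_eqI simp: lookup_add distrib_left)

lemma multiplier_on_minus: "multiplier_on i \<phi> T x - multiplier_on i \<psi> T x = multiplier_on i (\<lambda>b. \<phi> b - \<psi> b) T x"
  unfolding multiplier_on_def
  by (auto intro!: poly_mapping2_eqI simp: lookup_minus right_diff_distrib)

lemma multiplier_on_scale: "single (0, 0) c * multiplier_on i \<phi> T x = multiplier_on i (\<lambda>b. c * \<phi> b) T x"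
  unfolding multiplier_on_def
  by (auto intro!: poly_mapping2_eqI simp: lookup_single_mult_pair)

abbreviation boundary :: "int \<Rightarrow> (int \<Rightarrow> rat) \<Rightarrow> (int \<Rightarrow> rat) \<Rightarrow> int \<Rightarrow> rat"
  where "boundary T a b \<equiv> \<lambda>j. (rho powi (j + T) - 1) * a j - b j * (rho powi j - 1)"

lemma C_d_cochain0:
  assumes "a \<in> integral_functionals" "b \<in> integral_functionals"
  shows "C_d p r (q * T) (cochain0 T a b) =
    cochain1 T (boundary T a b) (b (- T))"
proof (intro ext)
  fix i s :: int and x :: laurent2
  let ?R = "cochain1 T (boundary T a b) (b (- T))"
  consider "s = 1" "i = 0" | "s = 1" "i = 1" | "s = 1" "i \<noteq> 0" "i \<noteq> 1" | "s \<noteq> 1" by blast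
  then show "C_d p r (q * T) (cochain0 T a b) i s x = ?R i s x"
  proof cases
    case 1
    have "C_d p r (q * T) (cochain0 T a b) 0 1 x =
        multiplier_on 0 (\<lambda>j. rho powi j - 1) 0 (multiplier_on 0 a T x) -
        multiplier_on 1 b T (multiplier_on 0 (\<lambda>j. rho powi j - 1) 0 x)"
      by (simp add: C_d_def cochain0_def res_d_0)
    also have "\<dots> = multiplier_on 0 (\<lambda>j. a j * (rho powi (j + T) - 1) - (rho powi j - 1) * b j) T x"
      by (simp add: compose_1_d[OF assms(1)] compose_1_d[OF adams_diff_integral] multiplier_on_minus)
    finally show ?thesis
      using 1 by (simp add: cochain1_def mult.commute)
  next
    case 2
    have "C_d p r (q * T) (cochain0 T a b) 1 1 x = multiplier_on 1 (\<lambda>b. if b = 0 then 1 else 0) 0 (multiplier_on 1 b T x)"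
      by (simp add: C_d_def cochain0_def res_d_1)
    also have "\<dots> = multiplier_on 1 (\<lambda>j. b j * (if j + T = 0 then 1 else 0)) T x"
      by (simp add: compose_1_d[OF assms(2)])
    also have "(\<lambda>j. b j * (if j + T = 0 then 1 else 0)) = (\<lambda>j. if j = - T then b (- T) else 0)"
      by (auto simp: fun_eq_iff)
    finally show ?thesis
      using 2 by (simp add: cochain1_def)
  next
    case 3
    then show ?thesis
      by (auto simp: C_d_def cochain0_def cochain1_def res_d_other)
  next
    case 4
    then show ?thesis
      by (auto simp: C_d_def cochain0_def cochain1_def)
  qed
qed

lemma C_d_cochain1:
  assumes "\<alpha> \<in> integral_functionals"
  shows "C_d p r (q * T + 1) (cochain1 T \<alpha> l) = cochain2 T (\<alpha> (- T) + l * (rho powi (- T) - 1))"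
proof (intro ext)
  fix i s :: int and x :: laurent2
  let ?R = "cochain2 T (\<alpha> (- T) + l * (rho powi (- T) - 1))"
  consider "s = 2" "i = 0" | "s = 2" "i = 1" | "s = 2" "i \<noteq> 0" "i \<noteq> 1" | "s \<noteq> 2" by blast
  then show "C_d p r (q * T + 1) (cochain1 T \<alpha> l) i s x = ?R i s x"
  proof cases
    case 1
    have "C_d p r (q * T + 1) (cochain1 T \<alpha> l) 0 2 x =
        multiplier_on 1 (\<lambda>b. if b = 0 then 1 else 0) 0 (multiplier_on 0 \<alpha> T x) +
        multiplier_on 1 (\<lambda>b. if b = - T then l else 0) T (multiplier_on 0 (\<lambda>j. rho powi j - 1) 0 x)"
      by (simp add: C_d_def cochain1_def res_d_0 res_d_1)
    also have "\<dots> = multiplier_on 0 (\<lambda>j. \<alpha> j * (if j + T = 0 then 1 else 0) +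
        (rho powi j - 1) * (if j = - T then l else 0)) T x"
      by (simp add: compose_1_d[OF assms(1)] compose_1_d[OF adams_diff_integral] multiplier_on_plus)
    also have "(\<lambda>j. \<alpha> j * (if j + T = 0 then 1 else 0) + (rho powi j - 1) * (if j = - T then l else 0)) =
        (\<lambda>j. if j = - T then \<alpha> (- T) + l * (rho powi (- T) - 1) else 0)"
      by (auto simp: fun_eq_iff)
    finally show ?thesis
      using 1 by (simp add: cochain2_def)
  next
    case 2
    then show ?thesis
      by (simp add: C_d_def cochain1_def cochain2_def res_d_other)
  next
    case 3
    then show ?thesis
      by (auto simp: C_d_def cochain1_def cochain2_def res_d_other)
  next
    case 4
    then show ?thesis
      by (auto simp: C_d_def cochain1_def cochain2_def)
  qed
qed

lemma C_d_cochain2: "C_d p r 2 (cochain2 0 l) = (\<lambda>i s x. 0)"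
proof (intro ext)
  fix i s :: int and x :: laurent2
  show "C_d p r 2 (cochain2 0 l) i s x = 0"
    by (cases "i = 0"; cases "s = 3"; cases "i = - 1") (auto simp: C_d_def cochain2_def res_d_other)
qed

lemma C_mult_cochain1:
  assumes "\<beta> \<in> integral_functionals"
  shows "C_mult (cochain1 (- T) \<alpha> l) (cochain1 T \<beta> m) = cochain2 0 (l * \<beta> 0)"
proof (intro ext)
  fix i s :: int and x :: laurent2
  have J: "{0..2} = {0, 1, 2::int}" by auto
  consider "s = 2" "i = 0" | "\<not> (s = 2 \<and> i = 0)" by blast
  then show "C_mult (cochain1 (- T) \<alpha> l) (cochain1 T \<beta> m) i s x = cochain2 0 (l * \<beta> 0) i s x"
  proof cases
    case 1
    have "C_mult (cochain1 (- T) \<alpha> l) (cochain1 T \<beta> m) 0 2 x =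
        multiplier_on 1 (\<lambda>b. if b = T then l else 0) (- T) (multiplier_on 0 \<beta> T x)"
      by (simp add: C_mult_def J cochain1_def)
    also have "\<dots> = multiplier_on 0 (\<lambda>b. \<beta> b * (if b + T = T then l else 0)) 0 x"
      by (simp add: compose_1_d[OF assms])
    also have "(\<lambda>b. \<beta> b * (if b + T = T then l else 0)) = (\<lambda>b. if b = - 0 then l * \<beta> 0 else 0)"
      by (auto simp: fun_eq_iff)
    finally show ?thesis
      using 1 by (simp add: cochain2_def)
  next
    case 2
    then show ?thesis
      by (auto simp: C_mult_def J cochain1_def cochain2_def)
  qed
qed

lemma cochain1_add:
  "(\<lambda>i s x. cochain1 T \<alpha> l i s x + cochain1 T \<beta> m i s x) = cochain1 T (\<lambda>b. \<alpha> b + \<beta> b) (l + m)"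
proof -
  have "(\<lambda>b. (if b = - T then l else 0) + (if b = - T then m else 0)) = (\<lambda>b. if b = - T then l + m else 0)"
    by auto
  then show ?thesis
    by (auto simp: cochain1_def fun_eq_iff multiplier_on_plus)
qed

lemma cochain1_scale:
  "(\<lambda>i s x. single (0, 0) c * cochain1 T \<alpha> l i s x) = cochain1 T (\<lambda>b. c * \<alpha> b) (c * l)"
proof -
  have "(\<lambda>b. c * (if b = - T then l else 0)) = (\<lambda>b. if b = - T then c * l else 0)"
    by auto
  then show ?thesis
    by (auto simp: cochain1_def fun_eq_iff multiplier_on_scale)
qed

lemma cochain2_add: "(\<lambda>i s x. cochain2 T l i s x + cochain2 T m i s x) = cochain2 T (l + m)"
proof -
  have "(\<lambda>b. (if b = - T then l else 0) + (if b = - T then m else 0)) = (\<lambda>b. if b = - T then l + m else 0)"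
    by auto
  then show ?thesis
    by (auto simp: cochain2_def fun_eq_iff multiplier_on_plus)
qed

lemma cochain2_scale: "(\<lambda>i s x. single (0, 0) c * cochain2 T l i s x) = cochain2 T (c * l)"
proof -
  have "(\<lambda>b. c * (if b = - T then l else 0)) = (\<lambda>b. if b = - T then c * l else 0)"
    by auto
  then show ?thesis
    by (auto simp: cochain2_def fun_eq_iff multiplier_on_scale)
qed

lemma cochain1_inject: "cochain1 T \<alpha> l = cochain1 T \<beta> m \<Longrightarrow> \<alpha> = \<beta>"
proof -
  assume "cochain1 T \<alpha> l = cochain1 T \<beta> m"
  then have "cochain1 T \<alpha> l 0 1 = cochain1 T \<beta> m 0 1" by simp
  then have "multiplier_on 0 \<alpha> T = multiplier_on 0 \<beta> T"
    by (simp add: cochain1_def)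
  then show "\<alpha> = \<beta>"
    by (rule multiplier_on_E1E1_inject) simp
qed

lemma cochain2_inject: "cochain2 T l = cochain2 T m \<Longrightarrow> l = m"
proof -
  assume "cochain2 T l = cochain2 T m"
  then have "cochain2 T l 0 2 = cochain2 T m 0 2" by simp
  then have "multiplier_on 0 (\<lambda>b. if b = - T then l else 0) T = multiplier_on 0 (\<lambda>b. if b = - T then m else 0) T"
    by (simp add: cochain2_def)
  then have "(\<lambda>b. if b = - T then l else 0) = (\<lambda>b. if b = - T then m else 0)"
    by (rule multiplier_on_E1E1_inject) simp
  from fun_cong[OF this, of "- T"] show "l = m" by simp
qed

lemma cochain2_eq_0_iff: "cochain2 T l = (\<lambda>i s x. 0) \<longleftrightarrow> l = 0"
proof -
  have "multiplier (\<lambda>_. 0) T x = 0" for x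
    by (rule poly_mapping2_eqI) simp
  then have "cochain2 T 0 = (\<lambda>i s x. 0)"
    by (auto simp: cochain2_def multiplier_on_def fun_eq_iff)
  then show ?thesis
    using cochain2_inject by metis
qed

end

section \<open>Cohomology in coordinates\<close>

lemma C_module_simps [simp]:
  "f \<oplus>\<^bsub>C_module p n\<^esub> g = (\<lambda>i s x. f i s x + g i s x)"
  "c \<odot>\<^bsub>C_module p n\<^esub> f = (\<lambda>i s x. single (0, 0) c * f i s x)"
  by (simp_all add: C_module_def)

lemma cohomology_simps:
  "carrier (cohomology p r n) = coh_class p r n ` cocycles p r n"
  "X \<oplus>\<^bsub>cohomology p r n\<^esub> Y = X <+>\<^bsub>C_module p n\<^esub> Y"
  "\<zero>\<^bsub>cohomology p r n\<^esub> = coboundaries p r n"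
  "c \<odot>\<^bsub>cohomology p r n\<^esub> X = (\<Union>f\<in>X. coh_class p r n (c \<odot>\<^bsub>C_module p n\<^esub> f))"
  by (simp_all add: cohomology_def)

text \<open>A parametrisation \<open>P\<close> of the cocycles by a module \<open>V\<close> of sequences, under which the coboundaries
  correspond to a submodule \<open>W\<close>: the cohomology is \<open>V/W\<close>. Injectivity is required modulo \<open>W\<close> only,
  so that a single number can be encoded by any sequence with this value at \<open>0\<close>.\<close>

locale cohomology_coordinates = prime_localisation +
  fixes r n :: int and P :: "(int \<Rightarrow> rat) \<Rightarrow> cochain" and V W :: "(int \<Rightarrow> rat) set"
  assumes cocycles_eq: "cocycles p r n = P ` V" and coboundaries_eq: "coboundaries p r n = P ` W"
    and P_add: "\<And>\<alpha> \<beta>. (\<lambda>i s x. P \<alpha> i s x + P \<beta> i s x) = P (\<lambda>b. \<alpha> b + \<beta> b)"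
    and P_scale: "\<And>c \<alpha>. (\<lambda>i s x. single (0, 0) c * P \<alpha> i s x) = P (\<lambda>b. c * \<alpha> b)"
    and P_inject: "\<And>\<alpha> \<beta>. P \<alpha> = P \<beta> \<Longrightarrow> \<beta> \<in> W \<Longrightarrow> \<alpha> \<in> W"
    and W_subset: "W \<subseteq> V"
    and V_add: "\<And>\<alpha> \<beta>. \<alpha> \<in> V \<Longrightarrow> \<beta> \<in> V \<Longrightarrow> (\<lambda>b. \<alpha> b + \<beta> b) \<in> V"
    and V_scale: "\<And>c \<alpha>. c \<in> Zp \<Longrightarrow> \<alpha> \<in> V \<Longrightarrow> (\<lambda>b. c * \<alpha> b) \<in> V"
    and W_0: "(\<lambda>b. 0) \<in> W"
    and W_add: "\<And>\<alpha> \<beta>. \<alpha> \<in> W \<Longrightarrow> \<beta> \<in> W \<Longrightarrow> (\<lambda>b. \<alpha> b + \<beta> b) \<in> W"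
    and W_scale: "\<And>c \<alpha>. c \<in> Zp \<Longrightarrow> \<alpha> \<in> W \<Longrightarrow> (\<lambda>b. c * \<alpha> b) \<in> W"
begin

abbreviation coclass :: "(int \<Rightarrow> rat) \<Rightarrow> cochain set" where "coclass \<alpha> \<equiv> coh_class p r n (P \<alpha>)"

lemma W_uminus: "\<alpha> \<in> W \<Longrightarrow> (\<lambda>b. - \<alpha> b) \<in> W"
  using W_scale[of "- 1" \<alpha>] Zp_uminus[OF Zp_1] by simp

lemma W_diff: "\<alpha> \<in> W \<Longrightarrow> \<beta> \<in> W \<Longrightarrow> (\<lambda>b. \<alpha> b - \<beta> b) \<in> W"
  using W_add[of \<alpha> "\<lambda>b. - \<beta> b"] W_uminus[of \<beta>] by simp

lemma coclass_eq: "coclass \<alpha> = P ` {\<beta>. (\<lambda>b. \<beta> b - \<alpha> b) \<in> W}"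
proof -
  have "coclass \<alpha> = (\<lambda>w. P (\<lambda>b. w b + \<alpha> b)) ` W"
    by (auto simp: coh_class_def a_r_coset_def' coboundaries_eq P_add)
  also have "\<dots> = P ` {\<beta>. (\<lambda>b. \<beta> b - \<alpha> b) \<in> W}"
  proof (intro equalityI subsetI)
    fix f assume "f \<in> (\<lambda>w. P (\<lambda>b. w b + \<alpha> b)) ` W"
    then obtain w where "w \<in> W" "f = P (\<lambda>b. w b + \<alpha> b)" by blast
    then show "f \<in> P ` {\<beta>. (\<lambda>b. \<beta> b - \<alpha> b) \<in> W}"
      by (intro image_eqI[of _ _ "\<lambda>b. w b + \<alpha> b"]) simp_all
  next
    fix f assume "f \<in> P ` {\<beta>. (\<lambda>b. \<beta> b - \<alpha> b) \<in> W}"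
    then obtain \<beta> where "(\<lambda>b. \<beta> b - \<alpha> b) \<in> W" "f = P \<beta>" by blast
    then show "f \<in> (\<lambda>w. P (\<lambda>b. w b + \<alpha> b)) ` W"
      by (intro image_eqI[of _ _ "\<lambda>b. \<beta> b - \<alpha> b"]) simp_all
  qed
  finally show ?thesis .
qed

lemma coclass_eq_iff: "coclass \<alpha> = coclass \<beta> \<longleftrightarrow> (\<lambda>b. \<alpha> b - \<beta> b) \<in> W"
proof
  assume "coclass \<alpha> = coclass \<beta>"
  moreover have "P \<alpha> \<in> coclass \<alpha>"
    unfolding coclass_eq using W_0 by (intro image_eqI[of _ _ \<alpha>]) simp_all
  ultimately obtain \<gamma> where \<gamma>: "(\<lambda>b. \<gamma> b - \<beta> b) \<in> W" "P \<alpha> = P \<gamma>"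
    unfolding coclass_eq by auto
  have "P (\<lambda>b. \<alpha> b - \<beta> b) = P (\<lambda>b. \<gamma> b - \<beta> b)"
    using P_add[of \<alpha> "\<lambda>b. - \<beta> b"] P_add[of \<gamma> "\<lambda>b. - \<beta> b"] \<gamma>(2) by simp
  then show "(\<lambda>b. \<alpha> b - \<beta> b) \<in> W"
    using P_inject \<gamma>(1) by blast
next
  assume W: "(\<lambda>b. \<alpha> b - \<beta> b) \<in> W"
  have "(\<lambda>b. \<gamma> b - \<alpha> b) \<in> W \<longleftrightarrow> (\<lambda>b. \<gamma> b - \<beta> b) \<in> W" for \<gamma>
    using W_add[OF _ W, of "\<lambda>b. \<gamma> b - \<alpha> b"] W_diff[OF _ W, of "\<lambda>b. \<gamma> b - \<beta> b"] by auto
  then show "coclass \<alpha> = coclass \<beta>"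
    by (simp add: coclass_eq)
qed

lemma carrier_cohomology: "carrier (cohomology p r n) = coclass ` V"
  by (auto simp: cohomology_simps cocycles_eq)

lemma coclass_in_carrier: "\<alpha> \<in> V \<Longrightarrow> coclass \<alpha> \<in> carrier (cohomology p r n)"
  by (simp add: carrier_cohomology)

lemma coclass_add: "coclass \<alpha> \<oplus>\<^bsub>cohomology p r n\<^esub> coclass \<beta> = coclass (\<lambda>b. \<alpha> b + \<beta> b)"
proof -
  have "coclass \<alpha> \<oplus>\<^bsub>cohomology p r n\<^esub> coclass \<beta> =
      {P (\<lambda>b. \<gamma> b + \<delta> b) | \<gamma> \<delta>. (\<lambda>b. \<gamma> b - \<alpha> b) \<in> W \<and> (\<lambda>b. \<delta> b - \<beta> b) \<in> W}"
    by (auto simp: cohomology_simps set_add_def' coclass_eq P_add)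
  also have "\<dots> = P ` {\<gamma>. (\<lambda>b. \<gamma> b - (\<alpha> b + \<beta> b)) \<in> W}"
  proof (intro equalityI subsetI)
    fix f assume "f \<in> {P (\<lambda>b. \<gamma> b + \<delta> b) | \<gamma> \<delta>. (\<lambda>b. \<gamma> b - \<alpha> b) \<in> W \<and> (\<lambda>b. \<delta> b - \<beta> b) \<in> W}"
    then obtain \<gamma> \<delta> where *: "f = P (\<lambda>b. \<gamma> b + \<delta> b)" "(\<lambda>b. \<gamma> b - \<alpha> b) \<in> W" "(\<lambda>b. \<delta> b - \<beta> b) \<in> W"
      by blast
    have "(\<lambda>b. (\<gamma> b + \<delta> b) - (\<alpha> b + \<beta> b)) \<in> W"
      using W_add[OF *(2,3)] by (simp add: algebra_simps)
    with *(1) show "f \<in> P ` {\<gamma>. (\<lambda>b. \<gamma> b - (\<alpha> b + \<beta> b)) \<in> W}" by blast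
  next
    fix f assume "f \<in> P ` {\<gamma>. (\<lambda>b. \<gamma> b - (\<alpha> b + \<beta> b)) \<in> W}"
    then obtain \<gamma> where \<gamma>: "f = P \<gamma>" "(\<lambda>b. \<gamma> b - (\<alpha> b + \<beta> b)) \<in> W" by blast
    have "f = P (\<lambda>b. (\<gamma> b - \<beta> b) + \<beta> b)" "(\<lambda>b. (\<gamma> b - \<beta> b) - \<alpha> b) \<in> W" "(\<lambda>b. \<beta> b - \<beta> b) \<in> W"
      using \<gamma> W_0 by (simp_all add: algebra_simps)
    then show "f \<in> {P (\<lambda>b. \<gamma> b + \<delta> b) | \<gamma> \<delta>. (\<lambda>b. \<gamma> b - \<alpha> b) \<in> W \<and> (\<lambda>b. \<delta> b - \<beta> b) \<in> W}"
      by (intro CollectI exI[of _ "\<lambda>b. \<gamma> b - \<beta> b"] exI[of _ \<beta>]) simp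
  qed
  finally show ?thesis by (simp add: coclass_eq)
qed

lemma coclass_scale:
  assumes "c \<in> Zp" shows "c \<odot>\<^bsub>cohomology p r n\<^esub> coclass \<alpha> = coclass (\<lambda>b. c * \<alpha> b)"
proof -
  have "coh_class p r n (P (\<lambda>b. c * \<beta> b)) = coclass (\<lambda>b. c * \<alpha> b)" if "(\<lambda>b. \<beta> b - \<alpha> b) \<in> W" for \<beta>
    unfolding coclass_eq_iff using W_scale[OF assms that] by (simp add: right_diff_distrib)
  then have "(\<Union>f\<in>coclass \<alpha>. coh_class p r n (\<lambda>i s x. single (0, 0) c * f i s x)) =
      (\<Union>\<beta>\<in>{\<beta>. (\<lambda>b. \<beta> b - \<alpha> b) \<in> W}. coclass (\<lambda>b. c * \<alpha> b))"
    unfolding coclass_eq[of \<alpha>] by (simp add: P_scale)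
  also have "\<dots> = coclass (\<lambda>b. c * \<alpha> b)"
  proof -
    have "\<alpha> \<in> {\<beta>. (\<lambda>b. \<beta> b - \<alpha> b) \<in> W}"
      using W_0 by simp
    then show ?thesis by blast
  qed
  finally show ?thesis by (simp add: cohomology_simps)
qed

lemma zero_class: "\<zero>\<^bsub>cohomology p r n\<^esub> = coclass (\<lambda>b. 0)"
  by (simp add: cohomology_simps coclass_eq coboundaries_eq)

lemma cohomology_comm_group: "comm_group (add_monoid (cohomology p r n))"
proof (rule comm_groupI)
  show "\<exists>Y\<in>carrier (add_monoid (cohomology p r n)). Y \<otimes>\<^bsub>add_monoid (cohomology p r n)\<^esub> X = \<one>\<^bsub>add_monoid (cohomology p r n)\<^esub>"
    if X: "X \<in> carrier (add_monoid (cohomology p r n))" for X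
  proof -
    obtain \<alpha> where \<alpha>: "\<alpha> \<in> V" "X = coclass \<alpha>"
      using X carrier_cohomology by auto
    have "(\<lambda>b. - \<alpha> b) \<in> V"
      using V_scale[OF Zp_uminus[OF Zp_1] \<alpha>(1)] by simp
    then show ?thesis
      using coclass_add[of "\<lambda>b. - \<alpha> b" \<alpha>] coclass_in_carrier zero_class \<alpha>(2)
      by (intro bexI[of _ "coclass (\<lambda>b. - \<alpha> b)"]) simp_all
  qed
qed (use carrier_cohomology coclass_add zero_class V_add W_subset W_0 in
      \<open>auto simp: add_ac\<close>)

end

section \<open>The multiplication\<close>

text \<open>Write the second factor as a multiple of its generator and move the scalar to the first factor; the
  sums then take place in the first factor.\<close>

lemma tensor_product_cyclic:
  fixes R :: "('r::comm_ring_1, 'x) ring_scheme"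
  assumes "tensor_factors R M N"
    and R: "0 \<in> carrier R" "\<And>a b. a \<in> carrier R \<Longrightarrow> b \<in> carrier R \<Longrightarrow> a - b \<in> carrier R"
      "\<And>a b. a \<in> carrier R \<Longrightarrow> b \<in> carrier R \<Longrightarrow> a * b \<in> carrier R"
    and U: "\<And>a. a \<in> carrier R \<Longrightarrow> U a \<in> carrier M" "\<And>x. x \<in> carrier M \<Longrightarrow> \<exists>a\<in>carrier R. x = U a"
      "\<And>a b. a \<in> carrier R \<Longrightarrow> b \<in> carrier R \<Longrightarrow> U (a + b) = U a \<oplus>\<^bsub>M\<^esub> U b"
      "\<And>a b. a \<in> carrier R \<Longrightarrow> b \<in> carrier R \<Longrightarrow> a \<odot>\<^bsub>M\<^esub> U b = U (a * b)"
    and y0: "y0 \<in> carrier N" "\<And>y. y \<in> carrier N \<Longrightarrow> \<exists>a\<in>carrier R. y = a \<odot>\<^bsub>N\<^esub> y0"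
    and c: "keys c \<subseteq> carrier M \<times> carrier N"
  shows "\<exists>a\<in>carrier R. c - frag_of (U a, y0) \<in> tensor_rels R M N"
proof -
  interpret tensor_factors R M N by fact
  have U_diff: "frag_of (U a, y0) - frag_of (U b, y0) - frag_of (U (a - b), y0) \<in> rels"
    if "a \<in> carrier R" "b \<in> carrier R" for a b
    using rels_add_left[of "U (a - b)" "U b" y0] U(1) U(3)[of "a - b" b] R(2) y0(1) that
    by (simp add: diff_diff_eq add.commute)
  show ?thesis
    using c
  proof (induction c rule: frag_induction)
    case zero
    have "0 - frag_of (U 0, y0) \<in> rels"
      using U_diff[of 0 0] R(1) by simp
    then show ?case using R(1) by blast
  next
    case (one m)
    then obtain x y where m: "m = (x, y)" "x \<in> carrier M" "y \<in> carrier N" by auto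
    obtain a where a: "a \<in> carrier R" "x = U a" using U(2) m(2) by blast
    obtain b where b: "b \<in> carrier R" "y = b \<odot>\<^bsub>N\<^esub> y0" using y0(2) m(3) by blast
    have "frag_of (U (b * a), y0) - frag_of (x, y) \<in> rels"
      using rels_balanced[of b x y0] a b m(2) y0(1) U(4) by simp
    from rels_uminus[OF this] show ?case
      using R(3) a b m(1) by auto
  next
    case (diff c d)
    then obtain a b where ab: "a \<in> carrier R" "c - frag_of (U a, y0) \<in> rels"
        "b \<in> carrier R" "d - frag_of (U b, y0) \<in> rels" by blast
    from rels_add[OF rels_diff[OF ab(2,4)] U_diff[OF ab(1,3)]]
    have "c - d - frag_of (U (a - b), y0) \<in> rels"
      by (simp add: algebra_simps)
    then show ?case using R(2) ab by blast
  qed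
qed

context adams_generator begin

text \<open>The cocycle condition \<open>\<alpha>\<^bsub>-T\<^esub> + \<lambda> (rho\<^bsup>-T\<^esup> - 1) = 0\<close>, solved for \<open>\<lambda>\<close>.\<close>

definition second_component :: "int \<Rightarrow> (int \<Rightarrow> rat) \<Rightarrow> rat"
  where "second_component T \<alpha> = - \<alpha> (- T) / (rho powi (- T) - 1)"

definition cocycle1 :: "int \<Rightarrow> (int \<Rightarrow> rat) \<Rightarrow> cochain"
  where "cocycle1 T \<alpha> = cochain1 T \<alpha> (second_component T \<alpha>)"

text \<open>The functionals \<open>(rho\<^sup>T \<Psi>\<^sup>r - 1) a - b (\<Psi>\<^sup>r - 1)\<close>.\<close>

definition boundary_functionals :: "int \<Rightarrow> (int \<Rightarrow> rat) set"
  where "boundary_functionals T = {boundary T a b | a b.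
    a \<in> integral_functionals \<and> b \<in> integral_functionals}"

lemma boundary_functionals_subset: "boundary_functionals T \<subseteq> integral_functionals"
proof
  fix \<alpha> assume "\<alpha> \<in> boundary_functionals T"
  then obtain a b where ab: "a \<in> integral_functionals" "b \<in> integral_functionals"
    "\<alpha> = (boundary T a b)"
    unfolding boundary_functionals_def by blast
  have "\<alpha> = (\<lambda>j. (rho powi T * (rho powi j * a j) - a j) - (rho powi j * b j - b j))"
    unfolding ab(3) by (simp add: power_int_add algebra_simps)
  then show "\<alpha> \<in> integral_functionals"
    using ab(1,2) rho_one_units
    by (auto intro!: integral_functionals_diff integral_functionals_scale integral_functionals_times_powi
        one_units_Zp one_units_powi)
qed

lemma boundary_functional_at_0:
  assumes "\<alpha> \<in> boundary_functionals T" obtains z where "z \<in> Zp" "\<alpha> 0 = (rho powi T - 1) * z"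
  using assms integral_functional_value unfolding boundary_functionals_def by force

text \<open>For the boundary of \<open>(a, b)\<close> the second component is \<open>b\<^bsub>-T\<^esub>\<close>.\<close>

lemma second_component_boundary:
  assumes "\<alpha> \<in> boundary_functionals T" "T \<noteq> 0" shows "second_component T \<alpha> \<in> Zp"
proof -
  obtain a b where ab: "a \<in> integral_functionals" "b \<in> integral_functionals"
    "\<alpha> = (boundary T a b)"
    using assms(1) unfolding boundary_functionals_def by blast
  have "second_component T \<alpha> = b (- T)"
    using rho_powi_nontrivial[of "- T"] assms(2) by (simp add: second_component_def ab(3))
  then show ?thesis
    using integral_functional_value[OF ab(2)] by simp
qed

text \<open>Put \<open>D = rho\<^sup>T - 1\<close>. A constant multiple of \<open>rho\<^sup>T \<Psi>\<^sup>r - 1\<close> has value \<open>\<alpha>\<^sub>0\<close> at \<open>0\<close>; the difference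
  vanishes there and hence is \<open>D a + e (\<Psi>\<^sup>r - 1)\<close>. The identity
  \<open>rho\<^sup>T \<Psi>\<^sup>r - 1 = rho\<^sup>T (\<Psi>\<^sup>r - 1) + D\<close> rewrites \<open>D a\<close> as a boundary.\<close>

theorem boundary_functionalI:
  assumes \<alpha>: "\<alpha> \<in> integral_functionals" and z: "z \<in> Zp" "\<alpha> 0 = (rho powi T - 1) * z" and T: "T \<noteq> 0"
  shows "\<alpha> \<in> boundary_functionals T"
proof -
  define D where "D = rho powi T - 1"
  have rhoT: "rho powi T \<in> Zp"
    by (intro one_units_Zp one_units_powi rho_one_units)
  have D: "D \<noteq> 0" "D \<in> Zp"
    using rho_powi_nontrivial[OF T] rhoT by (simp_all add: D_def Zp_diff)
  define \<alpha>' where "\<alpha>' j = \<alpha> j - (rho powi T * (rho powi j * z) - z)" for j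
  have "\<alpha>' \<in> integral_functionals"
    unfolding \<alpha>'_def
    by (intro integral_functionals_diff \<alpha> integral_functionals_scale rhoT integral_functionals_times_powi
        rho_one_units integral_functionals_const z(1))
  moreover have "\<alpha>' 0 = 0"
    using z(2) by (simp add: \<alpha>'_def algebra_simps)
  ultimately obtain a e where ae: "a \<in> integral_functionals" "e \<in> integral_functionals"
      "\<And>j. \<alpha>' j = D * a j + e j * (rho powi j - 1)"
    using functional_divisible_by_adams_diff[OF _ _ D] by metis
  \<comment> \<open>By \<open>D a = (rho\<^sup>T \<Psi>\<^sup>r - 1) a - rho\<^sup>T a (\<Psi>\<^sup>r - 1)\<close>; the constant \<open>z\<close> is the part split off before.\<close>
  define a' where "a' j = a j + z" for j
  define b where "b j = rho powi T * a j - e j" for j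
  have "a' \<in> integral_functionals" "b \<in> integral_functionals"
    unfolding a'_def b_def using ae rhoT z(1)
    by (auto intro!: integral_functionals_add integral_functionals_diff integral_functionals_scale
        integral_functionals_const)
  moreover have "\<alpha> = (\<lambda>j. (rho powi (j + T) - 1) * a' j - b j * (rho powi j - 1))"
  proof
    fix j
    have "\<alpha> j = \<alpha>' j + (rho powi T * (rho powi j * z) - z)"
      by (simp add: \<alpha>'_def)
    then show "\<alpha> j = (rho powi (j + T) - 1) * a' j - b j * (rho powi j - 1)"
      unfolding ae(3) by (simp add: D_def a'_def b_def power_int_add algebra_simps)
  qed
  ultimately show ?thesis
    unfolding boundary_functionals_def by blast
qed

lemma boundary_functionals_add:
  "\<alpha> \<in> boundary_functionals T \<Longrightarrow> \<beta> \<in> boundary_functionals T \<Longrightarrow> (\<lambda>b. \<alpha> b + \<beta> b) \<in> boundary_functionals T"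
proof -
  assume "\<alpha> \<in> boundary_functionals T" "\<beta> \<in> boundary_functionals T"
  then obtain a b a' b' where "a \<in> integral_functionals" "b \<in> integral_functionals"
    "\<alpha> = (boundary T a b)"
    "a' \<in> integral_functionals" "b' \<in> integral_functionals"
    "\<beta> = (\<lambda>j. (rho powi (j + T) - 1) * a' j - b' j * (rho powi j - 1))"
    unfolding boundary_functionals_def by blast
  then show ?thesis
    unfolding boundary_functionals_def
    by (intro CollectI exI[of _ "\<lambda>j. a j + a' j"] exI[of _ "\<lambda>j. b j + b' j"])
      (simp add: integral_functionals_add algebra_simps)
qed

lemma boundary_functionals_scale:
  "c \<in> Zp \<Longrightarrow> \<alpha> \<in> boundary_functionals T \<Longrightarrow> (\<lambda>b. c * \<alpha> b) \<in> boundary_functionals T"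
proof -
  assume "c \<in> Zp" "\<alpha> \<in> boundary_functionals T"
  then obtain a b where "c \<in> Zp" "a \<in> integral_functionals" "b \<in> integral_functionals"
    "\<alpha> = (boundary T a b)"
    unfolding boundary_functionals_def by blast
  then show ?thesis
    unfolding boundary_functionals_def
    by (intro CollectI exI[of _ "\<lambda>j. c * a j"] exI[of _ "\<lambda>j. c * b j"])
      (simp add: integral_functionals_scale algebra_simps)
qed

lemma second_component_add:
  "second_component T (\<lambda>b. \<alpha> b + \<beta> b) = second_component T \<alpha> + second_component T \<beta>"
  by (simp add: second_component_def diff_divide_distrib)

lemma first_cohomology_coordinates:
  assumes T: "T \<noteq> 0"
  shows "cohomology_coordinates p r (q * T + 1) (cocycle1 T) integral_functionals (boundary_functionals T)"
proof unfold_locales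
  have nz: "rho powi (- T) - 1 \<noteq> 0"
    using rho_powi_nontrivial[of "- T"] T by simp
  have unique: "\<alpha> (- T) + l * (rho powi (- T) - 1) = 0 \<longleftrightarrow> l = second_component T \<alpha>" for \<alpha> l
    using nz unfolding second_component_def by (subst eq_divide_eq) (auto simp: eq_neg_iff_add_eq_0 add.commute)
  show "cocycles p r (q * T + 1) = cocycle1 T ` integral_functionals"
    unfolding cocycles_def C_set_1
    by (auto simp: C_d_cochain1 cochain2_eq_0_iff unique cocycle1_def)
  show "coboundaries p r (q * T + 1) = cocycle1 T ` boundary_functionals T"
  proof -
    define F where "F a b = (boundary T a b)" for a b
    have d: "C_d p r (q * T) (cochain0 T a b) = cocycle1 T (F a b)"
      if "a \<in> integral_functionals" "b \<in> integral_functionals" for a b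
    proof -
      have "second_component T (F a b) = b (- T)"
        using nz by (simp add: second_component_def F_def)
      then show ?thesis
        using that by (simp add: C_d_cochain0 cocycle1_def F_def)
    qed
    have "boundary_functionals T = {F a b | a b. a \<in> integral_functionals \<and> b \<in> integral_functionals}"
      by (simp add: boundary_functionals_def F_def)
    moreover have "C_d p r (q * T) ` {cochain0 T a b | a b. a \<in> integral_functionals \<and> b \<in> integral_functionals} =
        cocycle1 T ` {F a b | a b. a \<in> integral_functionals \<and> b \<in> integral_functionals}"
      (is "?L = ?R")
    proof (intro equalityI subsetI)
      fix f assume "f \<in> ?L"
      then obtain a b where ab: "a \<in> integral_functionals" "b \<in> integral_functionals"
          "f = C_d p r (q * T) (cochain0 T a b)" by blast
      then have "f = cocycle1 T (F a b)" by (simp only: d)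
      with ab(1,2) show "f \<in> ?R" by blast
    next
      fix f assume "f \<in> ?R"
      then obtain a b where ab: "a \<in> integral_functionals" "b \<in> integral_functionals"
          "f = cocycle1 T (F a b)" by blast
      then have "f = C_d p r (q * T) (cochain0 T a b)" by (simp only: d)
      with ab(1,2) show "f \<in> ?L" by blast
    qed
    ultimately show ?thesis
      by (simp only: coboundaries_def add_diff_cancel_right' C_set_0[OF T])
  qed
  fix \<alpha> \<beta> c
  show "(\<lambda>i s x. cocycle1 T \<alpha> i s x + cocycle1 T \<beta> i s x) = cocycle1 T (\<lambda>b. \<alpha> b + \<beta> b)"
    by (simp add: cocycle1_def cochain1_add second_component_add)
  show "(\<lambda>i s x. single (0, 0) c * cocycle1 T \<alpha> i s x) = cocycle1 T (\<lambda>b. c * \<alpha> b)"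
    by (simp add: cocycle1_def cochain1_scale second_component_def)
  show "\<alpha> \<in> boundary_functionals T" if "cocycle1 T \<alpha> = cocycle1 T \<beta>" "\<beta> \<in> boundary_functionals T"
    using cochain1_inject[of T \<alpha> _ \<beta>] that unfolding cocycle1_def by metis
next
  show "(\<lambda>b. 0) \<in> boundary_functionals T"
    unfolding boundary_functionals_def
    by (intro CollectI exI[of _ "\<lambda>_. 0"]) (simp add: integral_functionals_const)
qed (fact boundary_functionals_subset
    | erule (1) integral_functionals_add integral_functionals_scale boundary_functionals_add boundary_functionals_scale)+

lemma coboundaries_2: "coboundaries p r 2 = cochain2 0 ` Zp"
proof -
  have "coboundaries p r 2 = C_d p r (q * 0 + 1) ` C_set p (q * 0 + 1)"
    by (simp add: coboundaries_def)
  also have "\<dots> = {cochain2 0 (\<alpha> 0) | \<alpha>. \<alpha> \<in> integral_functionals}"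
    (is "?L = ?R")
  proof (intro equalityI subsetI)
    fix f assume "f \<in> ?L"
    then obtain \<alpha> l where "\<alpha> \<in> integral_functionals" "f = C_d p r (q * 0 + 1) (cochain1 0 \<alpha> l)"
      unfolding C_set_1 by blast
    then have "\<alpha> \<in> integral_functionals" "f = cochain2 0 (\<alpha> 0)"
      by (simp_all only: C_d_cochain1) simp
    then show "f \<in> ?R" by blast
  next
    fix f assume "f \<in> ?R"
    then obtain \<alpha> where \<alpha>: "\<alpha> \<in> integral_functionals" "f = cochain2 0 (\<alpha> 0)" by blast
    then have "f = C_d p r (q * 0 + 1) (cochain1 0 \<alpha> 0)"
      by (simp only: C_d_cochain1) simp
    moreover have "cochain1 0 \<alpha> 0 \<in> C_set p (q * 0 + 1)"
      unfolding C_set_1 using \<alpha>(1) by blast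
    ultimately show "f \<in> ?L" by blast
  qed
  also have "\<dots> = cochain2 0 ` Zp"
  proof (intro equalityI subsetI)
    fix f assume "f \<in> cochain2 0 ` Zp"
    then obtain c where "c \<in> Zp" "f = cochain2 0 c" by blast
    then show "f \<in> {cochain2 0 (\<alpha> 0) | \<alpha>. \<alpha> \<in> integral_functionals}"
      by (intro CollectI exI[of _ "\<lambda>_. c"]) (simp add: integral_functionals_const)
  qed (use integral_functional_value in blast)
  finally show ?thesis .
qed

lemma second_cohomology_coordinates:
  "cohomology_coordinates p r 2 (\<lambda>\<alpha>. cochain2 0 (\<alpha> 0)) UNIV {\<alpha>. \<alpha> 0 \<in> Zp}"
proof unfold_locales
  show "cocycles p r 2 = range (\<lambda>\<alpha>. cochain2 0 (\<alpha> (0::int)))"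
  proof -
    have "cocycles p r 2 = range (cochain2 0)"
      unfolding cocycles_def C_set_2 by (auto simp: C_d_cochain2)
    also have "\<dots> = range (\<lambda>\<alpha>. cochain2 0 (\<alpha> (0::int)))"
    proof (intro equalityI subsetI)
      fix f assume "f \<in> range (cochain2 0)"
      then obtain l where "f = cochain2 0 l" by blast
      then show "f \<in> range (\<lambda>\<alpha>. cochain2 0 (\<alpha> (0::int)))"
        by (intro image_eqI[of _ _ "\<lambda>_. l"]) simp_all
    qed blast
    finally show ?thesis .
  qed
  show "coboundaries p r 2 = (\<lambda>\<alpha>. cochain2 0 (\<alpha> 0)) ` {\<alpha>. \<alpha> (0::int) \<in> Zp}"
    unfolding coboundaries_2
  proof (intro equalityI subsetI)
    fix f assume "f \<in> cochain2 0 ` Zp"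
    then obtain l where "l \<in> Zp" "f = cochain2 0 l" by blast
    then show "f \<in> (\<lambda>\<alpha>. cochain2 0 (\<alpha> 0)) ` {\<alpha>. \<alpha> (0::int) \<in> Zp}"
      by (intro image_eqI[of _ _ "\<lambda>_. l"]) simp_all
  qed blast
qed (auto simp: cochain2_add cochain2_scale Zp_add Zp_mult dest!: cochain2_inject)

text \<open>The product is the composite \<open>I\<^sup>0 \<rightarrow> I\<^sup>1 \<rightarrow> I\<^sup>2\<close>. Its class does not depend on the representatives:
  boundaries have an integral second component, and their value at \<open>0\<close> is a multiple of the
  denominator \<open>rho\<^sup>k - 1\<close> of the second component of \<open>\<alpha>\<close>.\<close>

lemma coh_mult_cocycle1:
  assumes k: "k \<noteq> 0" and \<alpha>: "\<alpha> \<in> integral_functionals" and \<beta>: "\<beta> \<in> integral_functionals"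
  shows "coh_mult p r (q * - k + 1) (q * k + 1)
      (coh_class p r (q * - k + 1) (cocycle1 (- k) \<alpha>)) (coh_class p r (q * k + 1) (cocycle1 k \<beta>)) =
    coh_class p r 2 (cochain2 0 (second_component (- k) \<alpha> * \<beta> 0))"
proof -
  interpret H1: cohomology_coordinates p r "q * - k + 1" "cocycle1 (- k)" integral_functionals "boundary_functionals (- k)"
    by (rule first_cohomology_coordinates) (simp add: k)
  interpret H2: cohomology_coordinates p r "q * k + 1" "cocycle1 k" integral_functionals "boundary_functionals k"
    by (rule first_cohomology_coordinates) (simp add: k)
  interpret H: cohomology_coordinates p r 2 "\<lambda>\<alpha>. cochain2 0 (\<alpha> 0)" UNIV "{\<alpha>. \<alpha> 0 \<in> Zp}"
    by (rule second_cohomology_coordinates)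
  have deg: "q * - k + 1 + (q * k + 1) = 2" by simp
  define S1 where "S1 = {\<alpha>'. (\<lambda>b. \<alpha>' b - \<alpha> b) \<in> boundary_functionals (- k)}"
  define S2 where "S2 = {\<beta>'. (\<lambda>b. \<beta>' b - \<beta> b) \<in> boundary_functionals k}"
  let ?R = "coh_class p r 2 (cochain2 0 (second_component (- k) \<alpha> * \<beta> 0))"
  have eq: "coh_class p r 2 (C_mult (cocycle1 (- k) \<alpha>') (cocycle1 k \<beta>')) = ?R" if "\<alpha>' \<in> S1" "\<beta>' \<in> S2" for \<alpha>' \<beta>'
  proof -
    have d\<alpha>: "(\<lambda>b. \<alpha>' b - \<alpha> b) \<in> boundary_functionals (- k)" and d\<beta>: "(\<lambda>b. \<beta>' b - \<beta> b) \<in> boundary_functionals k"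
      using that by (simp_all add: S1_def S2_def)
    have "(\<lambda>b. (\<beta>' b - \<beta> b) + \<beta> b) \<in> integral_functionals"
      by (rule integral_functionals_add[OF subsetD[OF boundary_functionals_subset d\<beta>] \<beta>])
    then have \<beta>': "\<beta>' \<in> integral_functionals" by simp
    obtain z where z: "z \<in> Zp" "\<beta>' 0 - \<beta> 0 = (rho powi k - 1) * z"
      using boundary_functional_at_0[OF d\<beta>] by blast
    have "second_component (- k) \<alpha>' = second_component (- k) (\<lambda>b. \<alpha>' b - \<alpha> b) + second_component (- k) \<alpha>"
      by (simp flip: second_component_add)
    then have "second_component (- k) \<alpha>' * \<beta>' 0 - second_component (- k) \<alpha> * \<beta> 0 =
        second_component (- k) (\<lambda>b. \<alpha>' b - \<alpha> b) * \<beta>' 0 + second_component (- k) \<alpha> * (\<beta>' 0 - \<beta> 0)"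
      by (simp add: algebra_simps)
    moreover have "second_component (- k) \<alpha> * (\<beta>' 0 - \<beta> 0) = - (\<alpha> k * z)"
      using rho_powi_nontrivial[OF k] unfolding z(2) second_component_def by simp
    moreover have "second_component (- k) (\<lambda>b. \<alpha>' b - \<alpha> b) * \<beta>' 0 + - (\<alpha> k * z) \<in> Zp"
      using second_component_boundary[OF d\<alpha>] k z(1) integral_functional_value[OF \<alpha>]
        integral_functional_value[OF \<beta>']
      by (intro Zp_add Zp_mult Zp_uminus) simp_all
    ultimately have "second_component (- k) \<alpha>' * \<beta>' 0 - second_component (- k) \<alpha> * \<beta> 0 \<in> Zp"
      by simp
    then have "coh_class p r 2 (cochain2 0 (second_component (- k) \<alpha>' * \<beta>' 0)) = ?R"
      using H.coclass_eq_iff[of "\<lambda>_. second_component (- k) \<alpha>' * \<beta>' 0" "\<lambda>_. second_component (- k) \<alpha> * \<beta> 0"]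
      by simp
    then show ?thesis
      unfolding cocycle1_def C_mult_cochain1[OF \<beta>'] .
  qed
  have "\<alpha> \<in> S1" "\<beta> \<in> S2"
    using H1.W_0 H2.W_0 by (simp_all add: S1_def S2_def)
  have "coh_mult p r (q * - k + 1) (q * k + 1)
      (coh_class p r (q * - k + 1) (cocycle1 (- k) \<alpha>)) (coh_class p r (q * k + 1) (cocycle1 k \<beta>)) =
    (\<Union>\<alpha>'\<in>S1. \<Union>\<beta>'\<in>S2. coh_class p r 2 (C_mult (cocycle1 (- k) \<alpha>') (cocycle1 k \<beta>')))"
    unfolding coh_mult_def deg H1.coclass_eq H2.coclass_eq S1_def[symmetric] S2_def[symmetric] by blast
  also have "\<dots> = (\<Union>\<alpha>'\<in>S1. \<Union>\<beta>'\<in>S2. ?R)"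
    by (intro SUP_cong refl eq)
  also have "\<dots> = ?R"
    using \<open>\<alpha> \<in> S1\<close> \<open>\<beta> \<in> S2\<close> by blast
  finally show ?thesis .
qed

text \<open>Both factors are cyclic, generated by the classes of the constant functional \<open>1\<close>, so every element
  of the tensor product is \<open>U a \<otimes> y0\<close>. If its image \<open>- a/(rho\<^sup>k - 1)\<close> is integral, then \<open>a\<close> is a
  multiple of \<open>rho\<^sup>k - 1\<close>, hence of \<open>rho\<^bsup>-k\<^esup> - 1\<close>, and \<open>U a = 0\<close>.\<close>

theorem multiplication_injective:
  assumes k: "k \<noteq> 0"
  defines "m \<equiv> q * - k + 1" and "n \<equiv> q * k + 1"
  shows "coh_mult_tensor p r m n \<in>
      hom (tensor_product (Zloc p) (cohomology p r m) (cohomology p r n)) (add_monoid (cohomology p r 2))"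
    and "inj_on (coh_mult_tensor p r m n)
      (carrier (tensor_product (Zloc p) (cohomology p r m) (cohomology p r n)))"
proof -
  interpret H1: cohomology_coordinates p r m "cocycle1 (- k)" integral_functionals "boundary_functionals (- k)"
    unfolding m_def by (rule first_cohomology_coordinates) (simp add: k)
  interpret H2: cohomology_coordinates p r n "cocycle1 k" integral_functionals "boundary_functionals k"
    unfolding n_def by (rule first_cohomology_coordinates) (simp add: k)
  interpret H: cohomology_coordinates p r 2 "\<lambda>\<alpha>. cochain2 0 (\<alpha> 0)" UNIV "{\<alpha>. \<alpha> 0 \<in> Zp}"
    by (rule second_cohomology_coordinates)
  interpret T: tensor_factors "Zloc p" "cohomology p r m" "cohomology p r n"
    by unfold_locales
      (auto simp: H1.carrier_cohomology H2.carrier_cohomology H1.coclass_add H2.coclass_add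
        H1.coclass_scale H2.coclass_scale integral_functionals_add integral_functionals_scale)
  let ?G = "add_monoid (cohomology p r 2)"
  let ?T = "tensor_product (Zloc p) (cohomology p r m) (cohomology p r n)"
  define \<mu> where "\<mu> = (\<lambda>(X, Y). coh_mult p r m n X Y)"
  have \<mu>: "\<mu> (H1.coclass \<alpha>, H2.coclass \<beta>) = H.coclass (\<lambda>_. second_component (- k) \<alpha> * \<beta> 0)"
    if "\<alpha> \<in> integral_functionals" "\<beta> \<in> integral_functionals" for \<alpha> \<beta>
    using coh_mult_cocycle1[OF k that] by (simp add: \<mu>_def m_def n_def)
  have lift: "coh_mult_tensor p r m n = tensor_lift ?G \<mu>"
    by (simp add: coh_mult_tensor_def m_def n_def \<mu>_def)
  have G: "comm_group ?G"
    by (rule H.cohomology_comm_group)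
  have sc_scale: "second_component (- k) (\<lambda>b. c * \<alpha> b) = c * second_component (- k) \<alpha>" for c \<alpha>
    by (simp add: second_component_def)
  have H_carrier: "coh_class p r 2 (cochain2 0 l) \<in> carrier (cohomology p r 2)" for l
    using H.coclass_in_carrier[of "\<lambda>_. l"] by simp
  have H_add: "coh_class p r 2 (cochain2 0 l) \<oplus>\<^bsub>cohomology p r 2\<^esub> coh_class p r 2 (cochain2 0 l') =
      coh_class p r 2 (cochain2 0 (l + l'))" for l l'
    using H.coclass_add[of "\<lambda>_. l" "\<lambda>_. l'"] by simp
  have H_zero: "coh_class p r 2 (cochain2 0 l) = \<zero>\<^bsub>cohomology p r 2\<^esub> \<longleftrightarrow> l \<in> Zp" for l
    using H.coclass_eq_iff[of "\<lambda>_. l" "\<lambda>_. 0"] by (simp add: H.zero_class)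
  have closed: "\<mu> (X, Y) \<in> carrier ?G"
    if "X \<in> carrier (cohomology p r m)" "Y \<in> carrier (cohomology p r n)" for X Y
    using that H_carrier by (auto simp: H1.carrier_cohomology H2.carrier_cohomology \<mu>)
  have left: "\<mu> (X \<oplus>\<^bsub>cohomology p r m\<^esub> X', Y) = \<mu> (X, Y) \<otimes>\<^bsub>?G\<^esub> \<mu> (X', Y)"
    if "X \<in> carrier (cohomology p r m)" "X' \<in> carrier (cohomology p r m)"
      "Y \<in> carrier (cohomology p r n)" for X X' Y
    using that by (auto simp: H1.carrier_cohomology H2.carrier_cohomology \<mu> H1.coclass_add H_add
        integral_functionals_add second_component_add distrib_right)
  have right: "\<mu> (X, Y \<oplus>\<^bsub>cohomology p r n\<^esub> Y') = \<mu> (X, Y) \<otimes>\<^bsub>?G\<^esub> \<mu> (X, Y')"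
    if "X \<in> carrier (cohomology p r m)" "Y \<in> carrier (cohomology p r n)"
      "Y' \<in> carrier (cohomology p r n)" for X Y Y'
    using that by (auto simp: H1.carrier_cohomology H2.carrier_cohomology \<mu> H2.coclass_add H_add
        integral_functionals_add distrib_left)
  have balanced: "\<mu> (c \<odot>\<^bsub>cohomology p r m\<^esub> X, Y) = \<mu> (X, c \<odot>\<^bsub>cohomology p r n\<^esub> Y)"
    if "c \<in> carrier (Zloc p)" "X \<in> carrier (cohomology p r m)" "Y \<in> carrier (cohomology p r n)" for c X Y
    using that by (auto simp: H1.carrier_cohomology H2.carrier_cohomology \<mu> H1.coclass_scale H2.coclass_scale
        integral_functionals_scale sc_scale mult_ac)
  have hom: "tensor_lift ?G \<mu> \<in> hom ?T ?G"
    by (rule T.tensor_lift_universal(1)[OF G closed left right balanced])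
  have lift_frag: "tensor_lift ?G \<mu> (T.cls (frag_of (X, Y))) = \<mu> (X, Y)"
    if "X \<in> carrier (cohomology p r m)" "Y \<in> carrier (cohomology p r n)" for X Y
    by (rule T.tensor_lift_universal(2)[OF G closed left right balanced that])
  show "coh_mult_tensor p r m n \<in> hom ?T ?G"
    unfolding lift by (rule hom)
  define U where "U a = H1.coclass (\<lambda>_. a)" for a
  define y0 where "y0 = H2.coclass (\<lambda>_. 1)"
  have U_in: "U a \<in> carrier (cohomology p r m)" if "a \<in> Zp" for a
    unfolding U_def using that by (intro H1.coclass_in_carrier integral_functionals_const)
  have y0_in: "y0 \<in> carrier (cohomology p r n)"
    unfolding y0_def by (intro H2.coclass_in_carrier integral_functionals_const Zp_1)
  have constant_class: "(\<lambda>b. \<alpha> b - \<alpha> 0) \<in> boundary_functionals T"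
    if "\<alpha> \<in> integral_functionals" "T \<noteq> 0" for \<alpha> T
  proof (rule boundary_functionalI[where z = 0])
    show "(\<lambda>b. \<alpha> b - \<alpha> 0) \<in> integral_functionals"
      by (rule integral_functionals_diff[OF that(1) integral_functionals_const[OF integral_functional_value[OF that(1)]]])
  qed (simp_all add: that(2))
  have U_surj: "\<exists>a\<in>Zp. X = U a" if X: "X \<in> carrier (cohomology p r m)" for X
  proof -
    obtain \<alpha> where "\<alpha> \<in> integral_functionals" "X = H1.coclass \<alpha>"
      using X by (auto simp: H1.carrier_cohomology)
    then show ?thesis
      using constant_class[of \<alpha> "- k"] k integral_functional_value[of \<alpha> 0]
      by (intro bexI[of _ "\<alpha> 0"]) (simp_all add: U_def H1.coclass_eq_iff)
  qed
  have y0_generates: "\<exists>a\<in>Zp. Y = a \<odot>\<^bsub>cohomology p r n\<^esub> y0" if Y: "Y \<in> carrier (cohomology p r n)" for Y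
  proof -
    obtain \<beta> where "\<beta> \<in> integral_functionals" "Y = H2.coclass \<beta>"
      using Y by (auto simp: H2.carrier_cohomology)
    then show ?thesis
      using constant_class[of \<beta> k] k integral_functional_value[of \<beta> 0]
      by (intro bexI[of _ "\<beta> 0"]) (simp_all add: y0_def H2.coclass_scale H2.coclass_eq_iff)
  qed
  have U_add: "U (a + b) = U a \<oplus>\<^bsub>cohomology p r m\<^esub> U b" for a b
    by (simp add: U_def H1.coclass_add)
  have U_scale: "a \<odot>\<^bsub>cohomology p r m\<^esub> U b = U (a * b)" if "a \<in> Zp" for a b
    using that by (simp add: U_def H1.coclass_scale)
  show "inj_on (coh_mult_tensor p r m n) (carrier ?T)"
    unfolding lift
  proof (subst inj_on_one_iff'[OF hom])
    show "group ?T" by (rule T.T.group_axioms)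
    show "group ?G" by (rule comm_group.axioms(2)[OF G])
    show "\<forall>X. X \<in> carrier ?T \<longrightarrow> tensor_lift ?G \<mu> X = \<one>\<^bsub>?G\<^esub> \<longrightarrow> X = \<one>\<^bsub>?T\<^esub>"
    proof (intro allI impI)
      fix X assume X: "X \<in> carrier ?T" and X1: "tensor_lift ?G \<mu> X = \<one>\<^bsub>?G\<^esub>"
      obtain c where c: "X = T.cls c" "keys c \<subseteq> carrier (cohomology p r m) \<times> carrier (cohomology p r n)"
        using X by (auto simp: T.carrier_tensor_product)
      obtain a where a: "a \<in> Zp" "c - frag_of (U a, y0) \<in> T.rels"
        using tensor_product_cyclic[OF T.tensor_factors_axioms, of U y0 c] c(2) U_in U_surj U_add U_scale
          y0_in y0_generates by (auto simp: Zp_diff Zp_mult)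
      have Ua: "keys (frag_of (U b, y0)) \<subseteq> carrier (cohomology p r m) \<times> carrier (cohomology p r n)"
        if "b \<in> Zp" for b
        using U_in[OF that] y0_in by simp
      have Xa: "X = T.cls (frag_of (U a, y0))"
        using T.cls_eq_iff[OF c(2) Ua[OF a(1)]] a(2) c(1) by simp
      then have "\<mu> (U a, y0) = \<zero>\<^bsub>cohomology p r 2\<^esub>"
        using X1 lift_frag[OF U_in[OF a(1)] y0_in] by simp
      then have s: "second_component (- k) (\<lambda>_. a) \<in> Zp"
        using a(1) by (simp add: U_def y0_def \<mu> integral_functionals_const H_zero)
      define s where "s = second_component (- k) (\<lambda>_. a)"
      have "(rho powi k - 1) * s = - a"
        using rho_powi_nontrivial[OF k] by (simp add: s_def second_component_def)
      moreover have "rho powi - k * rho powi k = 1"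
        by (simp flip: power_int_add)
      ultimately have a_eq: "a = (rho powi - k - 1) * (rho powi k * s)"
        by (simp add: algebra_simps)
      have "(\<lambda>_. a - 0) \<in> boundary_functionals (- k)"
      proof (rule boundary_functionalI)
        show "a - 0 = (rho powi - k - 1) * (rho powi k * s)"
          using a_eq by simp
        show "rho powi k * s \<in> Zp"
          unfolding s_def by (intro Zp_mult s one_units_Zp one_units_powi rho_one_units)
      qed (use a(1) k in \<open>simp_all add: integral_functionals_const\<close>)
      then have "U a = U 0"
        by (simp add: U_def H1.coclass_eq_iff)
      moreover have "frag_of (U 0, y0) \<in> T.rels"
        using T.rels_uminus[OF T.rels_add_left[of "U 0" "U 0" y0]] U_in[OF Zp_0] y0_in U_add[of 0 0] by simp
      ultimately have "X = T.cls 0"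
        using T.cls_eq_iff[OF Ua[OF a(1)], of 0] Xa by simp
      then show "X = \<one>\<^bsub>?T\<^esub>"
        using hom_one[OF T.cls_hom] T.F.group_axioms T.T.group_axioms by simp
    qed
  qed
qed

end

lemma primitive_root_power:
  fixes r :: int
  assumes p: "prime p" and gen: "generate (units_of (residue_ring (int p ^ 2))) {r mod int p ^ 2} =
         carrier (units_of (residue_ring (int p ^ 2)))"
    and r: "r mod int p ^ 2 \<in> carrier (units_of (residue_ring (int p ^ 2)))"
    and y: "\<not> int p dvd y"
  shows "\<exists>j::nat. [r ^ j = y] (mod int p ^ 2)"
proof -
  have gt1: "1 < int p ^ 2"
    using prime_gt_1_nat[OF p] by (intro one_less_power) simp_all
  interpret residues "int p ^ 2" "residue_ring (int p ^ 2)"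
    by unfold_locales (rule gt1, simp)
  let ?R = "residue_ring (int p ^ 2)"
  interpret U: group "units_of ?R"
    by (rule units_group)
  have fin: "finite (carrier (units_of ?R))"
    by (simp add: units_of_carrier)
  have "coprime (int p) y"
    using y p by (simp add: prime_imp_coprime)
  then have "coprime y (int p ^ 2)"
    by (simp add: coprime_commute)
  then have "y mod int p ^ 2 \<in> Units ?R"
    using gt1 by (rule mod_in_res_units[rotated])
  then have "y mod int p ^ 2 \<in> generate (units_of ?R) {r mod int p ^ 2}"
    unfolding gen units_of_carrier .
  then obtain j :: nat where j: "y mod int p ^ 2 = (r mod int p ^ 2) [^]\<^bsub>units_of ?R\<^esub> j"
    unfolding U.generate_pow_on_finite_carrier[OF fin r] by blast
  have "(r mod int p ^ 2) [^]\<^bsub>units_of ?R\<^esub> i = (r mod int p ^ 2) [^]\<^bsub>?R\<^esub> i" for i :: nat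
    by (induction i) (simp_all add: units_of_mult units_of_one)
  then have "y mod int p ^ 2 = r ^ j mod int p ^ 2"
    unfolding j pow_cong[symmetric] by simp
  then show ?thesis
    unfolding cong_def by (intro exI[of _ j]) simp
qed

theorem corollary13:
  fixes p :: nat and r k :: int
  assumes "prime p" and "odd p"
    and "r mod int p ^ 2 \<in> carrier (units_of (residue_ring (int p ^ 2)))"
    and "generate (units_of (residue_ring (int p ^ 2))) {r mod int p ^ 2} =
         carrier (units_of (residue_ring (int p ^ 2)))"
    and "k \<noteq> 0"
  shows "coh_mult_tensor p r (- (2 * int p - 2) * k + 1) ((2 * int p - 2) * k + 1)
           \<in> hom (tensor_product (Zloc p)
                    (cohomology p r (- (2 * int p - 2) * k + 1))
                    (cohomology p r ((2 * int p - 2) * k + 1)))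
                 (add_monoid (cohomology p r 2)) \<and>
         inj_on (coh_mult_tensor p r (- (2 * int p - 2) * k + 1) ((2 * int p - 2) * k + 1))
           (carrier (tensor_product (Zloc p)
                       (cohomology p r (- (2 * int p - 2) * k + 1))
                       (cohomology p r ((2 * int p - 2) * k + 1))))"
proof -
  interpret adams_generator p r
    using assms(1,2) primitive_root_power[OF assms(1,4,3)] by unfold_locales
  have degree: "- (2 * int p - 2) * k + 1 = (2 * int p - 2) * - k + 1"
    by (simp add: algebra_simps)
  show ?thesis
    unfolding degree by (intro conjI multiplication_injective assms(5))
qed

end
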